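(* Let $n \geq 3$ and let $M$ be a compact, connected surface (possibly with boundary) different from the sphere $S^2$ and the real projective plane $\mathbb{R}P^2$. If $H$ is a subgroup of $B_n(M)$ with $P_n(M) \subsetneq H \subset B_n(M)$, then $H$ is not bi-orderable.
   Context: For a surface $M$, $F_n(M)=\{(z_1,\dots,z_n)\in M^n : z_i\neq z_j \text{ for } i\neq j\}$ is the ordered configuration space and $C_n(M)=F_n(M)/S_n$ the unordered configuration space (quotient by permuting coordinates). The pure braid group is $P_n(M)=\pi_1(F_n(M))$ and the braid group is $B_n(M)=\pi_1(C_n(M))$; $P_n(M)$ is the kernel of the permutation homomorphism $B_n(M)\to S_n$ induced by the covering $F_n(M)\to C_n(M)$. A group is bi-orderable if it admits a strict total ordering $<$ such that $x<y$ implies $gx<gy$ and $xg<yg$ for all $x,y,g$. *)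

theory Defs
  imports "HOL-Analysis.Analysis" "HOL-Algebra.Group"
begin

lemma istopology_quotient:
  "istopology (\<lambda>U. U \<subseteq> f ` topspace X \<and> openin X {x \<in> topspace X. f x \<in> U})"
  unfolding istopology_def
proof (rule conjI; intro allI impI)
  fix S T assume S: "S \<subseteq> f ` topspace X \<and> openin X {x \<in> topspace X. f x \<in> S}"
    and T: "T \<subseteq> f ` topspace X \<and> openin X {x \<in> topspace X. f x \<in> T}"
  have "{x \<in> topspace X. f x \<in> S \<inter> T} =
        {x \<in> topspace X. f x \<in> S} \<inter> {x \<in> topspace X. f x \<in> T}" by auto
  then show "S \<inter> T \<subseteq> f ` topspace X \<and> openin X {x \<in> topspace X. f x \<in> S \<inter> T}"
    using S T by (simp add: openin_Int le_infI1)
next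
  fix K assume K: "\<forall>U\<in>K. U \<subseteq> f ` topspace X \<and> openin X {x \<in> topspace X. f x \<in> U}"
  have "{x \<in> topspace X. f x \<in> \<Union>K} = \<Union>((\<lambda>U. {x \<in> topspace X. f x \<in> U}) ` K)" by auto
  then show "\<Union>K \<subseteq> f ` topspace X \<and> openin X {x \<in> topspace X. f x \<in> \<Union>K}"
    using K by (auto intro!: openin_Union)
qed

definition quotient_topology :: "'a topology \<Rightarrow> ('a \<Rightarrow> 'b) \<Rightarrow> 'b topology" where
  "quotient_topology X f =
     topology (\<lambda>U. U \<subseteq> f ` topspace X \<and> openin X {x \<in> topspace X. f x \<in> U})"

definition closed_half_plane :: "(real \<times> real) set" where
  "closed_half_plane = {p. snd p \<ge> 0}"

definition surface_with_boundary :: "'a topology \<Rightarrow> bool" where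
  "surface_with_boundary X \<longleftrightarrow> Hausdorff_space X \<and> second_countable X \<and>
     (\<forall>x \<in> topspace X. \<exists>U V. openin X U \<and> x \<in> U \<and>
         openin (top_of_set closed_half_plane) V \<and>
         subtopology X U homeomorphic_space top_of_set V)"

definition sphere2 :: "(real^3) topology" where
  "sphere2 = top_of_set (sphere 0 1)"

definition real_projective_plane :: "(real^3) set topology" where
  "real_projective_plane = quotient_topology sphere2 (\<lambda>x. {x, -x})"

definition ordered_config :: "'a topology \<Rightarrow> nat \<Rightarrow> (nat \<Rightarrow> 'a) topology" where
  "ordered_config X n = subtopology (product_topology (\<lambda>_. X) {..<n})
                                    {z. inj_on z {..<n}}"

text \<open>Unordered configuration space C_n(M) = F_n(M)/S_n; a configuration is identified
  with its (n-element) set of points, which is exactly the S_n-orbit.\<close>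
definition unordered_config :: "'a topology \<Rightarrow> nat \<Rightarrow> 'a set topology" where
  "unordered_config X n = quotient_topology (ordered_config X n) (\<lambda>z. z ` {..<n})"

definition loopin :: "'a topology \<Rightarrow> 'a \<Rightarrow> (real \<Rightarrow> 'a) \<Rightarrow> bool" where
  "loopin X x0 g \<longleftrightarrow> pathin X g \<and> g 0 = x0 \<and> g 1 = x0"

definition loop_class :: "'a topology \<Rightarrow> 'a \<Rightarrow> (real \<Rightarrow> 'a) \<Rightarrow> (real \<Rightarrow> 'a) set" where
  "loop_class X x0 g = {h. loopin X x0 h \<and>
      homotopic_with (\<lambda>k. k 0 = x0 \<and> k 1 = x0) (top_of_set {0..1}) X g h}"

definition loop_join :: "(real \<Rightarrow> 'a) \<Rightarrow> (real \<Rightarrow> 'a) \<Rightarrow> real \<Rightarrow> 'a" where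
  "loop_join p q t = (if t \<le> 1/2 then p (2 * t) else q (2 * t - 1))"

definition fundamental_group :: "'a topology \<Rightarrow> 'a \<Rightarrow> (real \<Rightarrow> 'a) set monoid" where
  "fundamental_group X x0 =
     \<lparr> carrier = {loop_class X x0 g | g. loopin X x0 g},
       mult = (\<lambda>A B. loop_class X x0 (loop_join (SOME p. p \<in> A) (SOME q. q \<in> B))),
       one = loop_class X x0 (\<lambda>_. x0) \<rparr>"

definition braid_group :: "'a topology \<Rightarrow> nat \<Rightarrow> (nat \<Rightarrow> 'a) \<Rightarrow> (real \<Rightarrow> 'a set) set monoid" where
  "braid_group X n b = fundamental_group (unordered_config X n) (b ` {..<n})"

text \<open>P_n(M) = pi_1(F_n(M), b), viewed as a subgroup of B_n(M) via the covering map
  F_n(M) -> C_n(M) (which induces an injection on fundamental groups).\<close>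
definition pure_braid_subgroup :: "'a topology \<Rightarrow> nat \<Rightarrow> (nat \<Rightarrow> 'a) \<Rightarrow> (real \<Rightarrow> 'a set) set set" where
  "pure_braid_subgroup X n b =
     {loop_class (unordered_config X n) (b ` {..<n}) (\<lambda>t. g t ` {..<n}) | g.
        loopin (ordered_config X n) b g}"

definition biorderable :: "('g, 'b) monoid_scheme \<Rightarrow> bool" where
  "biorderable G \<longleftrightarrow> (\<exists>r :: 'g \<Rightarrow> 'g \<Rightarrow> bool.
      (\<forall>x \<in> carrier G. \<not> r x x) \<and>
      (\<forall>x \<in> carrier G. \<forall>y \<in> carrier G. \<forall>z \<in> carrier G. r x y \<longrightarrow> r y z \<longrightarrow> r x z) \<and>
      (\<forall>x \<in> carrier G. \<forall>y \<in> carrier G. x \<noteq> y \<longrightarrow> r x y \<or> r y x) \<and>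
      (\<forall>x \<in> carrier G. \<forall>y \<in> carrier G. \<forall>g \<in> carrier G. r x y \<longrightarrow>
          r (g \<otimes>\<^bsub>G\<^esub> x) (g \<otimes>\<^bsub>G\<^esub> y) \<and> r (x \<otimes>\<^bsub>G\<^esub> g) (y \<otimes>\<^bsub>G\<^esub> g)))"

end

theory Submission
  imports Defs "HOL-Combinatorics.Orbits" "HOL-Combinatorics.Cycles"
begin

text \<open>Suppose \<open>H\<close> is bi-ordered. An element of \<open>H\<close> outside \<open>P\<^sub>n\<close> induces a nontrivial permutation
  \<open>p\<close>, and since \<open>P\<^sub>n \<subseteq> H\<close>, every braid with permutation \<open>p\<close> lies in \<open>H\<close>. One such braid is the
  rotation \<open>x\<close> of points placed in a chart on circles around the origin, one circle for each cycle
  of \<open>p\<close>. Let \<open>y\<close> be the pure braid in which a point \<open>j\<close> runs around a nearby point \<open>l\<close>. Some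
  power of \<open>x\<close> consists of full turns and commutes with \<open>y\<close>; in a bi-ordered group \<open>x\<close> itself then
  commutes with \<open>y\<close>. Hence \<open>y\<close> equals its conjugate by \<open>x\<close>, where the strand \<open>p j\<close> runs around \<open>p
  l\<close>.

  Contracting the latter loop while allowing \<open>p j\<close> to hit \<open>p l\<close> gives a family of configurations
  over a disc, in which the strands outside \<open>{j, p j, p l}\<close> can be made constant by an ambient
  isotopy. Thus the loop of \<open>j\<close> around \<open>l\<close> is null-homotopic in \<open>M\<close> minus the base points of those
  strands. If there are two or more of them, this contradicts winding numbers. If \<open>l\<close> is the only
  one, it makes the double rotation trivial, as in \<open>SU(2)\<close>, so that a power of \<open>x\<close> is trivial;
  then \<open>x = 1\<close> because bi-ordered groups are torsion free, although \<open>x\<close> induces \<open>p\<close>.\<close>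

section \<open>Path homotopy\<close>

lemma continuous_map_compose_on:
  assumes "continuous_map (top_of_set B) X f" "continuous_on A g" "g \<in> A \<rightarrow> B"
  shows "continuous_map (top_of_set A) X (\<lambda>x. f (g x))"
proof -
  have "continuous_map (top_of_set A) (top_of_set B) g"
    using assms by auto
  from continuous_map_compose[OF this assms(1)] show ?thesis by (simp add: o_def)
qed

lemma continuous_map_top_of_set_cases_le:
  fixes A :: "'b::topological_space set" and p q :: "'b \<Rightarrow> real"
  assumes "continuous_on A p" "continuous_on A q"
    and "continuous_map (top_of_set {x \<in> A. p x \<le> q x}) X f"
    and "continuous_map (top_of_set {x \<in> A. q x \<le> p x}) X g"
    and "\<And>x. \<lbrakk>x \<in> A; p x = q x\<rbrakk> \<Longrightarrow> f x = g x"
  shows "continuous_map (top_of_set A) X (\<lambda>x. if p x \<le> q x then f x else g x)"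
proof (rule continuous_map_cases_le)
  have "A \<inter> {x \<in> A. p x \<le> q x} = {x \<in> A. p x \<le> q x}"
    "A \<inter> {x \<in> A. q x \<le> p x} = {x \<in> A. q x \<le> p x}"
    by auto
  with assms(3,4)
  show "continuous_map (subtopology (top_of_set A) {x \<in> topspace (top_of_set A). p x \<le> q x}) X f"
    and "continuous_map (subtopology (top_of_set A) {x \<in> topspace (top_of_set A). q x \<le> p x}) X g"
    by (simp_all add: subtopology_subtopology)
qed (use assms in auto)

lemma pathin_in_topspace: "pathin X p \<Longrightarrow> t \<in> {0..1} \<Longrightarrow> p t \<in> topspace X"
  unfolding pathin_def continuous_map_def by auto

lemma pathin_continuous_image:
  "\<lbrakk>pathin X p; continuous_map X Y f\<rbrakk> \<Longrightarrow> pathin Y (\<lambda>t. f (p t))"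
  using pathin_compose[of X p Y f] by (simp add: o_def)

lemma pathin_reparametrize:
  "\<lbrakk>continuous_map (top_of_set A) X f; continuous_on {0..1} u; u \<in> {0..1} \<rightarrow> A\<rbrakk>
    \<Longrightarrow> pathin X (\<lambda>t. f (u t))"
  unfolding pathin_def by (rule continuous_map_compose_on)

abbreviation unit_square :: "(real \<times> real) set" where
  "unit_square \<equiv> {0..1} \<times> {0..1}"

lemma prod_topology_top_of_set:
  "prod_topology (top_of_set A) (top_of_set B) = top_of_set (A \<times> B)"
  by (simp flip: subtopology_Times)

definition path_homotopic :: "'a topology \<Rightarrow> (real \<Rightarrow> 'a) \<Rightarrow> (real \<Rightarrow> 'a) \<Rightarrow> bool" where
  "path_homotopic X p q \<longleftrightarrow>
     homotopic_with (\<lambda>k. k 0 = p 0 \<and> k 1 = p 1) (top_of_set {0..1}) X p q"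

lemma path_homotopic_iff_square:
  "path_homotopic X p q \<longleftrightarrow>
    (\<exists>S. continuous_map (top_of_set unit_square) X S \<and>
      (\<forall>t\<in>{0..1}. S (0, t) = p t) \<and> (\<forall>t\<in>{0..1}. S (1, t) = q t) \<and>
      (\<forall>s\<in>{0..1}. S (s, 0) = p 0 \<and> S (s, 1) = p 1))"
  unfolding path_homotopic_def
  by (subst homotopic_with) (simp_all add: prod_topology_top_of_set)

lemma path_homotopicI:
  assumes "continuous_map (top_of_set unit_square) X S"
    and "\<And>t. t \<in> {0..1} \<Longrightarrow> S (0, t) = p t" "\<And>t. t \<in> {0..1} \<Longrightarrow> S (1, t) = q t"
    and "\<And>s. s \<in> {0..1} \<Longrightarrow> S (s, 0) = p 0" "\<And>s. s \<in> {0..1} \<Longrightarrow> S (s, 1) = p 1"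
  shows "path_homotopic X p q"
  unfolding path_homotopic_iff_square using assms by blast

lemma path_homotopicE:
  assumes "path_homotopic X p q"
  obtains S where "continuous_map (top_of_set unit_square) X S"
    "\<And>t. t \<in> {0..1} \<Longrightarrow> S (0, t) = p t" "\<And>t. t \<in> {0..1} \<Longrightarrow> S (1, t) = q t"
    "\<And>s. s \<in> {0..1} \<Longrightarrow> S (s, 0) = p 0" "\<And>s. s \<in> {0..1} \<Longrightarrow> S (s, 1) = p 1"
  using assms unfolding path_homotopic_iff_square by (elim exE conjE) (simp only: Ball_def)

lemma path_homotopicD:
  assumes "path_homotopic X p q"
  shows "pathin X p" "pathin X q" "q 0 = p 0" "q 1 = p 1"
  using homotopic_with_imp_continuous_maps[OF assms[unfolded path_homotopic_def]]
    homotopic_with_imp_property[OF assms[unfolded path_homotopic_def]]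
  by (auto simp: pathin_def)

lemma path_homotopic_eq:
  "\<lbrakk>pathin X p; \<And>t. t \<in> {0..1} \<Longrightarrow> q t = p t\<rbrakk> \<Longrightarrow> path_homotopic X p q"
  unfolding path_homotopic_def pathin_def by (rule homotopic_with_equal) auto

lemma path_homotopic_refl [simp]: "path_homotopic X p p \<longleftrightarrow> pathin X p"
  by (simp add: path_homotopic_def pathin_def)

lemma path_homotopic_sym: "path_homotopic X p q \<Longrightarrow> path_homotopic X q p"
  using path_homotopicD(3,4)[of X p q] unfolding path_homotopic_def
  by (simp add: homotopic_with_symD)

lemma path_homotopic_trans [trans]:
  assumes "path_homotopic X p q" "path_homotopic X q r"
  shows "path_homotopic X p r"
  using assms homotopic_with_trans path_homotopicD(3,4)[OF assms(1)]
  unfolding path_homotopic_def by fastforce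

lemma path_homotopic_continuous_image:
  "\<lbrakk>path_homotopic X p q; continuous_map X Y f\<rbrakk>
    \<Longrightarrow> path_homotopic Y (\<lambda>t. f (p t)) (\<lambda>t. f (q t))"
  unfolding path_homotopic_def
  by (drule (1) homotopic_with_compose_continuous_map_left) (auto simp: o_def)

proposition path_homotopic_through_convex:
  fixes C :: "'b::real_normed_vector set"
  assumes G: "continuous_map (top_of_set C) X G" and C: "convex C"
    and u: "continuous_on {0..1} u" "u \<in> {0..1} \<rightarrow> C"
    and v: "continuous_on {0..1} v" "v \<in> {0..1} \<rightarrow> C"
    and ends: "u 0 = v 0" "u 1 = v 1"
    and p: "\<And>t. t \<in> {0..1} \<Longrightarrow> p t = G (u t)" and q: "\<And>t. t \<in> {0..1} \<Longrightarrow> q t = G (v t)"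
  shows "path_homotopic X p q"
proof (rule path_homotopicI)
  let ?w = "\<lambda>x::real \<times> real. (1 - fst x) *\<^sub>R u (snd x) + fst x *\<^sub>R v (snd x)"
  show "continuous_map (top_of_set unit_square) X (\<lambda>x. G (?w x))"
  proof (rule continuous_map_compose_on[OF G])
    show "continuous_on unit_square ?w"
      by (intro continuous_intros continuous_on_compose2[OF u(1)] continuous_on_compose2[OF v(1)])
        auto
    show "?w \<in> unit_square \<rightarrow> C"
    proof
      fix x :: "real \<times> real" assume "x \<in> unit_square"
      then have "u (snd x) \<in> C" "v (snd x) \<in> C" "0 \<le> fst x" "fst x \<le> 1"
        using u(2) v(2) by auto
      then show "?w x \<in> C"
        using C by (simp add: convex_alt)
    qed
  qed
  have "(1 - s) *\<^sub>R v t + s *\<^sub>R v t = v t" for s t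
    by (simp flip: scaleR_left_distrib)
  then show "G (?w (s, 0)) = p 0" "G (?w (s, 1)) = p 1" for s
    using p[of 0] p[of 1] ends by simp_all
qed (use p q in auto)

corollary path_homotopic_reparametrize:
  assumes "pathin X p" "continuous_on {0..1} u" "u \<in> {0..1} \<rightarrow> {0..1}" "u 0 = 0" "u 1 = 1"
    and "\<And>t. t \<in> {0..1} \<Longrightarrow> q t = p (u t)"
  shows "path_homotopic X q p"
  by (rule path_homotopic_through_convex[OF assms(1)[unfolded pathin_def], of u "\<lambda>t. t"])
    (use assms in auto)

section \<open>Concatenation of paths and the fundamental group\<close>

notation loop_join (infixr "\<frown>" 65)

definition path_reverse :: "(real \<Rightarrow> 'a) \<Rightarrow> real \<Rightarrow> 'a" where
  "path_reverse p = (\<lambda>t. p (1 - t))"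

lemma loop_join_ends [simp]: "(p \<frown> q) 0 = p 0" "(p \<frown> q) 1 = q 1"
  by (simp_all add: loop_join_def)

lemma path_reverse_ends [simp]: "path_reverse p 0 = p 1" "path_reverse p 1 = p 0"
  by (simp_all add: path_reverse_def)

lemma path_reverse_reverse [simp]: "path_reverse (path_reverse p) = p"
  by (simp add: path_reverse_def)

lemma loop_join_image: "(\<lambda>t. f ((p \<frown> q) t)) = (\<lambda>t. f (p t)) \<frown> (\<lambda>t. f (q t))"
  by (auto simp: loop_join_def)

lemma path_reverse_image: "(\<lambda>t. f (path_reverse p t)) = path_reverse (\<lambda>t. f (p t))"
  by (simp add: path_reverse_def)

lemma pathin_reverse [simp]: "pathin X (path_reverse p) \<longleftrightarrow> pathin X p"
proof -
  have "pathin X (path_reverse p)" if "pathin X p" for p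
    using that unfolding path_reverse_def pathin_def
    by (rule continuous_map_compose_on) (auto intro!: continuous_intros)
  from this[of p] this[of "path_reverse p"] show ?thesis by auto
qed

lemma pathin_join [simp]:
  assumes "pathin X p" "pathin X q" "p 1 = q 0"
  shows "pathin X (p \<frown> q)"
proof -
  have "p (2 * t) = q (2 * t - 1)" if "t = 1/2" for t
    using assms(3) by (simp add: that)
  moreover have "continuous_map (top_of_set {t \<in> {0..1}. t \<le> 1/2}) X (\<lambda>t. p (2 * t))"
    by (rule continuous_map_compose_on[OF assms(1)[unfolded pathin_def]])
      (auto intro!: continuous_intros)
  moreover have "continuous_map (top_of_set {t \<in> {0..1}. 1/2 \<le> t}) X (\<lambda>t. q (2 * t - 1))"
    by (rule continuous_map_compose_on[OF assms(2)[unfolded pathin_def]])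
      (auto intro!: continuous_intros)
  ultimately show ?thesis
    unfolding pathin_def loop_join_def
    by (intro continuous_map_top_of_set_cases_le continuous_intros) auto
qed

lemma path_homotopic_join:
  assumes "path_homotopic X p p'" "path_homotopic X q q'" "p 1 = q 0"
  shows "path_homotopic X (p \<frown> q) (p' \<frown> q')"
proof -
  obtain S where S: "continuous_map (top_of_set unit_square) X S"
    "\<And>t. t \<in> {0..1} \<Longrightarrow> S (0, t) = p t" "\<And>t. t \<in> {0..1} \<Longrightarrow> S (1, t) = p' t"
    "\<And>s. s \<in> {0..1} \<Longrightarrow> S (s, 0) = p 0" "\<And>s. s \<in> {0..1} \<Longrightarrow> S (s, 1) = p 1"
    using path_homotopicE[OF assms(1)] by blast
  obtain T where T: "continuous_map (top_of_set unit_square) X T"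
    "\<And>t. t \<in> {0..1} \<Longrightarrow> T (0, t) = q t" "\<And>t. t \<in> {0..1} \<Longrightarrow> T (1, t) = q' t"
    "\<And>s. s \<in> {0..1} \<Longrightarrow> T (s, 0) = q 0" "\<And>s. s \<in> {0..1} \<Longrightarrow> T (s, 1) = q 1"
    using path_homotopicE[OF assms(2)] by blast
  show ?thesis
  proof (rule path_homotopicI)
    have "S (fst x, 2 * snd x) = T (fst x, 2 * snd x - 1)"
      if "x \<in> unit_square" "snd x = 1/2" for x
      using that S(5)[of "fst x"] T(4)[of "fst x"] assms(3) by (auto simp: that(2))
    moreover have "continuous_map (top_of_set {x \<in> unit_square. snd x \<le> 1/2}) X
        (\<lambda>x. S (fst x, 2 * snd x))"
      by (rule continuous_map_compose_on[OF S(1)]) (auto intro!: continuous_intros)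
    moreover have "continuous_map (top_of_set {x \<in> unit_square. 1/2 \<le> snd x}) X
        (\<lambda>x. T (fst x, 2 * snd x - 1))"
      by (rule continuous_map_compose_on[OF T(1)]) (auto intro!: continuous_intros)
    ultimately show "continuous_map (top_of_set unit_square) X
        (\<lambda>x. if snd x \<le> 1/2 then S (fst x, 2 * snd x) else T (fst x, 2 * snd x - 1))"
      by (intro continuous_map_top_of_set_cases_le continuous_intros) auto
  qed (use S T in \<open>auto simp: loop_join_def\<close>)
qed

lemma path_homotopic_assoc:
  assumes "pathin X p" "pathin X q" "pathin X r" "p 1 = q 0" "q 1 = r 0"
  shows "path_homotopic X ((p \<frown> q) \<frown> r) (p \<frown> q \<frown> r)"
proof (rule path_homotopic_reparametrize)
  let ?u = "\<lambda>t::real. min (2 * t) (min (t + 1/4) ((t + 1) / 2))"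
  show "((p \<frown> q) \<frown> r) t = (p \<frown> q \<frown> r) (?u t)" if "t \<in> {0..1}" for t
  proof -
    consider "t = 1/2" | "t = 1/4" | "t < 1/4" | "1/4 < t" "t < 1/2" | "1/2 < t"
      by linarith
    then show ?thesis
      by cases (use assms(4,5) in \<open>auto simp: loop_join_def min_def add_divide_distrib\<close>)
  qed
qed (use assms in \<open>auto simp: min_le_iff_disj intro!: continuous_intros\<close>)

lemma path_homotopic_const_join:
  assumes "pathin X p" "p 0 = x"
  shows "path_homotopic X ((\<lambda>_. x) \<frown> p) p"
proof (rule path_homotopic_reparametrize[OF assms(1)])
  show "((\<lambda>_. x) \<frown> p) t = p (max 0 (2 * t - 1))" for t
    using assms(2) by (cases t "1/2::real" rule: linorder_cases) (auto simp: loop_join_def)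
qed (auto intro!: continuous_intros)

lemma path_homotopic_join_const:
  assumes "pathin X p" "p 1 = x"
  shows "path_homotopic X (p \<frown> (\<lambda>_. x)) p"
proof (rule path_homotopic_reparametrize[OF assms(1)])
  show "(p \<frown> (\<lambda>_. x)) t = p (min (2 * t) 1)" for t
    using assms(2) by (auto simp: loop_join_def min_def)
qed (auto intro!: continuous_intros)

lemma path_homotopic_join_reverse:
  assumes "pathin X p"
  shows "path_homotopic X (p \<frown> path_reverse p) (\<lambda>_. p 0)"
proof (rule path_homotopic_through_convex[OF assms[unfolded pathin_def],
      where u = "\<lambda>t. min (2 * t) (2 - 2 * t)" and v = "\<lambda>_. 0"])
  show "(p \<frown> path_reverse p) t = p (min (2 * t) (2 - 2 * t))" for t
    by (auto simp: loop_join_def path_reverse_def min_def)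
qed (auto intro!: continuous_intros)

lemma path_homotopic_reverse_join:
  "pathin X p \<Longrightarrow> path_homotopic X (path_reverse p \<frown> p) (\<lambda>_. p 1)"
  using path_homotopic_join_reverse[of X "path_reverse p"] by simp

lemma path_homotopic_square:
  assumes "continuous_map (top_of_set unit_square) X S"
  shows "path_homotopic X ((\<lambda>t. S (t, 0)) \<frown> (\<lambda>t. S (1, t))) ((\<lambda>t. S (0, t)) \<frown> (\<lambda>t. S (t, 1)))"
proof (rule path_homotopic_through_convex[OF assms,
      where u = "\<lambda>t. (min (2 * t) 1, max 0 (2 * t - 1))"
        and v = "\<lambda>t. (max 0 (2 * t - 1), min (2 * t) 1)"])
  show "((\<lambda>t. S (t, 0)) \<frown> (\<lambda>t. S (1, t))) t = S (min (2 * t) 1, max 0 (2 * t - 1))"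
    and "((\<lambda>t. S (0, t)) \<frown> (\<lambda>t. S (t, 1))) t = S (max 0 (2 * t - 1), min (2 * t) 1)" for t
    by (cases t "1/2::real" rule: linorder_cases; auto simp: loop_join_def)+
qed (auto intro!: continuous_intros convex_Times)

lemma loop_class_eq_path_homotopic:
  assumes "loopin X x p"
  shows "loop_class X x p = {q. path_homotopic X p q}"
proof -
  have "path_homotopic X p q \<longleftrightarrow>
      homotopic_with (\<lambda>k. k 0 = x \<and> k 1 = x) (top_of_set {0..1}) X p q" for q
    using assms by (simp add: path_homotopic_def loopin_def)
  moreover have "loopin X x q" if "path_homotopic X p q" for q
    using path_homotopicD[OF that] assms by (simp add: loopin_def)
  ultimately show ?thesis
    unfolding loop_class_def by blast
qed

lemma loop_class_eq_iff:
  assumes "loopin X x p" "loopin X x q"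
  shows "loop_class X x p = loop_class X x q \<longleftrightarrow> path_homotopic X p q"
proof -
  have "path_homotopic X q q"
    using assms(2) by (simp add: loopin_def)
  then show ?thesis
    unfolding loop_class_eq_path_homotopic[OF assms(1)] loop_class_eq_path_homotopic[OF assms(2)]
    by (auto intro: path_homotopic_sym path_homotopic_trans)
qed

lemma loopin_join: "\<lbrakk>loopin X x p; loopin X x q\<rbrakk> \<Longrightarrow> loopin X x (p \<frown> q)"
  by (simp add: loopin_def)

lemma loop_class_in_fundamental_group:
  "loopin X x p \<Longrightarrow> loop_class X x p \<in> carrier (fundamental_group X x)"
  unfolding fundamental_group_def by auto

lemma fundamental_groupE:
  assumes "A \<in> carrier (fundamental_group X x)"
  obtains p where "A = loop_class X x p" "loopin X x p"
  using assms unfolding fundamental_group_def by auto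

lemma fundamental_group_one: "\<one>\<^bsub>fundamental_group X x\<^esub> = loop_class X x (\<lambda>_. x)"
  by (simp add: fundamental_group_def)

lemma fundamental_group_mult:
  assumes "loopin X x p" "loopin X x q"
  shows "loop_class X x p \<otimes>\<^bsub>fundamental_group X x\<^esub> loop_class X x q = loop_class X x (p \<frown> q)"
proof -
  have rep: "path_homotopic X p (SOME q. q \<in> loop_class X x p)
      \<and> loopin X x (SOME q. q \<in> loop_class X x p)"
    if "loopin X x p" for p
  proof (rule someI2[of "\<lambda>q. q \<in> loop_class X x p" p])
    show "p \<in> loop_class X x p"
      using that by (simp add: loop_class_eq_path_homotopic loopin_def)
    show "path_homotopic X p q \<and> loopin X x q" if "q \<in> loop_class X x p" for q
      using that loop_class_eq_path_homotopic[OF \<open>loopin X x p\<close>] by (auto simp: loop_class_def)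
  qed
  have "loopin X x (p \<frown> q)"
    using assms by (rule loopin_join)
  then show ?thesis
    using rep[OF assms(1)] rep[OF assms(2)] assms unfolding fundamental_group_def monoid.simps
    by (subst loop_class_eq_iff)
      (auto intro: loopin_join intro!: path_homotopic_sym[OF path_homotopic_join] simp: loopin_def)
qed

lemma group_fundamental_group:
  assumes "x \<in> topspace X"
  shows "group (fundamental_group X x)" (is "group ?G")
proof (rule groupI)
  have const: "loopin X x (\<lambda>_. x)"
    using assms by (simp add: loopin_def)
  then show "\<one>\<^bsub>?G\<^esub> \<in> carrier ?G"
    by (simp add: fundamental_group_one loop_class_in_fundamental_group)
  fix A assume "A \<in> carrier ?G"
  then obtain p where A: "A = loop_class X x p" and p: "loopin X x p"
    by (rule fundamental_groupE)
  have "path_homotopic X ((\<lambda>_. x) \<frown> p) p"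
    using p by (auto simp: loopin_def path_homotopic_const_join)
  then show "\<one>\<^bsub>?G\<^esub> \<otimes>\<^bsub>?G\<^esub> A = A"
    using p const
    by (simp add: A fundamental_group_one fundamental_group_mult loop_class_eq_iff loopin_join)
  have "path_homotopic X (path_reverse p \<frown> p) (\<lambda>_. x)"
    using p path_homotopic_reverse_join[of X p] by (simp add: loopin_def)
  moreover have reverse: "loopin X x (path_reverse p)"
    using p by (simp add: loopin_def)
  ultimately have "loop_class X x (path_reverse p) \<otimes>\<^bsub>?G\<^esub> A = \<one>\<^bsub>?G\<^esub>"
    using p const
    by (simp add: A fundamental_group_one fundamental_group_mult loop_class_eq_iff loopin_join)
  then show "\<exists>B\<in>carrier ?G. B \<otimes>\<^bsub>?G\<^esub> A = \<one>\<^bsub>?G\<^esub>"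
    using loop_class_in_fundamental_group[OF reverse] by blast
  fix B assume "B \<in> carrier ?G"
  then obtain q where B: "B = loop_class X x q" and q: "loopin X x q"
    by (rule fundamental_groupE)
  show "A \<otimes>\<^bsub>?G\<^esub> B \<in> carrier ?G"
    using p q by (simp add: A B fundamental_group_mult loop_class_in_fundamental_group loopin_join)
  fix C assume "C \<in> carrier ?G"
  then obtain r where C: "C = loop_class X x r" and r: "loopin X x r"
    by (rule fundamental_groupE)
  have "path_homotopic X ((p \<frown> q) \<frown> r) (p \<frown> q \<frown> r)"
    using p q r by (intro path_homotopic_assoc) (auto simp: loopin_def)
  then show "A \<otimes>\<^bsub>?G\<^esub> B \<otimes>\<^bsub>?G\<^esub> C = A \<otimes>\<^bsub>?G\<^esub> (B \<otimes>\<^bsub>?G\<^esub> C)"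
    using p q r by (simp add: A B C fundamental_group_mult loop_class_eq_iff loopin_join)
qed

section \<open>Change of base point\<close>

lemma path_homotopic_cancel_left:
  assumes "pathin X \<mu>" "pathin X q" "q 0 = \<mu> 1"
  shows "path_homotopic X (path_reverse \<mu> \<frown> \<mu> \<frown> q) q"
proof -
  have "path_homotopic X (path_reverse \<mu> \<frown> \<mu> \<frown> q) ((path_reverse \<mu> \<frown> \<mu>) \<frown> q)"
    using assms by (intro path_homotopic_sym[OF path_homotopic_assoc]) auto
  also have "path_homotopic X \<dots> ((\<lambda>_. \<mu> 1) \<frown> q)"
    using assms by (intro path_homotopic_join path_homotopic_reverse_join) auto
  also have "path_homotopic X \<dots> q"
    using assms by (intro path_homotopic_const_join) auto
  finally show ?thesis .
qed

definition conj_loop :: "(real \<Rightarrow> 'a) \<Rightarrow> (real \<Rightarrow> 'a) \<Rightarrow> real \<Rightarrow> 'a" where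
  "conj_loop \<mu> p = \<mu> \<frown> p \<frown> path_reverse \<mu>"

lemma loopin_conj_loop:
  "\<lbrakk>pathin X \<mu>; loopin X (\<mu> 1) p\<rbrakk> \<Longrightarrow> loopin X (\<mu> 0) (conj_loop \<mu> p)"
  by (simp add: loopin_def conj_loop_def)

lemma path_homotopic_conj_loop:
  assumes "pathin X \<mu>" "loopin X (\<mu> 1) p" "path_homotopic X p q"
  shows "path_homotopic X (conj_loop \<mu> p) (conj_loop \<mu> q)"
  unfolding conj_loop_def using assms
  by (intro path_homotopic_join) (auto simp: loopin_def)

lemma conj_loop_join:
  assumes \<mu>: "pathin X \<mu>" and p: "loopin X (\<mu> 1) p" and q: "loopin X (\<mu> 1) q"
  shows "path_homotopic X (conj_loop \<mu> p \<frown> conj_loop \<mu> q) (conj_loop \<mu> (p \<frown> q))"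
proof -
  note [simp] = \<mu> p[unfolded loopin_def] q[unfolded loopin_def]
  let ?\<nu> = "path_reverse \<mu>"
  have "path_homotopic X (conj_loop \<mu> p \<frown> conj_loop \<mu> q) (\<mu> \<frown> (p \<frown> ?\<nu>) \<frown> (\<mu> \<frown> q \<frown> ?\<nu>))"
    unfolding conj_loop_def by (rule path_homotopic_assoc) simp_all
  also have "path_homotopic X \<dots> (\<mu> \<frown> p \<frown> ?\<nu> \<frown> \<mu> \<frown> q \<frown> ?\<nu>)"
    by (intro path_homotopic_join path_homotopic_assoc) simp_all
  also have "path_homotopic X \<dots> (\<mu> \<frown> p \<frown> q \<frown> ?\<nu>)"
    by (intro path_homotopic_join path_homotopic_cancel_left) simp_all
  also have "path_homotopic X \<dots> (conj_loop \<mu> (p \<frown> q))"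
    unfolding conj_loop_def
    by (intro path_homotopic_join path_homotopic_sym[OF path_homotopic_assoc]) simp_all
  finally show ?thesis .
qed

lemma conj_loop_reverse:
  assumes \<mu>: "pathin X \<mu>" and p: "loopin X (\<mu> 1) p"
  shows "path_homotopic X (conj_loop (path_reverse \<mu>) (conj_loop \<mu> p)) p"
proof -
  note [simp] = \<mu> p[unfolded loopin_def]
  let ?\<nu> = "path_reverse \<mu>"
  have "path_homotopic X (conj_loop ?\<nu> (conj_loop \<mu> p)) (?\<nu> \<frown> \<mu> \<frown> (p \<frown> ?\<nu>) \<frown> \<mu>)"
    unfolding conj_loop_def path_reverse_reverse
    by (intro path_homotopic_join path_homotopic_assoc) simp_all
  also have "path_homotopic X \<dots> ((p \<frown> ?\<nu>) \<frown> \<mu>)"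
    by (intro path_homotopic_cancel_left) simp_all
  also have "path_homotopic X \<dots> (p \<frown> ?\<nu> \<frown> \<mu>)"
    by (intro path_homotopic_assoc) simp_all
  also have "path_homotopic X \<dots> (p \<frown> (\<lambda>_. \<mu> 1))"
    by (intro path_homotopic_join path_homotopic_reverse_join) simp_all
  also have "path_homotopic X \<dots> p"
    by (rule path_homotopic_join_const) simp_all
  finally show ?thesis .
qed

definition transport_class :: "'a topology \<Rightarrow> (real \<Rightarrow> 'a) \<Rightarrow> (real \<Rightarrow> 'a) set \<Rightarrow> (real \<Rightarrow> 'a) set" where
  "transport_class X \<mu> A = (\<Union>p\<in>A. loop_class X (\<mu> 0) (conj_loop \<mu> p))"

lemma transport_class_loop_class:
  assumes "pathin X \<mu>" "loopin X (\<mu> 1) p"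
  shows "transport_class X \<mu> (loop_class X (\<mu> 1) p) = loop_class X (\<mu> 0) (conj_loop \<mu> p)"
proof -
  have "loop_class X (\<mu> 0) (conj_loop \<mu> q) = loop_class X (\<mu> 0) (conj_loop \<mu> p)"
    if "q \<in> loop_class X (\<mu> 1) p" for q
  proof -
    have "loopin X (\<mu> 1) q" "path_homotopic X p q"
      using that loop_class_eq_path_homotopic[OF assms(2)] by (auto simp: loop_class_def)
    then show ?thesis
      using assms by (simp add: loop_class_eq_iff loopin_conj_loop path_homotopic_conj_loop
          path_homotopic_sym)
  qed
  moreover have "p \<in> loop_class X (\<mu> 1) p"
    using assms(2) by (simp add: loop_class_eq_path_homotopic loopin_def)
  ultimately show ?thesis
    unfolding transport_class_def by blast
qed

proposition transport_class_hom:
  assumes \<mu>: "pathin X \<mu>"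
  shows "transport_class X \<mu> \<in> hom (fundamental_group X (\<mu> 1)) (fundamental_group X (\<mu> 0))"
proof (rule homI)
  fix A assume "A \<in> carrier (fundamental_group X (\<mu> 1))"
  then obtain p where A: "A = loop_class X (\<mu> 1) p" and p: "loopin X (\<mu> 1) p"
    by (rule fundamental_groupE)
  then show "transport_class X \<mu> A \<in> carrier (fundamental_group X (\<mu> 0))"
    using \<mu> by (simp add: transport_class_loop_class
        loop_class_in_fundamental_group loopin_conj_loop)
  fix B assume "B \<in> carrier (fundamental_group X (\<mu> 1))"
  then obtain q where B: "B = loop_class X (\<mu> 1) q" and q: "loopin X (\<mu> 1) q"
    by (rule fundamental_groupE)
  show "transport_class X \<mu> (A \<otimes>\<^bsub>fundamental_group X (\<mu> 1)\<^esub> B) =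
      transport_class X \<mu> A \<otimes>\<^bsub>fundamental_group X (\<mu> 0)\<^esub> transport_class X \<mu> B"
    using \<mu> p q conj_loop_join[OF \<mu> p q]
    by (simp add: A B fundamental_group_mult transport_class_loop_class loopin_join
        loop_class_eq_iff loopin_conj_loop path_homotopic_sym)
qed

proposition inj_on_transport_class:
  assumes \<mu>: "pathin X \<mu>"
  shows "inj_on (transport_class X \<mu>) (carrier (fundamental_group X (\<mu> 1)))"
proof (rule inj_onI)
  fix A B assume "A \<in> carrier (fundamental_group X (\<mu> 1))" "B \<in> carrier (fundamental_group X (\<mu> 1))"
    and eq: "transport_class X \<mu> A = transport_class X \<mu> B"
  then obtain p q where A: "A = loop_class X (\<mu> 1) p" and p: "loopin X (\<mu> 1) p"
    and B: "B = loop_class X (\<mu> 1) q" and q: "loopin X (\<mu> 1) q"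
    by (elim fundamental_groupE)
  have conj: "path_homotopic X (conj_loop \<mu> p) (conj_loop \<mu> q)"
    using eq \<mu> p q by (simp add: A B transport_class_loop_class loop_class_eq_iff loopin_conj_loop)
  let ?\<nu> = "path_reverse \<mu>"
  have "path_homotopic X p (conj_loop ?\<nu> (conj_loop \<mu> p))"
    using \<mu> p by (rule path_homotopic_sym[OF conj_loop_reverse])
  also have "path_homotopic X \<dots> (conj_loop ?\<nu> (conj_loop \<mu> q))"
    by (rule path_homotopic_conj_loop[where \<mu> = ?\<nu>])
      (simp_all add: \<mu> conj loopin_conj_loop[OF \<mu> p])
  also have "path_homotopic X \<dots> q"
    using \<mu> q by (rule conj_loop_reverse)
  finally show "A = B"
    using p q by (simp add: A B loop_class_eq_iff)
qed

section \<open>Lifting to ordered configurations\<close>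

lemma topspace_ordered_config:
  "z \<in> topspace (ordered_config M n) \<longleftrightarrow> z \<in> {..<n} \<rightarrow>\<^sub>E topspace M \<and> inj_on z {..<n}"
  by (simp add: ordered_config_def)

lemma continuous_map_ordered_config:
  "continuous_map X (ordered_config M n) f \<longleftrightarrow>
     (\<forall>i<n. continuous_map X M (\<lambda>x. f x i)) \<and>
     (\<forall>x\<in>topspace X. f x \<in> extensional {..<n} \<and> inj_on (f x) {..<n})"
  unfolding ordered_config_def continuous_map_in_subtopology continuous_map_componentwise by auto

lemma Hausdorff_space_ordered_config: "Hausdorff_space M \<Longrightarrow> Hausdorff_space (ordered_config M n)"
  unfolding ordered_config_def
  by (simp add: Hausdorff_space_product_topology Hausdorff_space_subtopology)

lemma openin_unordered_config:
  "openin (unordered_config M n) U \<longleftrightarrow> U \<subseteq> (\<lambda>z. z ` {..<n}) ` topspace (ordered_config M n) \<and>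
     openin (ordered_config M n) {z \<in> topspace (ordered_config M n). z ` {..<n} \<in> U}"
  unfolding unordered_config_def quotient_topology_def
  by (subst topology_inverse'[OF istopology_quotient]) (rule refl)

lemma topspace_unordered_config:
  "topspace (unordered_config M n) = (\<lambda>z. z ` {..<n}) ` topspace (ordered_config M n)"
    (is "_ = ?Q")
proof
  show "topspace (unordered_config M n) \<subseteq> ?Q"
    using openin_unordered_config openin_topspace by blast
  have "{z \<in> topspace (ordered_config M n). z ` {..<n} \<in> ?Q} = topspace (ordered_config M n)"
    by auto
  then have "openin (unordered_config M n) ?Q"
    by (simp add: openin_unordered_config)
  then show "?Q \<subseteq> topspace (unordered_config M n)"
    by (rule openin_subset)
qed

lemma continuous_map_config_image:
  "continuous_map (ordered_config M n) (unordered_config M n) (\<lambda>z. z ` {..<n})"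
  unfolding continuous_map_def topspace_unordered_config openin_unordered_config by auto

lemma pathin_config_image:
  "pathin (ordered_config M n) g \<Longrightarrow> pathin (unordered_config M n) (\<lambda>t. g t ` {..<n})"
  by (rule pathin_continuous_image[OF _ continuous_map_config_image])

lemma path_homotopic_config_image:
  "path_homotopic (ordered_config M n) g g' \<Longrightarrow>
    path_homotopic (unordered_config M n) (\<lambda>t. g t ` {..<n}) (\<lambda>t. g' t ` {..<n})"
  by (rule path_homotopic_continuous_image[OF _ continuous_map_config_image])

definition permute_config :: "nat \<Rightarrow> (nat \<Rightarrow> nat) \<Rightarrow> (nat \<Rightarrow> 'a) \<Rightarrow> nat \<Rightarrow> 'a" where
  "permute_config n \<sigma> z = (\<lambda>i\<in>{..<n}. z (\<sigma> i))"

lemma continuous_map_permute_config: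
  assumes "\<sigma> permutes {..<n}"
  shows "continuous_map (ordered_config M n) (ordered_config M n) (permute_config n \<sigma>)"
proof -
  have "continuous_map (ordered_config M n) M (\<lambda>z. z i)" if "i < n" for i
    using that continuous_map_ordered_config[of "ordered_config M n" M n "\<lambda>z. z"] by simp
  moreover have "\<sigma> i < n \<longleftrightarrow> i < n" for i
    using permutes_in_image[OF assms, of i] by simp
  ultimately show ?thesis
    using permutes_inj[OF assms] unfolding continuous_map_ordered_config permute_config_def
    by (auto simp: topspace_ordered_config inj_on_def inj_def)
qed

lemma permute_config_image:
  assumes "\<sigma> permutes {..<n}"
  shows "permute_config n \<sigma> z ` {..<n} = z ` {..<n}"
proof -
  have "permute_config n \<sigma> z ` {..<n} = z ` \<sigma> ` {..<n}"
    by (auto simp: permute_config_def image_image)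
  then show ?thesis
    using permutes_image[OF assms] by simp
qed

lemma permute_config_if_same_image:
  assumes "z \<in> topspace (ordered_config M n)" "z' \<in> topspace (ordered_config M n)"
    and "z ` {..<n} = z' ` {..<n}"
  obtains \<sigma> where "\<sigma> permutes {..<n}" "z = permute_config n \<sigma> z'"
proof -
  have "bij_betw z {..<n} (z ` {..<n})" "bij_betw z' {..<n} (z ` {..<n})"
    using assms by (auto simp: topspace_ordered_config bij_betw_def)
  then have bij: "bij_betw (inv_into {..<n} z' \<circ> z) {..<n} {..<n}"
    using bij_betw_inv_into bij_betw_trans by blast
  define \<sigma> where "\<sigma> i = (if i < n then inv_into {..<n} z' (z i) else i)" for i
  have "bij_betw \<sigma> {..<n} {..<n}"
    using bij by (subst bij_betw_cong[of _ _ "inv_into {..<n} z' \<circ> z"]) (simp_all add: \<sigma>_def)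
  then have "\<sigma> permutes {..<n}"
    by (rule bij_imp_permutes) (simp add: \<sigma>_def)
  moreover have "z i = z' (\<sigma> i)" if "i < n" for i
    using that f_inv_into_f[of "z i" z' "{..<n}"] by (simp add: \<sigma>_def flip: assms(3))
  then have "z = permute_config n \<sigma> z'"
    using assms(1) by (auto simp: permute_config_def topspace_ordered_config
        PiE_def extensional_def)
  ultimately show thesis by (rule that)
qed

lemma Hausdorff_separate_inj:
  assumes "Hausdorff_space X" "finite I" "inj_on z I" "z ` I \<subseteq> topspace X"
  obtains U where "\<And>i. i \<in> I \<Longrightarrow> openin X (U i) \<and> z i \<in> U i" "disjoint_family_on U I"
proof -
  have "\<exists>A B. openin X A \<and> openin X B \<and> z i \<in> A \<and> z j \<in> B \<and> A \<inter> B = {}"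
    if "i \<in> I" "j \<in> I" "i \<noteq> j" for i j
    using assms that unfolding Hausdorff_space_def disjnt_def
    by (metis image_subset_iff inj_on_eq_iff)
  then obtain A B where AB: "\<And>i j. \<lbrakk>i \<in> I; j \<in> I; i \<noteq> j\<rbrakk> \<Longrightarrow>
      openin X (A i j) \<and> openin X (B i j) \<and> z i \<in> A i j \<and> z j \<in> B i j \<and> A i j \<inter> B i j = {}"
    by metis
  define U where "U i = topspace X \<inter> (\<Inter>j\<in>I - {i}. A i j \<inter> B j i)" for i
  show thesis
  proof
    fix i assume i: "i \<in> I"
    show "openin X (U i) \<and> z i \<in> U i"
    proof (cases "I - {i} = {}")
      case True
      then show ?thesis
        unfolding U_def True using i assms(4) by auto
    next
      case False
      then show ?thesis
        unfolding U_def using i AB assms(2,4) by (auto intro!: openin_Int openin_INT)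
    qed
  next
    show "disjoint_family_on U I"
      unfolding disjoint_family_on_def
    proof (intro ballI impI)
      fix i j assume ij: "i \<in> I" "j \<in> I" "i \<noteq> j"
      then have "U i \<subseteq> A i j" "U j \<subseteq> B i j"
        unfolding U_def by auto
      then show "U i \<inter> U j = {}"
        using AB[OF ij] by blast
    qed
  qed
qed

lemma openin_config_meets:
  assumes "openin M G"
  shows "openin (unordered_config M n) {W \<in> topspace (unordered_config M n). W \<inter> G \<noteq> {}}"
    (is "openin _ ?V")
proof -
  let ?F = "ordered_config M n"
  have "openin ?F {z \<in> topspace ?F. z i \<in> G}" if "i < n" for i
    using that openin_continuous_map_preimage[OF _ assms, of ?F "\<lambda>z. z i"]
      continuous_map_ordered_config[of ?F M n "\<lambda>z. z"] by simp
  then have "openin ?F (\<Union>i<n. {z \<in> topspace ?F. z i \<in> G})"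
    by blast
  moreover have "(\<Union>i<n. {z \<in> topspace ?F. z i \<in> G}) = {z \<in> topspace ?F. z ` {..<n} \<in> ?V}"
    unfolding topspace_unordered_config by auto
  ultimately show ?thesis
    unfolding openin_unordered_config by (auto simp: topspace_unordered_config)
qed

lemma config_meets_disjoint_family:
  assumes "W \<in> topspace (unordered_config M n)" and meets: "\<And>i. i < n \<Longrightarrow> W \<inter> U i \<noteq> {}"
    and disj: "disjoint_family_on U {..<n}"
  obtains w where "\<And>i. i < n \<Longrightarrow> W \<inter> U i = {w i}" "inj_on w {..<n}" "w ` {..<n} = W"
proof -
  have "\<forall>i\<in>{..<n}. \<exists>x. x \<in> W \<and> x \<in> U i"
    using meets by blast
  then obtain w where w: "\<And>i. i < n \<Longrightarrow> w i \<in> W \<and> w i \<in> U i"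
    using bchoice[of "{..<n}"] by (metis lessThan_iff)
  have inj: "inj_on w {..<n}"
    using w disj by (intro inj_onI) (metis disjoint_family_onD disjoint_iff lessThan_iff)
  obtain z where z: "W = z ` {..<n}" "inj_on z {..<n}"
    using assms(1) by (auto simp: topspace_unordered_config topspace_ordered_config)
  have image: "w ` {..<n} = W"
    by (rule card_subset_eq) (use w z inj in \<open>auto simp: card_image\<close>)
  have "W \<inter> U i = {w i}" if i: "i < n" for i
  proof -
    have "k = i" if "k < n" "w k \<in> U i" for k
      using that w[of k] i disjoint_family_onD[OF disj, of k i] by auto
    with w[OF i] show ?thesis
      by (auto simp flip: image)
  qed
  with inj image that show thesis by blast
qed

definition config_lift ::
    "'t topology \<Rightarrow> 'a topology \<Rightarrow> nat \<Rightarrow> ('t \<Rightarrow> 'a set) \<Rightarrow> ('t \<Rightarrow> nat \<Rightarrow> 'a) \<Rightarrow> bool" where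
  "config_lift T M n S L \<longleftrightarrow>
     continuous_map T (ordered_config M n) L \<and> (\<forall>x\<in>topspace T. L x ` {..<n} = S x)"

lemma config_liftD:
  assumes "config_lift T M n S L"
  shows "continuous_map T (ordered_config M n) L"
    and "x \<in> topspace T \<Longrightarrow> L x ` {..<n} = S x"
    and "x \<in> topspace T \<Longrightarrow> L x \<in> topspace (ordered_config M n)"
  using assms by (auto simp: config_lift_def continuous_map_def)

lemma config_lift_subset:
  "\<lbrakk>config_lift (top_of_set A) M n S L; B \<subseteq> A\<rbrakk> \<Longrightarrow> config_lift (top_of_set B) M n S L"
  by (auto simp: config_lift_def intro: continuous_map_from_subtopology_mono)

lemma config_lift_permute:
  assumes "config_lift T M n S L" "\<sigma> permutes {..<n}"
  shows "config_lift T M n S (\<lambda>x. permute_config n \<sigma> (L x))"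
  using assms continuous_map_compose[OF _ continuous_map_permute_config[OF assms(2)], of T M L]
  by (simp add: config_lift_def permute_config_image o_def)

lemma config_lift_change_start:
  assumes L: "config_lift T M n S L" and x: "x \<in> topspace T"
    and z: "z \<in> topspace (ordered_config M n)" "z ` {..<n} = S x"
  obtains L' where "config_lift T M n S L'" "L' x = z"
proof -
  obtain \<sigma> where "\<sigma> permutes {..<n}" "z = permute_config n \<sigma> (L x)"
    using permute_config_if_same_image[OF z(1), of "L x"] config_liftD[OF L] x z(2) by metis
  then show thesis
    using config_lift_permute[OF L] that by metis
qed

proposition config_lift_if_meets_disjoint_family:
  assumes op: "\<And>i. i < n \<Longrightarrow> openin M (U i)" and disj: "disjoint_family_on U {..<n}"
    and S: "continuous_map T (unordered_config M n) S"
    and meets: "\<And>x i. \<lbrakk>x \<in> topspace T; i < n\<rbrakk> \<Longrightarrow> S x \<inter> U i \<noteq> {}"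
  obtains L where "config_lift T M n S L"
proof -
  have S_top: "S x \<in> topspace (unordered_config M n)" if "x \<in> topspace T" for x
    using S that by (auto simp: continuous_map_def)
  have "\<exists>w. (\<forall>i<n. S x \<inter> U i = {w i}) \<and> inj_on w {..<n} \<and> w ` {..<n} = S x"
    if x: "x \<in> topspace T" for x
    using config_meets_disjoint_family[OF S_top[OF x] meets[OF x] disj] by metis
  then obtain w where w: "\<And>x i. \<lbrakk>x \<in> topspace T; i < n\<rbrakk> \<Longrightarrow> S x \<inter> U i = {w x i}"
    "\<And>x. x \<in> topspace T \<Longrightarrow> inj_on (w x) {..<n} \<and> w x ` {..<n} = S x"
    by metis
  have "continuous_map T M (\<lambda>x. w x i)" if i: "i < n" for i
    unfolding continuous_map_def
  proof (intro conjI allI impI)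
    have "S x \<subseteq> topspace M" if "x \<in> topspace T" for x
      using S_top[OF that] by (auto simp: topspace_unordered_config topspace_ordered_config)
    then show "(\<lambda>x. w x i) \<in> topspace T \<rightarrow> topspace M"
      using w(2) i by blast
    fix G assume G: "openin M G"
    have "w x i \<in> G \<longleftrightarrow> S x \<inter> (G \<inter> U i) \<noteq> {}" if "x \<in> topspace T" for x
    proof -
      have "S x \<inter> (G \<inter> U i) = G \<inter> {w x i}"
        using w(1)[OF that i] by blast
      then show ?thesis by auto
    qed
    then have "{x \<in> topspace T. w x i \<in> G} = {x \<in> topspace T. S x \<in>
        {W \<in> topspace (unordered_config M n). W \<inter> (G \<inter> U i) \<noteq> {}}}"
      using S_top by blast
    then show "openin T {x \<in> topspace T. w x i \<in> G}"
      using openin_continuous_map_preimage[OF S openin_config_meets[of M "G \<inter> U i"]] op[OF i] G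
      by (simp add: openin_Int)
  qed
  then have "config_lift T M n S (\<lambda>x. restrict (w x) {..<n})"
    unfolding config_lift_def continuous_map_ordered_config using w(2) by simp
  then show thesis by (rule that)
qed

lemma config_lift_locally:
  assumes M: "Hausdorff_space M" and S: "continuous_map T (unordered_config M n) S"
    and x: "x \<in> topspace T"
  obtains V L where "openin T V" "x \<in> V" "config_lift (subtopology T V) M n S L"
proof -
  have "S x \<in> topspace (unordered_config M n)"
    using S x by (auto simp: continuous_map_def)
  then obtain z where z: "z \<in> topspace (ordered_config M n)" "S x = z ` {..<n}"
    by (auto simp: topspace_unordered_config)
  then have "inj_on z {..<n}" "z ` {..<n} \<subseteq> topspace M"
    by (auto simp: topspace_ordered_config)
  then obtain U where U: "\<And>i. i < n \<Longrightarrow> openin M (U i) \<and> z i \<in> U i" "disjoint_family_on U {..<n}"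
    using Hausdorff_separate_inj[OF M finite_lessThan] by (metis lessThan_iff)
  let ?V = "topspace T \<inter> (\<Inter>i<n. {y \<in> topspace T. S y \<inter> U i \<noteq> {}})"
  have "openin T {y \<in> topspace T. S y \<inter> U i \<noteq> {}}" if "i < n" for i
  proof -
    have "{y \<in> topspace T. S y \<inter> U i \<noteq> {}} = {y \<in> topspace T. S y \<in>
        {W \<in> topspace (unordered_config M n). W \<inter> U i \<noteq> {}}}"
      using S by (auto simp: continuous_map_def)
    then show ?thesis
      using openin_continuous_map_preimage[OF S openin_config_meets] U(1)[OF that] by simp
  qed
  then have "openin T ?V"
    by (cases "n = 0") (auto intro!: openin_Int openin_INT)
  moreover have "x \<in> ?V"
    using x z U(1) by auto
  moreover obtain L where "config_lift (subtopology T ?V) M n S L"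
    by (rule config_lift_if_meets_disjoint_family[of n M U "subtopology T ?V" S])
      (use U S in \<open>auto simp: continuous_map_from_subtopology\<close>)
  ultimately show thesis by (rule that)
qed

lemma openin_config_lifts_eq:
  assumes M: "Hausdorff_space M" and L: "config_lift T M n S L" and L': "config_lift T M n S L'"
  shows "openin T {x \<in> topspace T. L x = L' x}"
proof (subst openin_subopen, intro ballI)
  fix y assume "y \<in> {x \<in> topspace T. L x = L' x}"
  then have y: "y \<in> topspace T" "L y = L' y" by auto
  have "inj_on (L y) {..<n}" "L y ` {..<n} \<subseteq> topspace M"
    using config_liftD(3)[OF L y(1)] by (auto simp: topspace_ordered_config)
  then obtain U where U: "\<And>i. i < n \<Longrightarrow> openin M (U i) \<and> L y i \<in> U i"
      "disjoint_family_on U {..<n}"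
    using Hausdorff_separate_inj[OF M finite_lessThan] by (metis lessThan_iff)
  let ?V = "topspace T \<inter>
    (\<Inter>i<n. {x \<in> topspace T. L x i \<in> U i} \<inter> {x \<in> topspace T. L' x i \<in> U i})"
  have "openin T ({x \<in> topspace T. L x i \<in> U i} \<inter> {x \<in> topspace T. L' x i \<in> U i})" if "i < n" for i
    using config_liftD(1)[OF L] config_liftD(1)[OF L'] U that
    unfolding continuous_map_ordered_config
    by (intro openin_Int openin_continuous_map_preimage[of T M _ "U i"]) auto
  then have "openin T ?V"
    by (cases "n = 0") (auto intro!: openin_Int[OF openin_topspace] openin_INT simp del: Int_iff)
  moreover have "y \<in> ?V"
    using y U(1) by auto
  moreover have "?V \<subseteq> {x \<in> topspace T. L x = L' x}"
  proof
    fix x assume x: "x \<in> ?V"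
    have "L x i = L' x i" if i: "i < n" for i
    proof -
      have "L x i \<in> L' x ` {..<n}"
        using config_liftD(2)[OF L, of x] config_liftD(2)[OF L', of x] x i by force
      then obtain k where k: "k < n" "L x i = L' x k" by auto
      have "L x i \<in> U i" "L' x k \<in> U k"
        using x i k(1) by auto
      then have "i = k"
        using k disjoint_family_onD[OF U(2), of i k] i by auto
      then show ?thesis using k(2) by simp
    qed
    then have "L x = L' x"
      using x config_liftD(3)[OF L, of x] config_liftD(3)[OF L', of x]
      unfolding topspace_ordered_config by (auto intro: PiE_ext)
    then show "x \<in> {x \<in> topspace T. L x = L' x}"
      using x by simp
  qed
  ultimately show "\<exists>V. openin T V \<and> y \<in> V \<and> V \<subseteq> {x \<in> topspace T. L x = L' x}"
    by blast
qed

proposition config_lift_unique: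
  assumes M: "Hausdorff_space M" and T: "connected_space T"
    and L: "config_lift T M n S L" and L': "config_lift T M n S L'"
    and x0: "x0 \<in> topspace T" "L x0 = L' x0" and x: "x \<in> topspace T"
  shows "L x = L' x"
proof -
  have "closedin T {x \<in> topspace T. L x = L' x}"
    by (rule closedin_continuous_maps_eq[OF Hausdorff_space_ordered_config[OF M]
          config_liftD(1)[OF L] config_liftD(1)[OF L']])
  with openin_config_lifts_eq[OF M L L'] have "{x \<in> topspace T. L x = L' x} = topspace T"
    using T x0 unfolding connected_space_clopen_in by blast
  then show ?thesis using x by blast
qed

lemma config_lift_glue:
  fixes A :: "'b::topological_space set" and f :: "'b \<Rightarrow> real"
  assumes M: "Hausdorff_space M" and f: "continuous_on A f"
    and E: "connected {x \<in> A. f x = c}" "{x \<in> A. f x = c} \<noteq> {}"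
    and L1: "config_lift (top_of_set {x \<in> A. f x \<le> c}) M n S L1"
    and L2: "config_lift (top_of_set {x \<in> A. c \<le> f x}) M n S L2"
  shows "\<exists>L. config_lift (top_of_set A) M n S L"
proof -
  obtain x0 where x0: "x0 \<in> A" "f x0 = c"
    using E(2) by auto
  then have "L1 x0 \<in> topspace (ordered_config M n)" "L1 x0 ` {..<n} = S x0"
    using config_liftD[OF L1] by simp_all
  then obtain L3 where L3: "config_lift (top_of_set {x \<in> A. c \<le> f x}) M n S L3" "L3 x0 = L1 x0"
    using config_lift_change_start[OF L2, of x0 "L1 x0"] x0 by auto
  have "L1 x = L3 x" if "x \<in> A" "f x = c" for x
  proof (rule config_lift_unique[OF M, of "top_of_set {x \<in> A. f x = c}" n S])
    show "connected_space (top_of_set {x \<in> A. f x = c})"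
      using E(1) by (simp add: connectedin_def[of euclidean, simplified, symmetric])
    show "config_lift (top_of_set {x \<in> A. f x = c}) M n S L1"
      by (rule config_lift_subset[OF L1]) auto
    show "config_lift (top_of_set {x \<in> A. f x = c}) M n S L3"
      by (rule config_lift_subset[OF L3(1)]) auto
  qed (use x0 L3(2) that in auto)
  then have "config_lift (top_of_set A) M n S (\<lambda>x. if f x \<le> c then L1 x else L3 x)"
    using f L1 L3(1) unfolding config_lift_def
    by (auto intro!: continuous_map_top_of_set_cases_le)
  then show ?thesis by blast
qed

lemma unit_interval_induct:
  fixes P :: "real \<Rightarrow> real \<Rightarrow> bool"
  assumes "\<And>a b c. \<lbrakk>a \<le> b; b \<le> c; P a b; P b c\<rbrakk> \<Longrightarrow> P a c"
    and local: "\<And>x. x \<in> {0..1} \<Longrightarrow>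
      \<exists>\<delta>>0. \<forall>a b. x \<in> {a..b} \<and> {a..b} \<subseteq> {0..1} \<inter> ball x \<delta> \<longrightarrow> P a b"
  shows "P 0 1"
proof -
  have "0 \<le> (0::real) \<and> 1 \<le> (1::real) \<longrightarrow> P 0 1"
  proof (rule Bolzano[of 0 1 "\<lambda>a b. 0 \<le> a \<and> b \<le> 1 \<longrightarrow> P a b"])
    fix x :: real assume "0 \<le> x" "x \<le> 1"
    then obtain \<delta> where "\<delta> > 0"
      and \<delta>: "\<And>a b. \<lbrakk>x \<in> {a..b}; {a..b} \<subseteq> {0..1} \<inter> ball x \<delta>\<rbrakk> \<Longrightarrow> P a b"
      using local[of x] by auto
    moreover have "{a..b} \<subseteq> {0..1} \<inter> ball x \<delta>"
      if "a \<le> x" "x \<le> b" "b - a < \<delta>" "0 \<le> a" "b \<le> 1" for a b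
      using that by (auto simp: dist_real_def)
    ultimately show "\<exists>d>0. \<forall>a b. a \<le> x \<and> x \<le> b \<and> b - a < d \<longrightarrow> 0 \<le> a \<and> b \<le> 1 \<longrightarrow> P a b"
      by auto
  next
    show "0 \<le> a \<and> c \<le> 1 \<longrightarrow> P a c"
      if "0 \<le> a \<and> b \<le> 1 \<longrightarrow> P a b" "0 \<le> b \<and> c \<le> 1 \<longrightarrow> P b c" "a \<le> b" "b \<le> c" for a b c
      using that assms(1)[of a b c] by auto
  qed simp
  then show ?thesis by simp
qed

lemma Times_ball_half_subset_ball: "ball x (\<epsilon>/2) \<times> ball y (\<epsilon>/2) \<subseteq> ball (x, y) \<epsilon>"
proof clarify
  fix u v assume "u \<in> ball x (\<epsilon>/2)" "v \<in> ball y (\<epsilon>/2)"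
  moreover have "dist (x, y) (u, v) \<le> dist x u + dist y v"
    by (simp add: dist_Pair_Pair sqrt_sum_squares_le_sum)
  ultimately show "(u, v) \<in> ball (x, y) \<epsilon>" by simp
qed

proposition unit_square_induct:
  fixes P :: "(real \<times> real) set \<Rightarrow> bool"
  assumes horizontal: "\<And>a b c s t. \<lbrakk>a \<le> b; b \<le> c; s \<le> t; P ({a..b} \<times> {s..t}); P ({b..c} \<times> {s..t})\<rbrakk>
      \<Longrightarrow> P ({a..c} \<times> {s..t})"
    and vertical: "\<And>a b r s t. \<lbrakk>a \<le> b; r \<le> s; s \<le> t; P ({a..b} \<times> {r..s}); P ({a..b} \<times> {s..t})\<rbrakk>
      \<Longrightarrow> P ({a..b} \<times> {r..t})"
    and local: "\<And>x. x \<in> unit_square \<Longrightarrow>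
      \<exists>U. openin (top_of_set unit_square) U \<and> x \<in> U \<and> (\<forall>R\<subseteq>U. P R)"
  shows "P unit_square"
proof -
  let ?near = "\<lambda>u \<delta> a b. u \<in> {a..b} \<and> {a..b} \<subseteq> {0..1} \<inter> ball u \<delta>"
  have strip: "\<exists>\<delta>>0. \<forall>a b. ?near u \<delta> a b \<longrightarrow> P ({a..b} \<times> {0..1})" if u: "u \<in> {0..1}" for u
  proof (rule unit_interval_induct
      [where P = "\<lambda>s t. \<exists>\<delta>>0. \<forall>a b. ?near u \<delta> a b \<longrightarrow> P ({a..b} \<times> {s..t})"])
    fix r s t :: real
    assume "r \<le> s" "s \<le> t" "\<exists>\<delta>>0. \<forall>a b. ?near u \<delta> a b \<longrightarrow> P ({a..b} \<times> {r..s})"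
      "\<exists>\<delta>>0. \<forall>a b. ?near u \<delta> a b \<longrightarrow> P ({a..b} \<times> {s..t})"
    then obtain \<delta> \<delta>' where "\<delta> > 0" "\<delta>' > 0"
      "\<And>a b. ?near u \<delta> a b \<Longrightarrow> P ({a..b} \<times> {r..s})" "\<And>a b. ?near u \<delta>' a b \<Longrightarrow> P ({a..b} \<times> {s..t})"
      by blast
    moreover have "?near u \<delta> a b" "?near u \<delta>' a b" if "?near u (min \<delta> \<delta>') a b" for a b
      using that by auto
    ultimately show "\<exists>\<delta>>0. \<forall>a b. ?near u \<delta> a b \<longrightarrow> P ({a..b} \<times> {r..t})"
      using \<open>r \<le> s\<close> \<open>s \<le> t\<close> by (intro exI[of _ "min \<delta> \<delta>'"]) (auto intro: vertical[of _ _ r s t])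
  next
    fix v :: real assume "v \<in> {0..1}"
    with u obtain U where U: "openin (top_of_set unit_square) U" "(u, v) \<in> U" "\<And>R. R \<subseteq> U \<Longrightarrow> P R"
      using local[of "(u, v)"] by auto
    obtain \<epsilon> where \<epsilon>: "\<epsilon> > 0" "ball (u, v) \<epsilon> \<inter> unit_square \<subseteq> U"
      using U(1,2) unfolding openin_contains_ball by blast
    have "P ({a..b} \<times> {s..t})" if "?near u (\<epsilon>/2) a b" "?near v (\<epsilon>/2) s t" for a b s t
      using that Times_ball_half_subset_ball[of u \<epsilon> v] \<epsilon>(2) by (intro U(3)) blast
    then show "\<exists>\<delta>>0. \<forall>s t. ?near v \<delta> s t \<longrightarrow> (\<exists>\<delta>>0. \<forall>a b. ?near u \<delta> a b \<longrightarrow> P ({a..b} \<times> {s..t}))"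
      using \<epsilon>(1) half_gt_zero by blast
  qed
  show ?thesis
    by (rule unit_interval_induct[where P = "\<lambda>a b. P ({a..b} \<times> {0..1})"])
      (use horizontal strip in auto)
qed

proposition config_lift_unit_square:
  assumes M: "Hausdorff_space M"
    and S: "continuous_map (top_of_set unit_square) (unordered_config M n) S"
    and z: "z \<in> topspace (ordered_config M n)" "z ` {..<n} = S (0, 0)"
  obtains L where "config_lift (top_of_set unit_square) M n S L" "L (0, 0) = z"
proof -
  let ?liftable = "\<lambda>A. \<exists>L. config_lift (top_of_set A) M n S L"
  have "?liftable unit_square"
  proof (rule unit_square_induct)
    fix a b c s t :: real
    assume le: "a \<le> b" "b \<le> c" "s \<le> t" and "?liftable ({a..b} \<times> {s..t})"
      "?liftable ({b..c} \<times> {s..t})"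
    moreover have "{x \<in> {a..c} \<times> {s..t}. fst x \<le> b} = {a..b} \<times> {s..t}"
      "{x \<in> {a..c} \<times> {s..t}. b \<le> fst x} = {b..c} \<times> {s..t}"
      "{x \<in> {a..c} \<times> {s..t}. fst x = b} = {b} \<times> {s..t}"
      using le by auto
    ultimately show "?liftable ({a..c} \<times> {s..t})"
      using config_lift_glue[OF M, of "{a..c} \<times> {s..t}" fst b n S]
      by (force simp: connected_Times continuous_on_fst)
  next
    fix a b r s t :: real
    assume le: "a \<le> b" "r \<le> s" "s \<le> t" and "?liftable ({a..b} \<times> {r..s})"
      "?liftable ({a..b} \<times> {s..t})"
    moreover have "{x \<in> {a..b} \<times> {r..t}. snd x \<le> s} = {a..b} \<times> {r..s}"
      "{x \<in> {a..b} \<times> {r..t}. s \<le> snd x} = {a..b} \<times> {s..t}"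
      "{x \<in> {a..b} \<times> {r..t}. snd x = s} = {a..b} \<times> {s}"
      using le by auto
    ultimately show "?liftable ({a..b} \<times> {r..t})"
      using config_lift_glue[OF M, of "{a..b} \<times> {r..t}" snd s n S]
      by (force simp: connected_Times continuous_on_snd)
  next
    fix x assume "x \<in> unit_square"
    then obtain V L where V: "openin (top_of_set unit_square) V" "x \<in> V"
      and L: "config_lift (subtopology (top_of_set unit_square) V) M n S L"
      using config_lift_locally[OF M S, of x] by auto
    have "subtopology (top_of_set unit_square) V = top_of_set V"
      using openin_imp_subset[OF V(1)] by (simp add: subtopology_subtopology Int_absorb1)
    then have "\<forall>R\<subseteq>V. ?liftable R"
      using L config_lift_subset by metis
    with V show "\<exists>U. openin (top_of_set unit_square) U \<and> x \<in> U \<and> (\<forall>R\<subseteq>U. ?liftable R)"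
      by blast
  qed
  then show thesis
    using config_lift_change_start[of "top_of_set unit_square" M n S _ "(0, 0)" z] z that by auto
qed

corollary config_path_lift:
  assumes M: "Hausdorff_space M" and p: "pathin (unordered_config M n) p"
    and z: "z \<in> topspace (ordered_config M n)" "z ` {..<n} = p 0"
  obtains g where "pathin (ordered_config M n) g" "\<And>t. t \<in> {0..1} \<Longrightarrow> g t ` {..<n} = p t" "g 0 = z"
proof -
  have "continuous_map (top_of_set unit_square) (unordered_config M n) (\<lambda>x. p (snd x))"
    by (rule continuous_map_compose_on[OF p[unfolded pathin_def]]) (auto intro!: continuous_intros)
  then obtain L where L: "config_lift (top_of_set unit_square) M n (\<lambda>x. p (snd x)) L" "L (0, 0) = z"
    using config_lift_unit_square[OF M _ z(1), of "\<lambda>x. p (snd x)"] z(2) by auto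
  show thesis
  proof (rule that[of "\<lambda>t. L (0, t)"])
    show "pathin (ordered_config M n) (\<lambda>t. L (0, t))"
      by (rule pathin_reparametrize[OF config_liftD(1)[OF L(1)]]) (auto intro!: continuous_intros)
  qed (use L config_liftD(2)[OF L(1)] in auto)
qed

corollary config_homotopy_lift:
  assumes M: "Hausdorff_space M"
    and g: "pathin (ordered_config M n) g" "pathin (ordered_config M n) g'" "g 0 = g' 0"
    and h: "path_homotopic (unordered_config M n) (\<lambda>t. g t ` {..<n}) (\<lambda>t. g' t ` {..<n})"
  shows "path_homotopic (ordered_config M n) g g'"
proof -
  let ?F = "ordered_config M n"
  obtain S where S: "continuous_map (top_of_set unit_square) (unordered_config M n) S"
    "\<And>t. t \<in> {0..1} \<Longrightarrow> S (0, t) = g t ` {..<n}" "\<And>t. t \<in> {0..1} \<Longrightarrow> S (1, t) = g' t ` {..<n}"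
    "\<And>s. s \<in> {0..1} \<Longrightarrow> S (s, 0) = g 0 ` {..<n}" "\<And>s. s \<in> {0..1} \<Longrightarrow> S (s, 1) = g 1 ` {..<n}"
    using path_homotopicE[OF h] by blast
  have top: "g t \<in> topspace ?F" "g' t \<in> topspace ?F" if "t \<in> {0..1}" for t
    using g that pathin_in_topspace by metis+
  obtain L where L: "config_lift (top_of_set unit_square) M n S L" "L (0, 0) = g 0"
    using config_lift_unit_square[OF M S(1), of "g 0"] top S(2)[of 0] by auto
  have unique: "L (f t) = k t"
    if "continuous_on {0..1} f" "f \<in> {0..1} \<rightarrow> unit_square" "pathin ?F k"
      "\<And>t. t \<in> {0..1} \<Longrightarrow> S (f t) = k t ` {..<n}" "L (f 0) = k 0" "t \<in> {0..1}" for f k t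
  proof (rule config_lift_unique[OF M, of "top_of_set {0..1}" n "\<lambda>t. S (f t)" "\<lambda>t. L (f t)" k])
    show "config_lift (top_of_set {0..1}) M n (\<lambda>t. S (f t)) (\<lambda>t. L (f t))"
      using that(1,2) continuous_map_compose_on[OF config_liftD(1)[OF L(1)]]
        config_liftD(2)[OF L(1)]
      by (auto simp: config_lift_def Pi_iff)
    show "config_lift (top_of_set {0..1}) M n (\<lambda>t. S (f t)) k"
      using that by (simp add: config_lift_def pathin_def)
  qed (use that in auto)
  have left: "L (0, t) = g t" if "t \<in> {0..1}" for t
    by (rule unique) (use that L S g in \<open>auto intro!: continuous_intros\<close>)
  have bottom: "L (s, 0) = g 0" if "s \<in> {0..1}" for s
    by (rule unique[where f = "\<lambda>s. (s, 0)" and k = "\<lambda>_. g 0"])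
      (use that L S top in \<open>auto intro!: continuous_intros\<close>)
  have right: "L (1, t) = g' t" if "t \<in> {0..1}" for t
    by (rule unique) (use that bottom[of 1] S g in \<open>auto intro!: continuous_intros\<close>)
  have "L (s, 1) = g 1" if "s \<in> {0..1}" for s
    by (rule unique[where f = "\<lambda>s. (s, 1)" and k = "\<lambda>_. g 1"])
      (use that left[of 1] S top in \<open>auto intro!: continuous_intros\<close>)
  with left bottom right show ?thesis
    by (intro path_homotopicI[OF config_liftD(1)[OF L(1)]])
qed

section \<open>Charts of surfaces\<close>

definition open_embedding ::
    "'b::topological_space set \<Rightarrow> 'a topology \<Rightarrow> ('b \<Rightarrow> 'a) \<Rightarrow> bool" where
  "open_embedding C X g \<longleftrightarrow>
     continuous_map (top_of_set C) X g \<and> open_map (top_of_set C) X g \<and> inj_on g C"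

lemma open_embeddingD:
  assumes "open_embedding C X g"
  shows "continuous_map (top_of_set C) X g" "open_map (top_of_set C) X g" "inj_on g C"
  using assms by (simp_all add: open_embedding_def)

lemma open_embedding_in_topspace: "\<lbrakk>open_embedding C X g; z \<in> C\<rbrakk> \<Longrightarrow> g z \<in> topspace X"
  unfolding open_embedding_def continuous_map_def by (auto simp: Pi_iff)

lemma open_embedding_eq_iff:
  "\<lbrakk>open_embedding C X g; z \<in> C; w \<in> C\<rbrakk> \<Longrightarrow> g z = g w \<longleftrightarrow> z = w"
  by (auto simp: open_embedding_def inj_on_def)

lemma open_embedding_openin_image:
  "\<lbrakk>open_embedding C X g; openin (top_of_set C) U\<rbrakk> \<Longrightarrow> openin X (g ` U)"
  by (simp add: open_embedding_def open_map_def)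

lemma open_embedding_openin: "open_embedding C X g \<Longrightarrow> openin X (g ` C)"
  by (simp add: open_embedding_openin_image)

lemma open_embedding_compose_on:
  "\<lbrakk>open_embedding C X g; continuous_on A f; f \<in> A \<rightarrow> C\<rbrakk>
    \<Longrightarrow> continuous_map (top_of_set A) X (\<lambda>x. g (f x))"
  by (rule continuous_map_compose_on[OF open_embeddingD(1)])

lemma open_embedding_subset:
  assumes "open_embedding C X g" "openin (top_of_set C) D"
  shows "open_embedding D X g"
  using assms openin_imp_subset[OF assms(2)] openin_trans[OF _ assms(2)]
  by (auto simp: open_embedding_def open_map_def intro: continuous_map_from_subtopology_mono
      inj_on_subset)

lemma open_embedding_homeomorphism:
  assumes g: "open_embedding D X g" and hom: "homeomorphism C D f f'"
  shows "open_embedding C X (\<lambda>z. g (f z))"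
  unfolding open_embedding_def
proof (intro conjI)
  have f: "continuous_on C f" "f ` C = D" "inj_on f C"
    using hom by (auto simp: homeomorphism_def intro: inj_on_inverseI)
  then show "continuous_map (top_of_set C) X (\<lambda>z. g (f z))"
    by (intro open_embedding_compose_on[OF g]) auto
  show "inj_on (\<lambda>z. g (f z)) C"
    using comp_inj_on[OF f(3), of g] open_embeddingD(3)[OF g] f(2) by (simp add: o_def)
  have "openin X (g ` f ` U)" if "openin (top_of_set C) U" for U
    using open_embedding_openin_image[OF g] homeomorphism_imp_open_map[OF hom that] .
  then show "open_map (top_of_set C) X (\<lambda>z. g (f z))"
    by (simp add: open_map_def image_image)
qed

lemma open_embedding_if_homeomorphic_map:
  assumes U: "openin X U" and g: "homeomorphic_map (top_of_set C) (subtopology X U) g"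
  shows "open_embedding C X g"
  unfolding open_embedding_def
proof (intro conjI)
  show "continuous_map (top_of_set C) X g"
    using homeomorphic_imp_continuous_map[OF g] continuous_map_into_fulltopology by blast
  show "open_map (top_of_set C) X g"
    using homeomorphic_imp_open_map[OF g] openin_trans_full[OF _ U] by (simp add: open_map_def)
  show "inj_on g C"
    using homeomorphic_imp_injective_map[OF g] by simp
qed

lemma homeomorphic_map_open_embedding:
  assumes "open_embedding C X g"
  shows "homeomorphic_map (top_of_set C) (subtopology X (g ` C)) g"
proof (rule bijective_open_imp_homeomorphic_map)
  show "g ` topspace (top_of_set C) = topspace (subtopology X (g ` C))"
    using open_embedding_in_topspace[OF assms] by auto
qed (use assms in \<open>auto simp: open_embedding_def open_map_into_subtopology
    intro!: continuous_map_into_subtopology\<close>)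

lemma continuous_map_inv_into_open_embedding:
  assumes g: "open_embedding C X g"
  shows "continuous_map (subtopology X (g ` C)) (top_of_set C) (inv_into C g)"
proof -
  obtain k where k: "homeomorphic_maps (top_of_set C) (subtopology X (g ` C)) g k"
    using homeomorphic_map_open_embedding[OF g] unfolding homeomorphic_map_maps by blast
  have "k x = inv_into C g x" if "x \<in> topspace (subtopology X (g ` C))" for x
    using that k open_embeddingD(3)[OF g] by (auto simp: homeomorphic_maps_def)
  moreover have "continuous_map (subtopology X (g ` C)) (top_of_set C) k"
    using k by (simp add: homeomorphic_maps_def)
  ultimately show ?thesis
    by (rule continuous_map_eq[rotated])
qed

lemma open_embedding_closedin_image:
  assumes "open_embedding C X g" "Hausdorff_space X" "compact K" "K \<subseteq> C"
  shows "closedin X (g ` K)"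
proof -
  have "compactin (top_of_set C) K"
    using assms(3,4) by (simp add: compactin_subtopology)
  then have "compactin X (g ` K)"
    using open_embeddingD(1)[OF assms(1)] image_compactin by blast
  then show ?thesis
    using assms(2) compactin_imp_closedin by blast
qed

lemma open_embedding_delete:
  assumes e: "open_embedding UNIV X e" and D: "closed D"
  shows "open_embedding (- D) (subtopology X (topspace X - e ` D)) e"
proof -
  have "open_embedding (- D) X e"
    using open_embedding_subset[OF e] D by (simp add: open_Compl)
  moreover have "e ` (- D) \<subseteq> topspace X - e ` D"
    using open_embedding_in_topspace[OF e] open_embedding_eq_iff[OF e] by auto
  ultimately show ?thesis
    by (auto simp: open_embedding_def image_subset_iff_funcset
        intro!: continuous_map_into_subtopology open_map_into_subtopology)
qed

definition chart_extension ::
    "'c set \<Rightarrow> ('c \<Rightarrow> 'a) \<Rightarrow> ('c \<Rightarrow> 'b) \<Rightarrow> ('a \<Rightarrow> 'b) \<Rightarrow> 'a \<Rightarrow> 'b" where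
  "chart_extension C g \<phi> \<psi> x = (if x \<in> g ` C then \<phi> (inv_into C g x) else \<psi> x)"

lemma chart_extension_outside: "x \<notin> g ` C \<Longrightarrow> chart_extension C g \<phi> \<psi> x = \<psi> x"
  by (simp add: chart_extension_def)

lemma chart_extension_chart:
  "\<lbrakk>open_embedding C X g; z \<in> C\<rbrakk> \<Longrightarrow> chart_extension C g \<phi> \<psi> (g z) = \<phi> z"
  by (simp add: chart_extension_def open_embedding_def)

proposition continuous_map_chart_extension_family:
  assumes g: "open_embedding C X g" and K: "closedin X (g ` K)" "K \<subseteq> C"
    and \<phi>: "continuous_map (prod_topology T (top_of_set C)) Z (\<lambda>(t, z). \<phi> t z)"
    and \<psi>: "continuous_map (prod_topology T (subtopology X (topspace X - g ` K))) Z
      (\<lambda>(t, x). \<psi> t x)"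
    and agree: "\<And>t z. \<lbrakk>t \<in> topspace T; z \<in> C; z \<notin> K\<rbrakk> \<Longrightarrow> \<phi> t z = \<psi> t (g z)"
  shows "continuous_map (prod_topology T X) Z (\<lambda>(t, x). chart_extension C g (\<phi> t) (\<psi> t) x)"
    (is "continuous_map _ _ ?F")
proof (rule pasting_lemma[where I = UNIV and f = "\<lambda>_. ?F"
      and T = "\<lambda>b::bool. topspace T \<times> (if b then g ` C else topspace X - g ` K)"])
  show "openin (prod_topology T X) (topspace T \<times> (if b then g ` C else topspace X - g ` K))" for b
    using open_embedding_openin[OF g] K by (auto simp: openin_prod_Times_iff openin_diff)
  have inside: "continuous_map (prod_topology T (subtopology X (g ` C))) Z ?F"
  proof (rule continuous_map_eq)
    have "continuous_map (prod_topology T (subtopology X (g ` C))) (prod_topology T (top_of_set C))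
        (\<lambda>(t, x). (t, inv_into C g x))"
      using continuous_map_inv_into_open_embedding[OF g] by (simp add: continuous_map_prod_top)
    from continuous_map_compose[OF this \<phi>]
    show "continuous_map (prod_topology T (subtopology X (g ` C))) Z
        (\<lambda>(t, x). \<phi> t (inv_into C g x))"
      by (simp add: o_def case_prod_unfold)
  qed (auto simp: chart_extension_def)
  have outside: "continuous_map (prod_topology T (subtopology X (topspace X - g ` K))) Z ?F"
  proof (rule continuous_map_eq[OF \<psi>])
    fix p assume p: "p \<in> topspace (prod_topology T (subtopology X (topspace X - g ` K)))"
    then obtain t x where tx: "p = (t, x)" "t \<in> topspace T" "x \<notin> g ` K" by auto
    show "(\<lambda>(t, x). \<psi> t x) p = ?F p"
    proof (cases "x \<in> g ` C")
      case True
      then obtain z where z: "z \<in> C" "x = g z" by blast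
      with tx(3) have "z \<notin> K" by blast
      with z show ?thesis
        using agree[OF tx(2) z(1)] by (simp add: tx(1) chart_extension_chart[OF g])
    qed (simp add: tx(1) chart_extension_outside)
  qed
  have "subtopology (prod_topology T X) (topspace T \<times> S) = prod_topology T (subtopology X S)" for S
    by (simp add: subtopology_Times)
  then show "continuous_map (subtopology (prod_topology T X)
      (topspace T \<times> (if b then g ` C else topspace X - g ` K))) Z ?F" for b
    using inside outside by simp
qed (use K(2) in auto)

corollary continuous_map_chart_extension:
  assumes g: "open_embedding C X g" and K: "closedin X (g ` K)" "K \<subseteq> C"
    and \<phi>: "continuous_map (top_of_set C) Z \<phi>"
    and \<psi>: "continuous_map (subtopology X (topspace X - g ` K)) Z \<psi>"
    and agree: "\<And>z. \<lbrakk>z \<in> C; z \<notin> K\<rbrakk> \<Longrightarrow> \<phi> z = \<psi> (g z)"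
  shows "continuous_map X Z (chart_extension C g \<phi> \<psi>)"
proof -
  let ?T = "discrete_topology {()}"
  have "continuous_map (prod_topology ?T (top_of_set C)) Z (\<lambda>(t, z). \<phi> z)"
    "continuous_map (prod_topology ?T (subtopology X (topspace X - g ` K))) Z (\<lambda>(t, x). \<psi> x)"
    using continuous_map_compose[OF continuous_map_snd \<phi>]
      continuous_map_compose[OF continuous_map_snd \<psi>]
    by (simp_all only: case_prod_unfold o_def)
  from continuous_map_chart_extension_family[OF g K this] agree
  have "continuous_map (prod_topology ?T X) Z (\<lambda>(t, x). chart_extension C g \<phi> \<psi> x)"
    by simp
  moreover have "continuous_map X (prod_topology ?T X) (\<lambda>x. ((), x))"
    by (simp add: continuous_map_pairwise o_def)
  ultimately have "continuous_map X Z ((\<lambda>(t, x). chart_extension C g \<phi> \<psi> x) \<circ> (\<lambda>x. ((), x)))"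
    by (rule continuous_map_compose[rotated])
  then show ?thesis
    by (simp add: o_def)
qed

definition chart_conj :: "'c set \<Rightarrow> ('c \<Rightarrow> 'a) \<Rightarrow> ('c \<Rightarrow> 'c) \<Rightarrow> 'a \<Rightarrow> 'a" where
  "chart_conj C g \<theta> = chart_extension C g (\<lambda>z. g (\<theta> z)) (\<lambda>x. x)"

lemma chart_conj_outside: "x \<notin> g ` C \<Longrightarrow> chart_conj C g \<theta> x = x"
  by (simp add: chart_conj_def chart_extension_outside)

lemma chart_conj_chart:
  "\<lbrakk>open_embedding C X g; z \<in> C\<rbrakk> \<Longrightarrow> chart_conj C g \<theta> (g z) = g (\<theta> z)"
  by (simp add: chart_conj_def chart_extension_chart)

lemma inj_chart_conj:
  assumes g: "open_embedding C X g" and \<theta>: "\<theta> \<in> C \<rightarrow> C" "inj_on \<theta> C"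
  shows "inj (chart_conj C g \<theta>)"
proof (rule injI)
  fix x y assume eq: "chart_conj C g \<theta> x = chart_conj C g \<theta> y"
  have image: "chart_conj C g \<theta> x \<in> g ` C \<longleftrightarrow> x \<in> g ` C" for x
    using \<theta>(1) by (cases "x \<in> g ` C") (auto simp: chart_conj_outside chart_conj_chart[OF g])
  show "x = y"
  proof (cases "x \<in> g ` C")
    case True
    then obtain z w where zw: "z \<in> C" "x = g z" "w \<in> C" "y = g w"
      using image[of x] image[of y] eq by (metis imageE)
    moreover from this have "\<theta> z \<in> C" "\<theta> w \<in> C"
      using \<theta>(1) by auto
    ultimately have "\<theta> z = \<theta> w"
      using eq by (simp add: chart_conj_chart[OF g] open_embedding_eq_iff[OF g])
    from inj_onD[OF \<theta>(2) this zw(1,3)] show ?thesis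
      using zw by simp
  next
    case False
    then show ?thesis
      using eq image[of x] image[of y] by (simp add: chart_conj_outside)
  qed
qed

lemma continuous_map_chart_conj_family:
  assumes g: "open_embedding C X g" and K: "closedin X (g ` K)" "K \<subseteq> C"
    and \<theta>: "continuous_on (A \<times> C) (\<lambda>p. \<theta> (fst p) (snd p))" "\<And>a z. \<lbrakk>a \<in> A; z \<in> C\<rbrakk> \<Longrightarrow> \<theta> a z \<in> C"
    and id: "\<And>a z. \<lbrakk>a \<in> A; z \<in> C; z \<notin> K\<rbrakk> \<Longrightarrow> \<theta> a z = z"
  shows "continuous_map (prod_topology (top_of_set A) X) X (\<lambda>(a, x). chart_conj C g (\<theta> a) x)"
  unfolding chart_conj_def
proof (rule continuous_map_chart_extension_family[OF g K])
  show "continuous_map (prod_topology (top_of_set A) (top_of_set C)) X (\<lambda>(a, z). g (\<theta> a z))"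
    unfolding prod_topology_top_of_set case_prod_unfold
    by (rule open_embedding_compose_on[OF g \<theta>(1)]) (use \<theta>(2) in auto)
  show "continuous_map (prod_topology (top_of_set A) (subtopology X (topspace X - g ` K))) X
      (\<lambda>(a, x). x)"
    using continuous_map_into_fulltopology[OF continuous_map_snd] by (simp add: case_prod_unfold)
qed (use id in auto)

abbreviation upper_half_plane :: "complex set" where
  "upper_half_plane \<equiv> {z. 0 \<le> Im z}"

definition manifold_interior :: "'a topology \<Rightarrow> 'a set" where
  "manifold_interior X = {x. \<exists>e :: complex \<Rightarrow> 'a. open_embedding UNIV X e \<and> x \<in> range e}"

lemma manifold_interiorI: "open_embedding UNIV X e \<Longrightarrow> e (z::complex) \<in> manifold_interior X"
  by (auto simp: manifold_interior_def)

lemma openin_manifold_interior: "openin X (manifold_interior X)"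
proof (subst openin_subopen, intro ballI)
  fix x assume "x \<in> manifold_interior X"
  then obtain e :: "complex \<Rightarrow> 'a" where "open_embedding UNIV X e" "x \<in> range e"
    by (auto simp: manifold_interior_def)
  then show "\<exists>T. openin X T \<and> x \<in> T \<and> T \<subseteq> manifold_interior X"
    by (intro exI[of _ "range e"]) (auto simp: open_embedding_openin manifold_interiorI)
qed

definition shrink :: "complex \<Rightarrow> real \<Rightarrow> complex \<Rightarrow> complex" where
  "shrink c r z = c + (r / (1 + norm z)) *\<^sub>R z"

definition unshrink :: "complex \<Rightarrow> real \<Rightarrow> complex \<Rightarrow> complex" where
  "unshrink c r w = (1 / (r - norm (w - c))) *\<^sub>R (w - c)"

lemma shrink_0 [simp]: "shrink c r 0 = c"
  by (simp add: shrink_def)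

lemma shrink_in_ball:
  assumes "r > 0"
  shows "shrink c r z \<in> ball c r"
proof -
  have "1 + norm z > 0"
    by (simp add: add_pos_nonneg)
  moreover have "r * norm z < r * (1 + norm z)"
    using assms by simp
  ultimately have "r * norm z / (1 + norm z) < r"
    by (simp add: pos_divide_less_eq)
  with assms \<open>1 + norm z > 0\<close> show ?thesis
    by (simp add: shrink_def dist_norm)
qed

lemma homeomorphism_shrink:
  assumes r: "r > 0"
  shows "homeomorphism UNIV (ball c r) (shrink c r) (unshrink c r)"
proof (rule homeomorphismI)
  have pos: "1 + norm z > 0" for z :: complex
    by (simp add: add_pos_nonneg)
  then have "1 + norm z \<noteq> 0" for z :: complex
    by (metis less_irrefl)
  then show "continuous_on UNIV (shrink c r)"
    unfolding shrink_def by (intro continuous_intros) auto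
  show "continuous_on (ball c r) (unshrink c r)"
    unfolding unshrink_def
    by (intro continuous_intros) (auto simp: dist_norm norm_minus_commute)
  show "unshrink c r (shrink c r z) = z" for z
  proof -
    have "r - norm (shrink c r z - c) = r / (1 + norm z)"
      using r pos[of z] by (simp add: shrink_def field_simps)
    then show ?thesis
      using r pos[of z] by (simp add: shrink_def unshrink_def)
  qed
  show "shrink c r (unshrink c r w) = w" if "w \<in> ball c r" for w
  proof -
    have w: "r - norm (w - c) > 0"
      using that by (simp add: dist_norm norm_minus_commute)
    then have "1 + norm (unshrink c r w) = r / (r - norm (w - c))"
      by (simp add: unshrink_def add_divide_eq_iff)
    then show ?thesis
      using w r by (simp add: shrink_def unshrink_def)
  qed
  show "range (shrink c r) \<subseteq> ball c r"
    using shrink_in_ball[OF r] by blast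
qed simp

lemma open_embedding_shrink:
  assumes g: "open_embedding D X g" and r: "r > 0" and C: "\<And>z. z \<in> C \<longleftrightarrow> shrink c r z \<in> D"
  shows "open_embedding C X (\<lambda>z. g (shrink c r z))"
proof -
  have "openin (top_of_set D) (D \<inter> ball c r)"
    by (simp add: openin_open_Int)
  moreover have "homeomorphism C (D \<inter> ball c r) (shrink c r) (unshrink c r)"
  proof (rule homeomorphism_of_subsets[OF homeomorphism_shrink[OF r]])
    have "w \<in> shrink c r ` C" if "w \<in> D" "w \<in> ball c r" for w
      using that C homeomorphism_apply2[OF homeomorphism_shrink[OF r]] by (metis image_eqI)
    then show "shrink c r ` C = D \<inter> ball c r"
      using C shrink_in_ball[OF r] by blast
  qed auto
  ultimately show ?thesis
    using open_embedding_homeomorphism open_embedding_subset[OF g] by blast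
qed

lemma open_embedding_rescale:
  assumes g: "open_embedding D X g" and z: "z \<in> D" and N: "openin X N" "g z \<in> N" and "d > 0"
    and C: "\<And>s w. \<lbrakk>0 < s; s \<le> d\<rbrakk> \<Longrightarrow> w \<in> C \<longleftrightarrow> shrink z s w \<in> D"
  obtains e where "open_embedding C X e" "e 0 = g z" "e ` C \<subseteq> N"
proof -
  have "openin (top_of_set D) {x \<in> D. g x \<in> N}"
    using openin_continuous_map_preimage[OF open_embeddingD(1)[OF g] N(1)] by simp
  then obtain r where r: "r > 0" "ball z r \<inter> D \<subseteq> {x \<in> D. g x \<in> N}"
    using z N(2) unfolding openin_contains_ball by (metis (mono_tags, lifting) mem_Collect_eq)
  define s where "s = min r d"
  have s: "s > 0" "s \<le> d" "ball z s \<subseteq> ball z r"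
    using r \<open>d > 0\<close> by (auto simp: s_def)
  show thesis
  proof (rule that[of "\<lambda>w. g (shrink z s w)"])
    show "open_embedding C X (\<lambda>w. g (shrink z s w))"
      using C[OF s(1,2)] by (rule open_embedding_shrink[OF g s(1)])
    show "(\<lambda>w. g (shrink z s w)) ` C \<subseteq> N"
      using C[OF s(1,2)] shrink_in_ball[OF s(1), of z] s(3) r(2) by blast
  qed simp
qed

lemma open_embedding_rescale_UNIV:
  fixes z :: complex
  assumes "open_embedding D X g" "ball z d \<subseteq> D" "d > 0" "openin X N" "g z \<in> N"
  obtains e where "open_embedding (UNIV :: complex set) X e" "e 0 = g z" "range e \<subseteq> N"
proof (rule open_embedding_rescale[where z = z and d = d and C = UNIV and D = D and N = N])
  show "w \<in> UNIV \<longleftrightarrow> shrink z s w \<in> D" if "0 < s" "s \<le> d" for s w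
    using that assms(2) shrink_in_ball[of s z w] by auto
qed (use assms that in auto)

lemma interior_chart:
  assumes "x \<in> manifold_interior X" "openin X N" "x \<in> N"
  obtains e where "open_embedding (UNIV :: complex set) X e" "e 0 = x" "range e \<subseteq> N"
proof -
  obtain g and z :: complex where "open_embedding UNIV X g" "x = g z"
    using assms(1) by (auto simp: manifold_interior_def)
  then show thesis
    using open_embedding_rescale_UNIV[of UNIV X g z 1 N] assms(2,3) that by auto
qed

lemma ball_subset_upper_half_plane: "ball z (Im z) \<subseteq> upper_half_plane"
proof
  fix w assume "w \<in> ball z (Im z)"
  then have "\<bar>Im (z - w)\<bar> < Im z"
    using abs_Im_le_cmod[of "z - w"] by (simp add: dist_norm)
  then show "w \<in> upper_half_plane" by simp
qed

lemma half_plane_chart_interior: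
  assumes g: "open_embedding upper_half_plane X g" and z: "Im z > 0"
  shows "g z \<in> manifold_interior X"
proof -
  have "g z \<in> topspace X"
    using open_embedding_in_topspace[OF g] z by simp
  then obtain e :: "complex \<Rightarrow> 'a" where "open_embedding UNIV X e" "e 0 = g z"
    by (rule open_embedding_rescale_UNIV[OF g ball_subset_upper_half_plane z openin_topspace])
  then show ?thesis
    by (metis manifold_interiorI)
qed

lemma surface_local_chart:
  assumes M: "surface_with_boundary M" and x: "x \<in> topspace M"
  obtains D g z where "open_embedding D M g" "openin (top_of_set upper_half_plane) D"
    "z \<in> D" "g z = x"
proof -
  obtain U V where U: "openin M U" "x \<in> U" and V: "openin (top_of_set closed_half_plane) V"
    and "subtopology M U homeomorphic_space top_of_set V"
    using M x unfolding surface_with_boundary_def by blast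
  then obtain f where f: "homeomorphic_map (top_of_set V) (subtopology M U) f"
    using homeomorphic_space homeomorphic_space_sym by blast
  define D where "D = {z. (Re z, Im z) \<in> V}"
  obtain W where W: "open W" "V = closed_half_plane \<inter> W"
    using V by (auto simp: openin_open)
  have "open ((\<lambda>z. (Re z, Im z)) -` W)"
    by (rule open_vimage[OF W(1)]) (auto intro!: continuous_intros)
  moreover have "D = upper_half_plane \<inter> (\<lambda>z. (Re z, Im z)) -` W"
    by (auto simp: D_def W(2) closed_half_plane_def)
  ultimately have D: "openin (top_of_set upper_half_plane) D"
    by (simp add: openin_open_Int)
  have "continuous_on V (\<lambda>p. Complex (fst p) (snd p))"
    unfolding Complex_eq by (intro continuous_intros)
  then have "homeomorphism D V (\<lambda>z. (Re z, Im z)) (\<lambda>p. Complex (fst p) (snd p))"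
    by (intro homeomorphismI) (auto simp: D_def intro!: continuous_intros)
  then have chart: "open_embedding D M (\<lambda>z. f (Re z, Im z))"
    by (rule open_embedding_homeomorphism[OF open_embedding_if_homeomorphic_map[OF U(1) f]])
  have "x \<in> f ` V"
    using homeomorphic_imp_surjective_map[OF f] U x by simp
  then obtain p where "p \<in> V" "f p = x" by blast
  then show thesis
    using that[OF chart D, of "Complex (fst p) (snd p)"] by (simp add: D_def)
qed

proposition surface_chart:
  assumes M: "surface_with_boundary M" and N: "openin M N" and x: "x \<in> N"
  obtains C g where "C = UNIV \<or> C = upper_half_plane" "open_embedding C M g" "g 0 = x" "g ` C \<subseteq> N"
proof -
  have "x \<in> topspace M"
    using N x openin_subset by blast
  then obtain D g z where g: "open_embedding D M g"
    and D: "openin (top_of_set upper_half_plane) D" and z: "z \<in> D" "g z = x"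
    by (rule surface_local_chart[OF M])
  obtain d where d: "d > 0" "ball z d \<inter> upper_half_plane \<subseteq> D"
    using D z(1) unfolding openin_contains_ball by blast
  have "Im z \<ge> 0"
    using z(1) openin_imp_subset[OF D] by auto
  then consider "Im z > 0" | "Im z = 0" by linarith
  then show thesis
  proof cases
    case 1
    have "ball z (min d (Im z)) = ball z d \<inter> ball z (Im z)"
      by auto
    then have "ball z (min d (Im z)) \<subseteq> D"
      using d(2) ball_subset_upper_half_plane[of z] by blast
    then show thesis
      using open_embedding_rescale_UNIV[OF g _ _ N] 1 d(1) x z(2) that by (metis min_less_iff_conj)
  next
    case 2
    have "w \<in> upper_half_plane \<longleftrightarrow> shrink z s w \<in> D" if s: "0 < s" "s \<le> d" for s w
    proof -
      have "0 < s / (1 + norm w)"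
        using s(1) by (simp add: add_pos_nonneg)
      then have "0 \<le> s / (1 + norm w) * Im w \<longleftrightarrow> 0 \<le> Im w"
        unfolding zero_le_mult_iff by linarith
      then have "0 \<le> Im (shrink z s w) \<longleftrightarrow> 0 \<le> Im w"
        using 2 by (simp add: shrink_def)
      moreover have "shrink z s w \<in> ball z d"
        using shrink_in_ball[OF s(1), of z w] s(2) by auto
      ultimately show ?thesis
        using d(2) openin_imp_subset[OF D] by auto
    qed
    then show thesis
      using open_embedding_rescale[OF g z(1) N _ d(1)] x z(2) that by metis
  qed
qed

lemma chart_avoiding_finite:
  assumes M: "surface_with_boundary M" and S: "finite S" and infinite: "\<not> topspace M \<subseteq> S"
  obtains e where "open_embedding (UNIV :: complex set) M e" "range e \<inter> S = {}"
proof -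
  have "closedin M (topspace M \<inter> S)"
    using M S closedin_Hausdorff_finite[of M "topspace M \<inter> S"]
    by (simp add: surface_with_boundary_def)
  moreover have "topspace M - S = topspace M - topspace M \<inter> S"
    by blast
  ultimately have N: "openin M (topspace M - S)"
    by (metis openin_diff openin_topspace)
  obtain y where "y \<in> topspace M - S"
    using infinite by blast
  then obtain C g where g: "C = UNIV \<or> C = upper_half_plane" "open_embedding C M g"
    "g ` C \<subseteq> topspace M - S"
    using surface_chart[OF M N] by metis
  then have "g \<i> \<in> manifold_interior M"
    using half_plane_chart_interior[of M g \<i>] manifold_interiorI[of M g \<i>] by auto
  moreover have "\<i> \<in> C"
    using g(1) by auto
  then have "g \<i> \<in> topspace M - S"
    using g(3) by blast
  ultimately obtain e :: "complex \<Rightarrow> 'a" where "open_embedding UNIV M e" "range e \<subseteq> topspace M - S"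
    by (rule interior_chart[OF _ N])
  then show thesis
    using that by blast
qed

section \<open>Moving the points of a configuration\<close>

lemma path_connectedin_open_embedding_diff_finite:
  fixes C :: "complex set"
  assumes g: "open_embedding C M g" and C: "convex C" "interior C \<noteq> {}" and S: "finite S"
  shows "path_connectedin M (g ` C - S)" "g ` C - S \<noteq> {}"
proof -
  define S' where "S' = C \<inter> g -` S"
  have "finite S'"
    unfolding S'_def using finite_vimage_IntI[OF S open_embeddingD(3)[OF g]]
    by (simp add: Int_commute)
  have diff: "g ` C - S = g ` (C - S')"
    unfolding S'_def by auto
  have "\<not> collinear C"
    using aff_dim_nonempty_interior[OF C(2)] by (simp add: collinear_aff_dim)
  then have "path_connected (C - S')"
    using path_connected_convex_diff_countable[OF C(1)] countable_finite[OF \<open>finite S'\<close>] by blast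
  then have "path_connectedin (top_of_set C) (C - S')"
    by (simp add: path_connectedin_subtopology)
  then show "path_connectedin M (g ` C - S)"
    unfolding diff using open_embeddingD(1)[OF g] path_connectedin_continuous_map_image by blast
  have "infinite C"
    using C(2) empty_interior_finite by blast
  then have "C - S' \<noteq> {}"
    using \<open>finite S'\<close> by (metis Diff_eq_empty_iff finite_subset)
  then show "g ` C - S \<noteq> {}"
    unfolding diff by simp
qed

lemma interior_upper_half_plane_nonempty: "interior upper_half_plane \<noteq> {}"
proof -
  have "\<i> \<in> interior upper_half_plane"
    by (rule interiorI[OF open_halfspace_Im_gt[of 0]]) auto
  then show ?thesis by blast
qed

lemma surface_neighbourhood_diff_finite:
  assumes "surface_with_boundary M" "openin M N" "x \<in> N" and S: "finite S"
  obtains W where "openin M W" "x \<in> W" "W \<subseteq> N" "path_connectedin M (W - S)" "W - S \<noteq> {}"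
proof -
  obtain C g where C: "C = UNIV \<or> C = upper_half_plane"
    and g: "open_embedding C M g" "g 0 = x" "g ` C \<subseteq> N"
    using surface_chart[OF assms(1-3)] by metis
  have "convex C" "interior C \<noteq> {}" "0 \<in> C"
    using C interior_upper_half_plane_nonempty convex_halfspace_Im_ge by auto
  then show thesis
    using that[of "g ` C"] path_connectedin_open_embedding_diff_finite[OF g(1) _ _ S] g
      open_embedding_openin[OF g(1)] by (metis imageI)
qed

lemma path_connectedin_subset_or_disjoint_component:
  assumes "path_connectedin X S"
  shows "S \<subseteq> Collect (path_component_of X x) \<or> S \<inter> Collect (path_component_of X x) = {}"
  using assms path_component_of_trans[of X x] path_component_of[of X] by blast

lemma path_connected_space_diff:
  assumes X: "connected_space X"
    and local: "\<And>N x. \<lbrakk>openin X N; x \<in> N\<rbrakk> \<Longrightarrow>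
      \<exists>W. openin X W \<and> x \<in> W \<and> W \<subseteq> N \<and> path_connectedin X (W - S) \<and> W - S \<noteq> {}"
  shows "path_connected_space (subtopology X (topspace X - S))"
  unfolding path_connected_space_iff_path_component
proof (intro ballI)
  let ?Y = "subtopology X (topspace X - S)"
  fix x y assume xy: "x \<in> topspace ?Y" "y \<in> topspace ?Y"
  define C where "C = Collect (path_component_of ?Y x)"
  define A where "A = \<Union>{W. openin X W \<and> W - S \<subseteq> C}"
  define B where "B = \<Union>{W. openin X W \<and> (W - S) \<inter> C = {}}"
  have dichotomy: "W - S \<subseteq> C \<or> (W - S) \<inter> C = {}"
    if "openin X W" "path_connectedin X (W - S)" for W
    unfolding C_def using that openin_subset[OF that(1)]
    by (intro path_connectedin_subset_or_disjoint_component)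
      (auto simp: path_connectedin_subtopology)
  have "openin X A" "openin X B"
    unfolding A_def B_def by auto
  moreover have cover: "topspace X \<subseteq> A \<union> B"
  proof
    fix z assume "z \<in> topspace X"
    then obtain W where "openin X W" "z \<in> W" "path_connectedin X (W - S)"
      using local[OF openin_topspace] by blast
    with dichotomy[of W] show "z \<in> A \<union> B"
      unfolding A_def B_def by blast
  qed
  moreover have "A \<inter> B = {}"
  proof (rule ccontr)
    assume "A \<inter> B \<noteq> {}"
    then obtain z V W where "openin X V" "V - S \<subseteq> C" "openin X W" "(W - S) \<inter> C = {}" "z \<in> V \<inter> W"
      unfolding A_def B_def by blast
    then show False
      using local[of "V \<inter> W" z] by blast
  qed
  moreover have "x \<in> A"
  proof -
    obtain W where W: "openin X W" "x \<in> W" "path_connectedin X (W - S)"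
      using local[OF openin_topspace, of x] xy(1) by auto
    moreover have "x \<in> (W - S) \<inter> C"
      using W(2) xy(1) by (auto simp: C_def path_component_of_refl)
    ultimately show ?thesis
      unfolding A_def using dichotomy[of W] by blast
  qed
  ultimately have "B = {}"
    using X unfolding connected_space_def by blast
  then have "y \<in> A"
    using cover xy(2) by auto
  then show "path_component_of ?Y x y"
    using xy(2) by (auto simp: A_def C_def)
qed

corollary surface_diff_finite_path_connected:
  assumes "surface_with_boundary M" "connected_space M" "finite S"
  shows "path_connected_space (subtopology M (topspace M - S))"
proof (rule path_connected_space_diff[OF assms(2)])
  show "\<exists>W. openin M W \<and> x \<in> W \<and> W \<subseteq> N \<and> path_connectedin M (W - S) \<and> W - S \<noteq> {}"
    if "openin M N" "x \<in> N" for N x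
    using surface_neighbourhood_diff_finite[OF assms(1) that assms(3)] by metis
qed

lemma path_component_of_config_update:
  assumes M: "surface_with_boundary M" "connected_space M"
    and z: "z \<in> topspace (ordered_config M n)" and k: "k < n"
    and y: "y \<in> topspace M" "y \<notin> z ` ({..<n} - {k})"
  shows "path_component_of (ordered_config M n) z (z(k := y))"
proof -
  let ?S = "z ` ({..<n} - {k})" and ?Y = "subtopology M (topspace M - z ` ({..<n} - {k}))"
  have inj: "inj_on z {..<n}" and top: "\<And>i. i < n \<Longrightarrow> z i \<in> topspace M"
    using z by (auto simp: topspace_ordered_config)
  have "z k \<notin> ?S"
    using inj_onD[OF inj, of k] k by auto
  then have "z k \<in> topspace ?Y" "y \<in> topspace ?Y"
    using top[OF k] y by auto
  moreover have "path_connected_space ?Y"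
    by (rule surface_diff_finite_path_connected[OF M]) simp
  ultimately obtain \<gamma> where \<gamma>: "pathin ?Y \<gamma>" "\<gamma> 0 = z k" "\<gamma> 1 = y"
    unfolding path_connected_space_def by blast
  have "pathin (ordered_config M n) (\<lambda>t. z(k := \<gamma> t))"
    unfolding pathin_def continuous_map_ordered_config
  proof (intro conjI allI impI ballI)
    show "continuous_map (top_of_set {0..1}) M (\<lambda>t. (z(k := \<gamma> t)) i)" if "i < n" for i
      using \<gamma>(1)[unfolded pathin_subtopology] top[OF that]
      by (cases "i = k") (auto simp: pathin_def)
    fix t :: real assume "t \<in> topspace (top_of_set {0..1})"
    then have "\<gamma> t \<notin> ?S"
      using \<gamma>(1) by (auto simp: pathin_subtopology)
    then have "z i \<noteq> \<gamma> t" "\<gamma> t \<noteq> z i" if "i < n" "i \<noteq> k" for i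
      using that by force+
    then show "inj_on (z(k := \<gamma> t)) {..<n}"
      using inj by (auto simp: inj_on_def)
    show "z(k := \<gamma> t) \<in> extensional {..<n}"
      using z k by (auto simp: topspace_ordered_config PiE_def extensional_def)
  qed
  then show ?thesis
    unfolding path_component_of_def using \<gamma>(2,3)
    by (intro exI[of _ "\<lambda>t. z(k := \<gamma> t)"]) auto
qed

proposition path_component_of_disjoint_configs:
  assumes M: "surface_with_boundary M" "connected_space M"
    and z: "z \<in> topspace (ordered_config M n)" and w: "w \<in> topspace (ordered_config M n)"
    and disj: "z ` {..<n} \<inter> w ` {..<n} = {}"
  shows "path_component_of (ordered_config M n) z w"
proof -
  let ?F = "ordered_config M n"
  define v where "v k = (\<lambda>i. if i < k then w i else z i)" for k
  have inj: "inj_on z {..<n}" "inj_on w {..<n}" and top: "\<And>i. i < n \<Longrightarrow> w i \<in> topspace M"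
    using z w by (auto simp: topspace_ordered_config)
  have "path_component_of ?F z (v k)" if "k \<le> n" for k
    using that
  proof (induction k)
    case 0
    then show ?case
      using z by (simp add: v_def path_component_of_refl)
  next
    case (Suc k)
    then have k: "k < n" and IH: "path_component_of ?F z (v k)" by auto
    have "w k \<noteq> v k i" if "i < n" "i \<noteq> k" for i
      using disj inj_onD[OF inj(2), of k i] k that by (auto simp: v_def)
    then have "w k \<notin> v k ` ({..<n} - {k})" by auto
    moreover have "v k \<in> topspace ?F"
      using IH path_component_of_equiv by metis
    ultimately have "path_component_of ?F (v k) ((v k)(k := w k))"
      using path_component_of_config_update[OF M _ k top[OF k]] by blast
    moreover have "(v k)(k := w k) = v (Suc k)"
      by (auto simp: v_def less_Suc_eq)
    ultimately show ?case
      using IH path_component_of_trans by metis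
  qed
  moreover have "v n = w"
    using z w by (auto simp: v_def topspace_ordered_config PiE_def extensional_def)
  ultimately show ?thesis
    by (metis order_refl)
qed

section \<open>Pushing a surface into its interior\<close>

definition radial_push :: "complex \<Rightarrow> complex \<Rightarrow> complex" where
  "radial_push a z = z + of_real (max 0 (1 - norm z)) * a"

lemma radial_push_0 [simp]: "radial_push a 0 = a"
  by (simp add: radial_push_def)

lemma radial_push_outside: "norm z \<ge> 1 \<Longrightarrow> radial_push a z = z"
  by (simp add: radial_push_def)

lemma continuous_on_radial_push: "continuous_on S (\<lambda>p. radial_push (fst p) (snd p))"
  unfolding radial_push_def by (intro continuous_intros)

lemma norm_diff_le_radial_push:
  assumes "norm a \<le> 1/2"
  shows "norm (z - z') \<le> 2 * (norm (radial_push a z - radial_push a' z') + norm (a - a'))"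
proof -
  let ?m = "\<lambda>z::complex. max 0 (1 - norm z)"
  let ?p = "radial_push a z - radial_push a' z'"
  have "\<bar>?m z - ?m z'\<bar> \<le> norm (z - z')"
    using norm_triangle_ineq3[of z z'] by linarith
  then have fst: "norm (of_real (?m z - ?m z') * a) \<le> norm (z - z') * (1/2)"
    unfolding norm_mult norm_of_real using assms by (intro mult_mono) auto
  have snd: "norm (of_real (?m z') * (a - a')) \<le> 1 * norm (a - a')"
    unfolding norm_mult norm_of_real by (intro mult_right_mono) auto
  have "?p = (z - z') + (of_real (?m z - ?m z') * a + of_real (?m z') * (a - a'))"
    by (simp add: radial_push_def algebra_simps)
  then have "norm (z - z') \<le>
      norm ?p + (norm (of_real (?m z - ?m z') * a) + norm (of_real (?m z') * (a - a')))"
    using norm_triangle_sub[of "z - z'" ?p] norm_triangle_ineq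
    by (smt (verit, best) add_diff_cancel_left' norm_minus_commute)
  then show ?thesis
    using fst snd by (simp add: algebra_simps)
qed

lemma radial_push_eq_iff:
  assumes "norm a \<le> 1/2"
  shows "radial_push a z = radial_push a z' \<longleftrightarrow> z = z'"
  using norm_diff_le_radial_push[OF assms, of z z' a] by auto

definition inward_push :: "'a topology \<Rightarrow> ('a \<Rightarrow> 'a) \<Rightarrow> bool" where
  "inward_push M f \<longleftrightarrow> continuous_map M M f \<and> inj_on f (topspace M) \<and>
     (\<forall>x\<in>topspace M. f x = x \<or> f x \<in> manifold_interior M)"

lemma inward_push_interior:
  "\<lbrakk>inward_push M f; x \<in> manifold_interior M\<rbrakk> \<Longrightarrow> f x \<in> manifold_interior M"
  using openin_subset[OF openin_manifold_interior] unfolding inward_push_def by fastforce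

lemma inward_push_compose:
  assumes f: "inward_push M f" and h: "inward_push M h"
  shows "inward_push M (\<lambda>x. h (f x))"
proof -
  have top: "f \<in> topspace M \<rightarrow> topspace M"
    using f by (auto simp: inward_push_def continuous_map_def)
  have "continuous_map M M (\<lambda>x. h (f x))"
    using f h continuous_map_compose[of M M f M h] by (simp add: inward_push_def o_def)
  moreover have "inj_on (\<lambda>x. h (f x)) (topspace M)"
    using f h top unfolding inward_push_def by (auto simp: inj_on_def Pi_iff)
  moreover have "h (f x) = x \<or> h (f x) \<in> manifold_interior M" if "x \<in> topspace M" for x
    using that f h inward_push_interior[OF h] unfolding inward_push_def by metis
  ultimately show ?thesis
    by (simp add: inward_push_def)
qed

definition half_chart_push :: "(complex \<Rightarrow> 'a) \<Rightarrow> 'a \<Rightarrow> 'a" where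
  "half_chart_push g = chart_conj upper_half_plane g (radial_push (\<i>/2))"

lemma half_chart_push_outside: "x \<notin> g ` upper_half_plane \<Longrightarrow> half_chart_push g x = x"
  by (simp add: half_chart_push_def chart_conj_outside)

lemma Im_radial_push_half_i: "Im (radial_push (\<i>/2) z) = Im z + max 0 (1 - norm z) / 2"
  by (simp add: radial_push_def)

lemma half_chart_push_interior:
  assumes g: "open_embedding upper_half_plane M g" and z: "z \<in> upper_half_plane" "norm z < 1"
  shows "half_chart_push g (g z) \<in> manifold_interior M"
proof -
  have "Im (radial_push (\<i>/2) z) > 0"
    using z by (simp add: Im_radial_push_half_i add_nonneg_pos)
  then show ?thesis
    using half_plane_chart_interior[OF g] z(1)
    by (simp add: half_chart_push_def chart_conj_chart[OF g])
qed

lemma inward_push_half_chart_push: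
  assumes M: "Hausdorff_space M" and g: "open_embedding upper_half_plane M g"
  shows "inward_push M (half_chart_push g)"
  unfolding inward_push_def
proof (intro conjI ballI)
  let ?C = upper_half_plane and ?\<phi> = "radial_push (\<i>/2)"
  have \<phi>: "?\<phi> z \<in> ?C" if "z \<in> ?C" for z
    using that by (simp add: Im_radial_push_half_i)
  have push_chart: "half_chart_push g (g z) = g (?\<phi> z)" if "z \<in> ?C" for z
    using that by (simp add: half_chart_push_def chart_conj_chart[OF g])
  show "continuous_map M M (half_chart_push g)"
    unfolding half_chart_push_def chart_conj_def
  proof (rule continuous_map_chart_extension[OF g])
    show "closedin M (g ` (?C \<inter> cball 0 1))"
      by (rule open_embedding_closedin_image[OF g M])
        (simp_all add: closed_Int_compact closed_halfspace_Im_ge)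
    show "continuous_map (top_of_set ?C) M (\<lambda>z. g (?\<phi> z))"
      by (rule open_embedding_compose_on[OF g])
        (use \<phi> in \<open>auto simp: radial_push_def intro!: continuous_intros\<close>)
  qed (auto simp: continuous_map_from_subtopology radial_push_outside)
  have "inj (half_chart_push g)"
    unfolding half_chart_push_def
    by (rule inj_chart_conj[OF g]) (use \<phi> in \<open>auto simp: inj_on_def radial_push_eq_iff\<close>)
  then show "inj_on (half_chart_push g) (topspace M)"
    by (rule inj_on_subset) simp
  show "half_chart_push g x = x \<or> half_chart_push g x \<in> manifold_interior M" for x
  proof (cases "x \<in> g ` ?C")
    case True
    then obtain z where z: "z \<in> ?C" "x = g z" by blast
    show ?thesis
    proof (cases "norm z < 1")
      case True
      with z show ?thesis using half_chart_push_interior[OF g] by simp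
    next
      case False
      with z show ?thesis by (simp add: push_chart radial_push_outside)
    qed
  qed (simp add: half_chart_push_outside)
qed

lemma inward_push_half_charts:
  assumes M: "Hausdorff_space M" and "finite \<G>" "\<And>g. g \<in> \<G> \<Longrightarrow> open_embedding upper_half_plane M g"
  obtains f where "inward_push M f" "\<And>x. x \<notin> (\<Union>g\<in>\<G>. g ` upper_half_plane) \<Longrightarrow> f x = x"
    "\<And>g z. \<lbrakk>g \<in> \<G>; z \<in> upper_half_plane; norm z < 1\<rbrakk> \<Longrightarrow> f (g z) \<in> manifold_interior M"
  using assms(2,3)
proof (induction \<G> arbitrary: thesis rule: finite_induct)
  case empty
  show ?case
    by (rule empty(1)[of "\<lambda>x. x"]) (simp_all add: inward_push_def)
next
  case (insert g \<G>)
  obtain f where f: "inward_push M f" "\<And>x. x \<notin> (\<Union>g\<in>\<G>. g ` upper_half_plane) \<Longrightarrow> f x = x"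
    "\<And>g z. \<lbrakk>g \<in> \<G>; z \<in> upper_half_plane; norm z < 1\<rbrakk> \<Longrightarrow> f (g z) \<in> manifold_interior M"
    using insert.IH insert.prems(2) by auto
  have g: "open_embedding upper_half_plane M g"
    using insert.prems(2) by simp
  have push: "inward_push M (half_chart_push g)"
    by (rule inward_push_half_chart_push[OF M g])
  show ?case
  proof (rule insert.prems(1)[of "\<lambda>x. half_chart_push g (f x)"])
    show "inward_push M (\<lambda>x. half_chart_push g (f x))"
      by (rule inward_push_compose[OF f(1) push])
    show "half_chart_push g (f x) = x" if "x \<notin> (\<Union>h\<in>insert g \<G>. h ` upper_half_plane)" for x
      using that f(2)[of x] half_chart_push_outside[of x g] by simp
    show "half_chart_push g (f (h z)) \<in> manifold_interior M"
      if h: "h \<in> insert g \<G>" and z: "z \<in> upper_half_plane" "norm z < 1" for h z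
    proof (cases "f (h z) \<in> manifold_interior M")
      case True
      then show ?thesis by (rule inward_push_interior[OF push])
    next
      case False
      then have "h = g"
        using f(3) h z by blast
      moreover have "f (h z) = h z"
        using False f(1) open_embedding_in_topspace[OF g z(1)] \<open>h = g\<close>
        unfolding inward_push_def by blast
      ultimately show ?thesis
        using half_chart_push_interior[OF g z] by simp
    qed
  qed
qed

lemma boundary_half_chart_cover:
  assumes M: "surface_with_boundary M" "compact_space M"
    and K: "closedin M K" "K \<subseteq> manifold_interior M"
  obtains \<G> where "finite \<G>" "\<And>g. g \<in> \<G> \<Longrightarrow> open_embedding upper_half_plane M g"
    "\<And>g. g \<in> \<G> \<Longrightarrow> g ` upper_half_plane \<inter> K = {}"
    "topspace M - manifold_interior M \<subseteq> (\<Union>g\<in>\<G>. g ` (upper_half_plane \<inter> ball 0 1))"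
proof -
  let ?D = "upper_half_plane \<inter> ball 0 1"
  define \<H> where "\<H> = {g. open_embedding upper_half_plane M g \<and> g ` upper_half_plane \<inter> K = {}}"
  have cover: "topspace M - manifold_interior M \<subseteq> \<Union>((\<lambda>g. g ` ?D) ` \<H>)"
  proof
    fix x assume x: "x \<in> topspace M - manifold_interior M"
    with K have N: "openin M (topspace M - K)" "x \<in> topspace M - K" by auto
    obtain C g where C: "C = UNIV \<or> C = upper_half_plane"
      and g: "open_embedding C M g" "g 0 = x" "g ` C \<subseteq> topspace M - K"
      by (rule surface_chart[OF M(1) N])
    then have "C \<noteq> UNIV"
      using x manifold_interiorI[of M g 0] by auto
    with C g have "g \<in> \<H>"
      by (auto simp: \<H>_def)
    moreover have "x \<in> g ` ?D"
      using g(2) by (intro image_eqI[of _ _ 0]) auto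
    ultimately show "x \<in> \<Union>((\<lambda>g. g ` ?D) ` \<H>)" by blast
  qed
  have "compactin M (topspace M - manifold_interior M)"
    using M(2) openin_manifold_interior closedin_compact_space by blast
  moreover have "openin M U" if U: "U \<in> (\<lambda>g. g ` ?D) ` \<H>" for U
  proof -
    obtain g where "open_embedding upper_half_plane M g" "U = g ` ?D"
      using U unfolding \<H>_def by blast
    moreover have "openin (top_of_set upper_half_plane) ?D"
      by (intro openin_open_Int open_ball)
    ultimately show ?thesis
      using open_embedding_openin_image by metis
  qed
  ultimately obtain \<F> where \<F>: "finite \<F>" "\<F> \<subseteq> (\<lambda>g. g ` ?D) ` \<H>"
    "topspace M - manifold_interior M \<subseteq> \<Union>\<F>"
    using compactinD[OF _ _ cover] by metis
  obtain \<G> where \<G>: "\<G> \<subseteq> \<H>" "finite \<G>" "\<F> = (\<lambda>g. g ` ?D) ` \<G>"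
    using finite_subset_image[OF \<F>(1,2)] by blast
  show thesis
    by (rule that[OF \<G>(2)]) (use \<G> \<F>(3) in \<open>auto simp: \<H>_def\<close>)
qed

proposition push_into_interior:
  assumes M: "surface_with_boundary M" "compact_space M"
    and K: "closedin M K" "K \<subseteq> manifold_interior M"
  obtains f where "continuous_map M M f" "inj_on f (topspace M)"
    "f ` topspace M \<subseteq> manifold_interior M" "\<And>x. x \<in> K \<Longrightarrow> f x = x"
proof -
  obtain \<G> where \<G>: "finite \<G>" "\<And>g. g \<in> \<G> \<Longrightarrow> open_embedding upper_half_plane M g"
    "\<And>g. g \<in> \<G> \<Longrightarrow> g ` upper_half_plane \<inter> K = {}"
    "topspace M - manifold_interior M \<subseteq> (\<Union>g\<in>\<G>. g ` (upper_half_plane \<inter> ball 0 1))"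
    by (rule boundary_half_chart_cover[OF M K]) (rule that)
  have T2: "Hausdorff_space M"
    using M(1) by (simp add: surface_with_boundary_def)
  obtain f where f: "inward_push M f"
    "\<And>x. x \<notin> (\<Union>g\<in>\<G>. g ` upper_half_plane) \<Longrightarrow> f x = x"
    "\<And>g z. \<lbrakk>g \<in> \<G>; z \<in> upper_half_plane; norm z < 1\<rbrakk> \<Longrightarrow> f (g z) \<in> manifold_interior M"
    by (rule inward_push_half_charts[OF T2 \<G>(1,2)]) (simp, rule that)
  have "f x \<in> manifold_interior M" if "x \<in> topspace M" for x
  proof (cases "x \<in> manifold_interior M")
    case True
    then show ?thesis by (rule inward_push_interior[OF f(1)])
  next
    case False
    then obtain g z where "g \<in> \<G>" "z \<in> upper_half_plane" "norm z < 1" "x = g z"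
      using \<G>(4) \<open>x \<in> topspace M\<close> by fastforce
    then show ?thesis using f(3) by simp
  qed
  moreover have "f x = x" if "x \<in> K" for x
    using f(2) \<G>(3) that by blast
  ultimately show thesis
    using f(1) that unfolding inward_push_def by blast
qed

section \<open>Trivializing moving points over a disc\<close>

definition isotopy :: "'t topology \<Rightarrow> 'a topology \<Rightarrow> ('t \<Rightarrow> 'a \<Rightarrow> 'a) \<Rightarrow> ('t \<Rightarrow> 'a \<Rightarrow> 'a) \<Rightarrow> bool" where
  "isotopy T M h k \<longleftrightarrow>
     continuous_map (prod_topology T M) M (\<lambda>(t, m). h t m) \<and>
     continuous_map (prod_topology T M) M (\<lambda>(t, m). k t m) \<and>
     (\<forall>t\<in>topspace T. \<forall>m\<in>topspace M. k t (h t m) = m \<and> h t (k t m) = m)"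

lemma isotopyD:
  assumes "isotopy T M h k" "t \<in> topspace T" "m \<in> topspace M"
  shows "k t (h t m) = m" "h t (k t m) = m" "h t m \<in> topspace M" "k t m \<in> topspace M"
proof -
  have "(t, m) \<in> topspace (prod_topology T M)"
    using assms by simp
  moreover have "continuous_map (prod_topology T M) M (\<lambda>(t, m). h t m)"
    "continuous_map (prod_topology T M) M (\<lambda>(t, m). k t m)"
    using assms(1) by (simp_all add: isotopy_def)
  ultimately show "h t m \<in> topspace M" "k t m \<in> topspace M"
    unfolding continuous_map_def Pi_iff by fast+
  show "k t (h t m) = m" "h t (k t m) = m"
    using assms by (simp_all add: isotopy_def)
qed

lemma isotopy_eq_iff:
  assumes "isotopy T M h k" "t \<in> topspace T" "m \<in> topspace M" "m' \<in> topspace M"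
  shows "h t m = h t m' \<longleftrightarrow> m = m'"
  using isotopyD(1)[OF assms(1,2,3)] isotopyD(1)[OF assms(1,2,4)] by metis

lemma isotopy_inverse: "isotopy T M h k \<Longrightarrow> isotopy T M k h"
  by (simp add: isotopy_def)

lemma continuous_map_isotopy_apply:
  assumes "isotopy T M h k" "continuous_map S T r" "continuous_map S M y"
  shows "continuous_map S M (\<lambda>s. h (r s) (y s))"
proof -
  have "continuous_map S (prod_topology T M) (\<lambda>s. (r s, y s))"
    using assms(2,3) by (rule continuous_map_pairedI)
  moreover have "continuous_map (prod_topology T M) M (\<lambda>(t, m). h t m)"
    using assms(1) by (simp add: isotopy_def)
  ultimately show ?thesis
    using continuous_map_compose by (fastforce simp: o_def)
qed

lemma isotopy_pullback:
  assumes I: "isotopy T M h k" and r: "continuous_map S T r"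
  shows "isotopy S M (\<lambda>s. h (r s)) (\<lambda>s. k (r s))"
proof -
  have r': "continuous_map (prod_topology S M) T (\<lambda>p. r (fst p))"
    using continuous_map_compose[OF continuous_map_fst r] by (simp add: o_def)
  have "r s \<in> topspace T" if "s \<in> topspace S" for s
    using r that by (auto simp: continuous_map_def)
  then show ?thesis
    using continuous_map_isotopy_apply[OF I r' continuous_map_snd]
      continuous_map_isotopy_apply[OF isotopy_inverse[OF I] r' continuous_map_snd]
      isotopyD(1,2)[OF I]
    by (simp add: isotopy_def case_prod_unfold)
qed

lemma isotopy_compose:
  assumes I: "isotopy T M h k" and I': "isotopy T M h' k'"
  shows "isotopy T M (\<lambda>t m. h t (h' t m)) (\<lambda>t m. k' t (k t m))"
  unfolding isotopy_def
proof (intro conjI ballI)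
  note apply_snd = continuous_map_isotopy_apply[OF _ continuous_map_fst continuous_map_snd]
  show "continuous_map (prod_topology T M) M (\<lambda>(t, m). h t (h' t m))"
    using continuous_map_isotopy_apply[OF I continuous_map_fst apply_snd[OF I']]
    by (simp add: case_prod_unfold)
  show "continuous_map (prod_topology T M) M (\<lambda>(t, m). k' t (k t m))"
    using continuous_map_isotopy_apply[OF isotopy_inverse[OF I'] continuous_map_fst
        apply_snd[OF isotopy_inverse[OF I]]]
    by (simp add: case_prod_unfold)
qed (use isotopyD[OF I] isotopyD[OF I'] in simp_all)

lemma isotopy_homeomorphic_map:
  assumes I: "isotopy T M h k" and t: "t \<in> topspace T"
  shows "homeomorphic_map M M (h t)"
proof -
  have const: "continuous_map M T (\<lambda>_. t)"
    using t by simp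
  have "homeomorphic_maps M M (h t) (k t)"
    using continuous_map_isotopy_apply[OF I const continuous_map_id]
      continuous_map_isotopy_apply[OF isotopy_inverse[OF I] const continuous_map_id]
      isotopyD(1,2)[OF I t]
    by (simp add: homeomorphic_maps_def)
  then show ?thesis
    unfolding homeomorphic_map_maps by blast
qed

lemma homeomorphic_map_manifold_interior:
  assumes f: "homeomorphic_map M M f" and m: "m \<in> manifold_interior M"
  shows "f m \<in> manifold_interior M"
proof -
  obtain e :: "complex \<Rightarrow> 'a" and z where e: "open_embedding UNIV M e" and m: "m = e z"
    using m by (auto simp: manifold_interior_def)
  have "range e \<subseteq> topspace M"
    using open_embedding_in_topspace[OF e] by blast
  then have "inj (f \<circ> e)"
    using comp_inj_on[OF open_embeddingD(3)[OF e]] homeomorphic_imp_injective_map[OF f]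
    by (metis inj_on_subset)
  moreover have "continuous_map (top_of_set UNIV) M (f \<circ> e)"
    by (rule continuous_map_compose[OF open_embeddingD(1)[OF e]
          homeomorphic_imp_continuous_map[OF f]])
  moreover have "open_map (top_of_set UNIV) M (f \<circ> e)"
    by (rule open_map_compose[OF open_embeddingD(2)[OF e] homeomorphic_imp_open_map[OF f]])
  ultimately have "open_embedding UNIV M (f \<circ> e)"
    by (simp add: open_embedding_def)
  from manifold_interiorI[OF this, of z] show ?thesis
    by (simp add: m)
qed

lemma prod_topology_top_of_set_subset:
  "B \<subseteq> A \<Longrightarrow>
    subtopology (prod_topology (top_of_set A) M) (B \<times> topspace M) = prod_topology (top_of_set B) M"
  by (simp add: subtopology_Times subtopology_subtopology Int_absorb1)

lemma continuous_map_prod_cases_le: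
  fixes A :: "'b::topological_space set" and f :: "'b \<Rightarrow> real"
  assumes f: "continuous_on A f"
    and g1: "continuous_map (prod_topology (top_of_set {s \<in> A. f s \<le> c}) M) X (\<lambda>(s, m). g1 s m)"
    and g2: "continuous_map (prod_topology (top_of_set {s \<in> A. c \<le> f s}) M) X (\<lambda>(s, m). g2 s m)"
    and eq: "\<And>s m. \<lbrakk>s \<in> A; f s = c; m \<in> topspace M\<rbrakk> \<Longrightarrow> g1 s m = g2 s m"
  shows "continuous_map (prod_topology (top_of_set A) M) X
    (\<lambda>(s, m). (if f s \<le> c then g1 s else g2 s) m)"
proof -
  let ?P = "prod_topology (top_of_set A) M"
  have "continuous_map ?P euclideanreal (f \<circ> fst)"
    by (rule continuous_map_compose[OF continuous_map_fst]) (use f in simp)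
  moreover have "{p \<in> topspace ?P. f (fst p) \<le> c} = {s \<in> A. f s \<le> c} \<times> topspace M"
    "{p \<in> topspace ?P. c \<le> f (fst p)} = {s \<in> A. c \<le> f s} \<times> topspace M"
    by auto
  then have "subtopology ?P {p \<in> topspace ?P. f (fst p) \<le> c} =
      prod_topology (top_of_set {s \<in> A. f s \<le> c}) M"
    "subtopology ?P {p \<in> topspace ?P. c \<le> f (fst p)} =
      prod_topology (top_of_set {s \<in> A. c \<le> f s}) M"
    by (simp_all only: prod_topology_top_of_set_subset[OF Collect_restrict])
  ultimately have "continuous_map ?P X
      (\<lambda>p. if f (fst p) \<le> c then (\<lambda>(s, m). g1 s m) p else (\<lambda>(s, m). g2 s m) p)"
    using g1 g2 eq by (intro continuous_map_cases_le) (auto simp: o_def)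
  then show ?thesis
    by (rule continuous_map_eq) auto
qed

lemma isotopy_glue:
  fixes A :: "'b::topological_space set" and f :: "'b \<Rightarrow> real"
  assumes f: "continuous_on A f"
    and I1: "isotopy (top_of_set {s \<in> A. f s \<le> c}) M h1 k1"
    and I2: "isotopy (top_of_set {s \<in> A. c \<le> f s}) M h2 k2"
    and eq: "\<And>s m. \<lbrakk>s \<in> A; f s = c; m \<in> topspace M\<rbrakk> \<Longrightarrow> h1 s m = h2 s m \<and> k1 s m = k2 s m"
  shows "isotopy (top_of_set A) M (\<lambda>s. if f s \<le> c then h1 s else h2 s)
    (\<lambda>s. if f s \<le> c then k1 s else k2 s)"
proof -
  let ?h = "\<lambda>s. if f s \<le> c then h1 s else h2 s" and ?k = "\<lambda>s. if f s \<le> c then k1 s else k2 s"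
  have "continuous_map (prod_topology (top_of_set A) M) M (\<lambda>(s, m). ?h s m)"
    "continuous_map (prod_topology (top_of_set A) M) M (\<lambda>(s, m). ?k s m)"
    using f I1 I2 eq unfolding isotopy_def by (intro continuous_map_prod_cases_le; simp)+
  moreover have "?k s (?h s m) = m \<and> ?h s (?k s m) = m" if "s \<in> A" "m \<in> topspace M" for s m
    using that isotopyD(1,2)[OF I1, of s m] isotopyD(1,2)[OF I2, of s m] by simp
  ultimately show ?thesis
    by (simp add: isotopy_def)
qed

lemma surj_radial_push:
  assumes a: "norm a \<le> 1/2"
  shows "surj (radial_push a)"
proof -
  have "w \<in> range (radial_push a)" for w
  proof -
    let ?f = "\<lambda>z. w - of_real (max 0 (1 - norm z)) * a"
    have "dist (?f x) (?f y) \<le> 1/2 * dist x y" for x y :: complex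
    proof -
      have "?f x - ?f y = of_real (max 0 (1 - norm y) - max 0 (1 - norm x)) * a"
        by (simp add: algebra_simps)
      then have "norm (?f x - ?f y) = \<bar>max 0 (1 - norm y) - max 0 (1 - norm x)\<bar> * norm a"
        by (simp only: norm_mult norm_of_real)
      also have "\<dots> \<le> norm (x - y) * (1/2)"
        using a norm_triangle_ineq3[of x y] by (intro mult_mono) auto
      finally show ?thesis
        by (simp add: dist_norm)
    qed
    then obtain z where "?f z = z"
      using banach_fix_type[of "1/2" ?f] by auto
    then have "w = radial_push a z"
      by (simp add: radial_push_def algebra_simps)
    then show ?thesis by blast
  qed
  then show ?thesis by blast
qed

definition radial_pull :: "complex \<Rightarrow> complex \<Rightarrow> complex" where
  "radial_pull a = inv_into UNIV (radial_push a)"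

lemma radial_push_pull: "norm a \<le> 1/2 \<Longrightarrow> radial_push a (radial_pull a z) = z"
  by (simp add: radial_pull_def surj_radial_push surj_f_inv_f)

lemma radial_pull_push: "norm a \<le> 1/2 \<Longrightarrow> radial_pull a (radial_push a z) = z"
  using radial_push_eq_iff radial_push_pull by blast

lemma continuous_on_radial_pull:
  "continuous_on (cball 0 (1/2) \<times> UNIV) (\<lambda>p. radial_pull (fst p) (snd p))"
  unfolding continuous_on_iff
proof (intro ballI allI impI)
  fix x :: "complex \<times> complex" and e :: real
  assume x: "x \<in> cball 0 (1/2) \<times> UNIV" and "e > 0"
  have "dist (radial_pull (fst y) (snd y)) (radial_pull (fst x) (snd x)) < e"
    if y: "y \<in> cball 0 (1/2) \<times> UNIV" "dist y x < e/4" for y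
  proof -
    have "norm (fst x) \<le> 1/2" "norm (fst y) \<le> 1/2"
      using x y by auto
    then have "dist (radial_pull (fst y) (snd y)) (radial_pull (fst x) (snd x))
        \<le> 2 * (dist (snd y) (snd x) + dist (fst y) (fst x))"
      using norm_diff_le_radial_push[of "fst y" "radial_pull (fst y) (snd y)"
          "radial_pull (fst x) (snd x)" "fst x"]
      by (simp add: radial_push_pull dist_norm)
    then show ?thesis
      using y(2) dist_fst_le[of y x] dist_snd_le[of y x] by argo
  qed
  then show "\<exists>d>0. \<forall>y\<in>cball 0 (1/2) \<times> UNIV. dist y x < d \<longrightarrow>
      dist (radial_pull (fst y) (snd y)) (radial_pull (fst x) (snd x)) < e"
    using \<open>e > 0\<close> by (intro exI[of _ "e/4"]) auto
qed

lemma isotopy_chart_conj_radial_push: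
  assumes M: "Hausdorff_space M" and e: "open_embedding UNIV M e"
  shows "isotopy (top_of_set (cball 0 (1/2))) M (\<lambda>a. chart_conj UNIV e (radial_push a))
    (\<lambda>a. chart_conj UNIV e (radial_pull a))"
  unfolding isotopy_def
proof (intro conjI ballI)
  have K: "closedin M (e ` cball 0 1)"
    using open_embedding_closedin_image[OF e M] by simp
  show "continuous_map (prod_topology (top_of_set (cball 0 (1/2))) M) M
      (\<lambda>(a, m). chart_conj UNIV e (radial_push a) m)"
    by (rule continuous_map_chart_conj_family[OF e K _ continuous_on_radial_push])
      (auto simp: radial_push_outside)
  have "radial_pull a z = z" if "norm a \<le> 1/2" "norm z \<ge> 1" for a z
    using radial_pull_push[OF that(1), of z] radial_push_outside[OF that(2), of a] by simp
  then show "continuous_map (prod_topology (top_of_set (cball 0 (1/2))) M) M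
      (\<lambda>(a, m). chart_conj UNIV e (radial_pull a) m)"
    by (intro continuous_map_chart_conj_family[OF e K _ continuous_on_radial_pull]) auto
  fix a m assume "a \<in> topspace (top_of_set (cball (0::complex) (1/2)))"
  then have "norm a \<le> 1/2" by simp
  then show "chart_conj UNIV e (radial_pull a) (chart_conj UNIV e (radial_push a) m) = m"
    "chart_conj UNIV e (radial_push a) (chart_conj UNIV e (radial_pull a) m) = m"
    by (cases "m \<in> range e"; auto simp: chart_conj_outside chart_conj_chart[OF e]
        radial_push_pull radial_pull_push)+
qed

definition trivializes ::
    "'a topology \<Rightarrow> 'a set \<Rightarrow> 't::topological_space set \<Rightarrow> ('t \<Rightarrow> 'a) \<Rightarrow> bool" where
  "trivializes M Z A x \<longleftrightarrow> (\<exists>h k b. isotopy (top_of_set A) M h k \<and> b \<in> topspace M \<and>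
     (\<forall>s\<in>A. h s b = x s \<and> (\<forall>z\<in>Z. h s z = z)))"

lemma trivializesE:
  assumes "trivializes M Z A x"
  obtains h k b where "isotopy (top_of_set A) M h k" "b \<in> topspace M"
    "\<And>s. s \<in> A \<Longrightarrow> h s b = x s" "\<And>s z. \<lbrakk>s \<in> A; z \<in> Z\<rbrakk> \<Longrightarrow> h s z = z"
  using assms unfolding trivializes_def by blast

lemma trivializes_pullback:
  assumes x: "trivializes M Z A x" and r: "continuous_on B r" "r \<in> B \<rightarrow> A"
  shows "trivializes M Z B (\<lambda>s. x (r s))"
proof -
  obtain h k b where hk: "isotopy (top_of_set A) M h k" "b \<in> topspace M"
    "\<And>s. s \<in> A \<Longrightarrow> h s b = x s" "\<And>s z. \<lbrakk>s \<in> A; z \<in> Z\<rbrakk> \<Longrightarrow> h s z = z"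
    using trivializesE[OF x] by blast
  have "continuous_map (top_of_set B) (top_of_set A) r"
    using r by auto
  from isotopy_pullback[OF hk(1) this] show ?thesis
    unfolding trivializes_def using hk(2-4) r(2) by blast
qed

lemma trivializes_cong: "\<lbrakk>trivializes M Z A x; \<And>s. s \<in> A \<Longrightarrow> x s = y s\<rbrakk> \<Longrightarrow> trivializes M Z A y"
  unfolding trivializes_def by fastforce

lemma trivializes_based:
  assumes Z: "Z \<subseteq> topspace M" and x: "trivializes M Z A x" and s0: "s0 \<in> A"
  obtains h k where "isotopy (top_of_set A) M h k" "\<And>m. m \<in> topspace M \<Longrightarrow> h s0 m = m"
    "\<And>s. s \<in> A \<Longrightarrow> h s (x s0) = x s" "\<And>s z. \<lbrakk>s \<in> A; z \<in> Z\<rbrakk> \<Longrightarrow> h s z = z"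
proof -
  obtain h k b where hk: "isotopy (top_of_set A) M h k" "b \<in> topspace M"
    "\<And>s. s \<in> A \<Longrightarrow> h s b = x s" "\<And>s z. \<lbrakk>s \<in> A; z \<in> Z\<rbrakk> \<Longrightarrow> h s z = z"
    using trivializesE[OF x] by blast
  have "continuous_map (top_of_set A) (top_of_set A) (\<lambda>_. s0)"
    using s0 by simp
  then have I: "isotopy (top_of_set A) M (\<lambda>s m. h s (k s0 m)) (\<lambda>s m. h s0 (k s m))"
    by (intro isotopy_compose[OF hk(1)] isotopy_inverse[OF isotopy_pullback[OF hk(1)]])
  have inverse: "k s0 (h s0 m) = m" "h s0 (k s0 m) = m" if "m \<in> topspace M" for m
    using isotopyD[OF hk(1), of s0 m] that s0 by simp_all
  show thesis
  proof (rule that[OF I])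
    show "h s0 (k s0 m) = m" if "m \<in> topspace M" for m
      by (rule inverse(2)[OF that])
    show "h s (k s0 (x s0)) = x s" if "s \<in> A" for s
      using inverse(1)[OF hk(2)] hk(3) that s0 by simp
    show "h s (k s0 z) = z" if "s \<in> A" "z \<in> Z" for s z
      using inverse(1)[of z] hk(4)[OF s0 that(2)] hk(4)[OF that] that(2) Z by auto
  qed
qed

lemma trivializes_glue:
  fixes A :: "'b::topological_space set" and f :: "'b \<Rightarrow> real"
  assumes Z: "Z \<subseteq> topspace M" and f: "continuous_on A f"
    and r: "continuous_on {s \<in> A. c \<le> f s} r" "\<And>s. \<lbrakk>s \<in> A; c \<le> f s\<rbrakk> \<Longrightarrow> r s \<in> A \<and> f (r s) = c"
      "\<And>s. \<lbrakk>s \<in> A; f s = c\<rbrakk> \<Longrightarrow> r s = s"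
    and x1: "trivializes M Z {s \<in> A. f s \<le> c} x" and x2: "trivializes M Z {s \<in> A. c \<le> f s} x"
  shows "trivializes M Z A x"
proof -
  let ?A1 = "{s \<in> A. f s \<le> c}" and ?A2 = "{s \<in> A. c \<le> f s}"
  obtain h1 k1 b1 where t1: "isotopy (top_of_set ?A1) M h1 k1" "b1 \<in> topspace M"
    "\<And>s. s \<in> ?A1 \<Longrightarrow> h1 s b1 = x s" "\<And>s z. \<lbrakk>s \<in> ?A1; z \<in> Z\<rbrakk> \<Longrightarrow> h1 s z = z"
    using trivializesE[OF x1] by blast
  obtain h2 k2 b2 where t2: "isotopy (top_of_set ?A2) M h2 k2" "b2 \<in> topspace M"
    "\<And>s. s \<in> ?A2 \<Longrightarrow> h2 s b2 = x s" "\<And>s z. \<lbrakk>s \<in> ?A2; z \<in> Z\<rbrakk> \<Longrightarrow> h2 s z = z"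
    using trivializesE[OF x2] by blast
  have r1: "continuous_map (top_of_set ?A2) (top_of_set ?A1) r"
    and r2: "continuous_map (top_of_set ?A2) (top_of_set ?A2) r"
    using r(1,2) by (auto simp: continuous_map_in_subtopology)
  (* h2 is corrected over A2 so that it agrees with h1 over the common face, onto which r
     retracts. *)
  define h3 where "h3 s m = h2 s (k2 (r s) (h1 (r s) m))" for s m
  define k3 where "k3 s m = k1 (r s) (h2 (r s) (k2 s m))" for s m
  have t3: "isotopy (top_of_set ?A2) M h3 k3"
    using isotopy_compose[OF t2(1) isotopy_compose[OF
          isotopy_inverse[OF isotopy_pullback[OF t2(1) r2]] isotopy_pullback[OF t1(1) r1]]]
    unfolding h3_def k3_def .
  have "h1 s m = h3 s m \<and> k1 s m = k3 s m" if s: "s \<in> A" "f s = c" and m: "m \<in> topspace M" for s m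
    using isotopyD[OF t1(1), of s m] isotopyD[OF t2(1), of s m]
      isotopyD(2)[OF t2(1), of s "h1 s m"] s m
    by (simp add: h3_def k3_def r(3)[OF s])
  then have glued: "isotopy (top_of_set A) M (\<lambda>s. if f s \<le> c then h1 s else h3 s)
      (\<lambda>s. if f s \<le> c then k1 s else k3 s)"
    by (rule isotopy_glue[OF f t1(1) t3])
  show ?thesis
    unfolding trivializes_def
  proof (intro exI conjI ballI, rule glued, rule t1(2))
    fix s assume s: "s \<in> A"
    have "k2 (r s) (x (r s)) = b2" if "c \<le> f s"
      using r(2)[OF s that] t2(3)[of "r s"] isotopyD(1)[OF t2(1), of "r s" b2] t2(2) by simp
    then show "(if f s \<le> c then h1 s else h3 s) b1 = x s"
      using s t1(3)[of s] t1(3)[of "r s"] t2(3)[of s] r(2)[OF s] by (auto simp: h3_def)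
    fix z assume z: "z \<in> Z"
    have "k2 (r s) z = z" if "c \<le> f s"
      using r(2)[OF s that] t2(4)[of "r s" z] isotopyD(1)[OF t2(1), of "r s" z] z Z by auto
    then show "(if f s \<le> c then h1 s else h3 s) z = z"
      using s z t1(4)[of s z] t1(4)[of "r s" z] t2(4)[of s z] r(2)[OF s] by (auto simp: h3_def)
  qed
qed

lemma trivializes_locally:
  assumes M: "Hausdorff_space M" and Z: "closedin M Z"
    and x: "continuous_map (top_of_set A) M x" and s0: "s0 \<in> A"
    and interior: "x s0 \<in> manifold_interior M" and avoids: "x s0 \<notin> Z"
  obtains V where "openin (top_of_set A) V" "s0 \<in> V" "trivializes M Z V x"
proof -
  have "openin M (topspace M - Z)" "x s0 \<in> topspace M - Z"
    using Z x s0 avoids by (auto simp: continuous_map_def)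
  then obtain e :: "complex \<Rightarrow> 'a" where e: "open_embedding UNIV M e" "e 0 = x s0"
    "range e \<subseteq> topspace M - Z"
    by (rule interior_chart[OF interior])
  define V where "V = {s \<in> A. x s \<in> e ` ball 0 (1/2)}"
  have "openin M (e ` ball 0 (1/2))"
    using open_embedding_openin_image[OF e(1)] by simp
  then have V: "openin (top_of_set A) V"
    using openin_continuous_map_preimage[OF x] by (simp add: V_def)
  have "s0 \<in> V"
    using e(2) s0 by (auto simp: V_def intro: image_eqI[of _ _ 0])
  let ?q = "\<lambda>s. inv_into UNIV e (x s)"
  have q: "?q s \<in> ball 0 (1/2)" "e (?q s) = x s" if "s \<in> V" for s
    using that open_embeddingD(3)[OF e(1)] by (auto simp: V_def)
  have "continuous_map (top_of_set V) (subtopology M (range e)) x"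
    using continuous_map_from_subtopology_mono[OF x, of V] by (auto simp: V_def intro!:
        continuous_map_into_subtopology)
  then have "continuous_map (top_of_set V) (top_of_set UNIV) ?q"
    using continuous_map_compose[OF _ continuous_map_inv_into_open_embedding[OF e(1)]]
    by (fastforce simp: o_def)
  then have "continuous_map (top_of_set V) (top_of_set (cball 0 (1/2))) ?q"
    using q(1) by (force simp: continuous_map_in_subtopology)
  note I = isotopy_pullback[OF isotopy_chart_conj_radial_push[OF M e(1)] this]
  have "trivializes M Z V x"
    unfolding trivializes_def
  proof (intro exI conjI ballI, rule I)
    show "e 0 \<in> topspace M"
      using open_embedding_in_topspace[OF e(1)] by simp
    fix s assume "s \<in> V"
    then show "chart_conj UNIV e (radial_push (?q s)) (e 0) = x s"
      using q(2) by (simp add: chart_conj_chart[OF e(1)])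
    fix z assume "z \<in> Z"
    then have "z \<notin> range e"
      using e(3) by blast
    then show "chart_conj UNIV e (radial_push (?q s)) z = z"
      by (rule chart_conj_outside)
  qed
  with V \<open>s0 \<in> V\<close> show thesis by (rule that)
qed

lemma trivializes_unit_square:
  assumes M: "Hausdorff_space M" and Z: "closedin M Z"
    and x: "continuous_map (top_of_set unit_square) M x"
    and interior: "x \<in> unit_square \<rightarrow> manifold_interior M - Z"
  shows "trivializes M Z unit_square x"
proof (rule unit_square_induct)
  have ZM: "Z \<subseteq> topspace M"
    using Z closedin_subset by blast
  fix a b c s t :: real
  assume le: "a \<le> b" "b \<le> c" "s \<le> t"
    and pieces: "trivializes M Z ({a..b} \<times> {s..t}) x" "trivializes M Z ({b..c} \<times> {s..t}) x"
  have halves: "{p \<in> {a..c} \<times> {s..t}. fst p \<le> b} = {a..b} \<times> {s..t}"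
    "{p \<in> {a..c} \<times> {s..t}. b \<le> fst p} = {b..c} \<times> {s..t}"
    using le by auto
  show "trivializes M Z ({a..c} \<times> {s..t}) x"
    by (rule trivializes_glue[OF ZM, where f = fst and c = b and r = "\<lambda>p. (b, snd p)"])
      (use le pieces in \<open>auto simp: halves intro!: continuous_intros\<close>)
next
  have ZM: "Z \<subseteq> topspace M"
    using Z closedin_subset by blast
  fix a b r s t :: real
  assume le: "a \<le> b" "r \<le> s" "s \<le> t"
    and pieces: "trivializes M Z ({a..b} \<times> {r..s}) x" "trivializes M Z ({a..b} \<times> {s..t}) x"
  have halves: "{p \<in> {a..b} \<times> {r..t}. snd p \<le> s} = {a..b} \<times> {r..s}"
    "{p \<in> {a..b} \<times> {r..t}. s \<le> snd p} = {a..b} \<times> {s..t}"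
    using le by auto
  show "trivializes M Z ({a..b} \<times> {r..t}) x"
    by (rule trivializes_glue[OF ZM, where f = snd and c = s and r = "\<lambda>p. (fst p, s)"])
      (use le pieces in \<open>auto simp: halves intro!: continuous_intros\<close>)
next
  fix s assume "s \<in> unit_square"
  moreover from this have "x s \<in> manifold_interior M" "x s \<notin> Z"
    using interior by auto
  ultimately obtain V where "openin (top_of_set unit_square) V" "s \<in> V" "trivializes M Z V x"
    by (rule trivializes_locally[OF M Z x])
  then show "\<exists>U. openin (top_of_set unit_square) U \<and> s \<in> U \<and> (\<forall>R\<subseteq>U. trivializes M Z R x)"
    using trivializes_pullback[of M Z V x _ "\<lambda>s. s"] by (intro exI[of _ V]) auto
qed

lemma trivializes_unit_disc:
  assumes M: "Hausdorff_space M" and Z: "closedin M Z"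
    and x: "continuous_map (top_of_set (cball (0::complex) 1)) M x"
    and interior: "x \<in> cball 0 1 \<rightarrow> manifold_interior M - Z"
  shows "trivializes M Z (cball 0 1) x"
proof -
  let ?D = "cball (0::complex) 1"
  define f where "f p = closest_point ?D (Complex (2 * fst p - 1) (2 * snd p - 1))" for p
  define sq where "sq z = ((Re z + 1) / 2, (Im z + 1) / 2)" for z
  have f_in: "f p \<in> ?D" for p
    unfolding f_def by (rule closest_point_in_set) auto
  have "continuous_on unit_square f"
    unfolding f_def Complex_eq
    by (intro continuous_intros continuous_on_compose2[OF continuous_on_closest_point[of ?D UNIV]])
      auto
  then have "continuous_map (top_of_set unit_square) M (\<lambda>p. x (f p))"
    using f_in by (intro continuous_map_compose_on[OF x]) auto
  then have "trivializes M Z unit_square (\<lambda>p. x (f p))"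
    using interior f_in by (intro trivializes_unit_square[OF M Z]) auto
  moreover have "sq z \<in> unit_square" if "z \<in> ?D" for z
    using that abs_Re_le_cmod[of z] abs_Im_le_cmod[of z] by (auto simp: sq_def)
  moreover have "continuous_on ?D sq"
    unfolding sq_def by (intro continuous_intros) auto
  ultimately have "trivializes M Z ?D (\<lambda>z. x (f (sq z)))"
    using trivializes_pullback[where A = unit_square and r = sq] by blast
  moreover have "f (sq z) = z" if "z \<in> ?D" for z
  proof -
    have "Complex (2 * fst (sq z) - 1) (2 * snd (sq z) - 1) = z"
      by (simp add: sq_def complex_eq_iff add_divide_distrib)
    then show ?thesis
      using that by (simp add: f_def closest_point_self)
  qed
  ultimately show ?thesis
    using trivializes_cong[of M Z ?D "\<lambda>z. x (f (sq z))" x] by simp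
qed

lemma trivializes_after_isotopy:
  fixes x :: "complex \<Rightarrow> 'a"
  assumes M: "Hausdorff_space M" and I: "isotopy (top_of_set (cball 0 1)) M h k"
    and x: "continuous_map (top_of_set (cball 0 1)) M x" "x \<in> cball 0 1 \<rightarrow> manifold_interior M"
    and Z: "closedin M Z" "\<And>z q. \<lbrakk>norm z \<le> 1; q \<in> Z\<rbrakk> \<Longrightarrow> x z \<noteq> h z q"
  shows "trivializes M Z (cball 0 1) (\<lambda>z. k z (x z))"
proof (rule trivializes_unit_disc[OF M Z(1)])
  show "continuous_map (top_of_set (cball 0 1)) M (\<lambda>z. k z (x z))"
    using continuous_map_isotopy_apply[OF isotopy_inverse[OF I] continuous_map_id x(1)] by simp
  show "(\<lambda>z. k z (x z)) \<in> cball 0 1 \<rightarrow> manifold_interior M - Z"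
  proof (intro Pi_I DiffI)
    fix z assume z: "z \<in> cball (0::complex) 1"
    have "homeomorphic_map M M (k z)"
      using isotopy_homeomorphic_map[OF isotopy_inverse[OF I]] z by simp
    then show "k z (x z) \<in> manifold_interior M"
      using x(2) z by (auto intro: homeomorphic_map_manifold_interior)
    have "x z \<in> topspace M"
      using continuous_map_image_subset_topspace[OF x(1)] z by auto
    then have "h z (k z (x z)) = x z"
      using isotopyD(2)[OF I] z by simp
    then show "k z (x z) \<notin> Z"
      using Z(2)[of z "k z (x z)"] z by auto
  qed
qed

lemma isotopy_extension_insert:
  fixes x :: "complex \<Rightarrow> 'a"
  assumes M: "Hausdorff_space M" and I: "isotopy (top_of_set (cball 0 1)) M h k"
    and z0: "norm z0 \<le> 1" and base: "\<And>m. m \<in> topspace M \<Longrightarrow> h z0 m = m"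
    and x: "continuous_map (top_of_set (cball 0 1)) M x" "x \<in> cball 0 1 \<rightarrow> manifold_interior M"
    and Z: "closedin M Z" "\<And>z q. \<lbrakk>norm z \<le> 1; q \<in> Z\<rbrakk> \<Longrightarrow> x z \<noteq> h z q"
  obtains h' k' where "isotopy (top_of_set (cball 0 1)) M h' k'"
    "\<And>m. m \<in> topspace M \<Longrightarrow> h' z0 m = m" "\<And>z. norm z \<le> 1 \<Longrightarrow> h' z (x z0) = x z"
    "\<And>z q. \<lbrakk>norm z \<le> 1; q \<in> Z\<rbrakk> \<Longrightarrow> h' z q = h z q"
proof -
  let ?D = "cball (0::complex) 1"
  have x_top: "x z \<in> topspace M" if "norm z \<le> 1" for z
    using continuous_map_image_subset_topspace[OF x(1)] that by auto
  have "trivializes M Z ?D (\<lambda>z. k z (x z))"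
    using M I x Z by (rule trivializes_after_isotopy)
  then obtain g g' where g: "isotopy (top_of_set ?D) M g g'"
    "\<And>m. m \<in> topspace M \<Longrightarrow> g z0 m = m" "\<And>z. z \<in> ?D \<Longrightarrow> g z (k z0 (x z0)) = k z (x z)"
    "\<And>z m. \<lbrakk>z \<in> ?D; m \<in> Z\<rbrakk> \<Longrightarrow> g z m = m"
    using trivializes_based[OF closedin_subset[OF Z(1)], of ?D _ z0] z0 by auto
  have kx: "k z (x z) \<in> topspace M" "h z (k z (x z)) = x z" if "norm z \<le> 1" for z
    using isotopyD(2,4)[OF I _ x_top[OF that]] that by simp_all
  have "k z0 (x z0) = x z0"
    using kx[OF z0] base by simp
  then have "h z (g z (x z0)) = x z" if "norm z \<le> 1" for z
    using g(3)[of z] kx(2)[OF that] that by simp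
  then show thesis
    using that[OF isotopy_compose[OF I g(1)]] base g(2,4) by simp
qed

proposition isotopy_extension_unit_disc:
  assumes M: "Hausdorff_space M" and "finite I" and z0: "norm z0 \<le> 1"
    and "\<And>i. i \<in> I \<Longrightarrow> continuous_map (top_of_set (cball (0::complex) 1)) M (x i)"
    and "\<And>i. i \<in> I \<Longrightarrow> x i \<in> cball 0 1 \<rightarrow> manifold_interior M"
    and "\<And>i j z. \<lbrakk>i \<in> I; j \<in> I; i \<noteq> j; norm z \<le> 1\<rbrakk> \<Longrightarrow> x i z \<noteq> x j z"
  shows "\<exists>h k. isotopy (top_of_set (cball 0 1)) M h k \<and> (\<forall>m\<in>topspace M. h z0 m = m) \<and>
    (\<forall>i\<in>I. \<forall>z\<in>cball 0 1. h z (x i z0) = x i z)"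
  using assms(2,4-)
proof (induction I rule: finite_induct)
  case empty
  have "isotopy (top_of_set (cball (0::complex) 1)) M (\<lambda>_ m. m) (\<lambda>_ m. m)"
    by (simp add: isotopy_def case_prod_unfold continuous_map_snd)
  then show ?case by fastforce
next
  case (insert j I)
  let ?D = "cball (0::complex) 1"
  have "\<exists>h k. isotopy (top_of_set ?D) M h k \<and> (\<forall>m\<in>topspace M. h z0 m = m) \<and>
      (\<forall>i\<in>I. \<forall>z\<in>?D. h z (x i z0) = x i z)"
    by (rule insert.IH) (use insert.prems in auto)
  then obtain h k where hk: "isotopy (top_of_set ?D) M h k" "\<forall>m\<in>topspace M. h z0 m = m"
    "\<forall>i\<in>I. \<forall>z\<in>?D. h z (x i z0) = x i z"
    by blast
  define Z where "Z = (\<lambda>i. x i z0) ` I"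
  have "x i z0 \<in> topspace M" if "i \<in> I" for i
    using continuous_map_image_subset_topspace[OF insert.prems(1)[of i]] that z0 by auto
  then have "closedin M Z"
    unfolding Z_def using insert.hyps(1) by (intro closedin_Hausdorff_finite[OF M]) auto
  moreover have "x j z \<noteq> h z q" if "norm z \<le> 1" "q \<in> Z" for z q
  proof -
    obtain i where "i \<in> I" "q = x i z0"
      using \<open>q \<in> Z\<close> by (auto simp: Z_def)
    then show ?thesis
      using hk(3) insert.prems(3)[of j i z] insert.hyps(2) that(1) by auto
  qed
  ultimately obtain h' k' where "isotopy (top_of_set ?D) M h' k'"
    "\<And>m. m \<in> topspace M \<Longrightarrow> h' z0 m = m" "\<And>z. norm z \<le> 1 \<Longrightarrow> h' z (x j z0) = x j z"
    "\<And>z q. \<lbrakk>norm z \<le> 1; q \<in> Z\<rbrakk> \<Longrightarrow> h' z q = h z q"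
    using isotopy_extension_insert[OF M hk(1) z0 _ insert.prems(1,2)] hk(2) by blast
  then show ?case
    using hk(3) by (intro exI[of _ h'] exI[of _ k']) (auto simp: Z_def)
qed

section \<open>Sections over a disc\<close>

definition polar :: "real \<times> real \<Rightarrow> complex" where
  "polar x = of_real (fst x) * cis (2 * pi * snd x)"

lemma norm_polar: "fst x \<ge> 0 \<Longrightarrow> norm (polar x) = fst x"
  by (simp add: polar_def norm_mult)

lemma continuous_on_polar: "continuous_on A polar"
  unfolding polar_def by (intro continuous_intros)

lemma unit_circle_param:
  assumes "norm z = 1"
  obtains t where "t \<in> {0..1}" "z = cis (2 * pi * t)"
proof -
  obtain s where s: "0 \<le> s" "s < 2 * pi" "Re z = cos s" "Im z = sin s"
    using sincos_total_2pi[of "Re z" "Im z"] assms by (metis cmod_power2 one_power2)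
  have "z = cis (2 * pi * (s / (2 * pi)))"
    using s(3,4) by (simp add: complex_eq_iff)
  moreover have "s / (2 * pi) \<in> {0..1}"
    using s(1,2) by simp
  ultimately show thesis
    using that by blast
qed

lemma polar_surj_unit_disc:
  assumes "norm z \<le> 1"
  obtains x where "x \<in> unit_square" "z = polar x"
proof (cases "z = 0")
  case True
  then show thesis
    using that[of "(0, 0)"] by (simp add: polar_def)
next
  case False
  then have "norm (z / of_real (norm z)) = 1"
    by (simp add: norm_divide)
  then obtain t where "t \<in> {0..1}" "z / of_real (norm z) = cis (2 * pi * t)"
    by (rule unit_circle_param)
  then show thesis
    using False assms that[of "(norm z, t)"] by (simp add: polar_def field_simps)
qed

lemma polar_image_unit_square: "polar ` unit_square = cball 0 1"
proof
  show "polar ` unit_square \<subseteq> cball 0 1"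
    by (auto simp: polar_def norm_mult)
  show "cball 0 1 \<subseteq> polar ` unit_square"
  proof
    fix z :: complex assume "z \<in> cball 0 1"
    then obtain x where "x \<in> unit_square" "z = polar x"
      using polar_surj_unit_disc[of z] by auto
    then show "z \<in> polar ` unit_square" by blast
  qed
qed

lemma cis_2pi_eq_imp:
  assumes "cis (2 * pi * t) = cis (2 * pi * t')" "t \<in> {0..1}" "t' \<in> {0..1}"
  shows "t = t' \<or> {t, t'} = {0, 1}"
proof -
  have "sin (2 * pi * t) = sin (2 * pi * t') \<and> cos (2 * pi * t) = cos (2 * pi * t')"
    using assms(1) by (auto simp: complex_eq_iff)
  then obtain n :: int where "2 * pi * t = 2 * pi * t' + 2 * pi * n"
    using sin_cos_eq_iff by blast
  then have "2 * pi * t = 2 * pi * (t' + n)"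
    by (simp add: algebra_simps)
  then have n: "t = t' + n" by simp
  then have "real_of_int n \<le> 1" "real_of_int n \<ge> -1"
    using assms(2,3) by auto
  then have "n = -1 \<or> n = 0 \<or> n = 1" by linarith
  then show ?thesis
    using n assms(2,3) by auto
qed

lemma quotient_map_polar: "quotient_map (top_of_set unit_square) (top_of_set (cball 0 1)) polar"
proof (rule continuous_imp_quotient_map)
  show "continuous_map (top_of_set unit_square) (top_of_set (cball 0 1)) polar"
    using polar_image_unit_square by (auto simp: continuous_map_in_subtopology continuous_on_polar)
qed (simp_all add: compact_space_subtopology compact_Times Hausdorff_space_subtopology
    polar_image_unit_square)

proposition polar_descend:
  assumes f: "continuous_map (top_of_set unit_square) X f"
    and periodic: "\<And>r. r \<in> {0..1} \<Longrightarrow> f (r, 0) = f (r, 1)"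
    and centre: "\<And>t. t \<in> {0..1} \<Longrightarrow> f (0, t) = f (0, 0)"
  obtains g where "continuous_map (top_of_set (cball 0 1)) X g"
    "\<And>x. x \<in> unit_square \<Longrightarrow> g (polar x) = f x"
proof -
  have fibre: "f x = f y"
    if xy: "x \<in> unit_square" "y \<in> unit_square" and eq: "polar x = polar y" for x y
  proof -
    obtain r t r' t' where x: "x = (r, t)" and y: "y = (r', t')"
      by fastforce
    have r: "r' = r" "r \<in> {0..1}" "t \<in> {0..1}" "t' \<in> {0..1}"
      using arg_cong[OF eq, of norm] xy by (auto simp: x y norm_polar)
    show ?thesis
    proof (cases "r = 0")
      case True
      with r show ?thesis
        using centre by (metis x y)
    next
      case False
      then have "t = t' \<or> {t, t'} = {0, 1}"
        using eq r by (intro cis_2pi_eq_imp) (auto simp: x y polar_def)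
      then show ?thesis
        using periodic[OF r(2)] by (auto simp: x y r(1) doubleton_eq_iff)
    qed
  qed
  show thesis
  proof (rule quotient_map_lift_exists[OF quotient_map_polar f])
    show "f x = f y" if "x \<in> topspace (top_of_set unit_square)"
      "y \<in> topspace (top_of_set unit_square)" "polar x = polar y" for x y
      using fibre[of x y] that by simp
  qed (use that in simp)
qed

lemma continuous_map_isotopy_inverse_section:
  assumes I: "isotopy T M h k" and u: "continuous_map T M u"
    and avoids: "\<And>t p. \<lbrakk>t \<in> topspace T; p \<in> P\<rbrakk> \<Longrightarrow> u t \<noteq> h t p"
  shows "continuous_map T (subtopology M (topspace M - P)) (\<lambda>t. k t (u t))"
proof (rule continuous_map_into_subtopology)
  show "continuous_map T M (\<lambda>t. k t (u t))"
    using continuous_map_isotopy_apply[OF isotopy_inverse[OF I] continuous_map_id u] by simp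
  show "(\<lambda>t. k t (u t)) \<in> topspace T \<rightarrow> topspace M - P"
  proof
    fix t assume t: "t \<in> topspace T"
    then have "u t \<in> topspace M"
      using u by (auto simp: continuous_map_def)
    from isotopyD(2,4)[OF I t this] show "k t (u t) \<in> topspace M - P"
      using avoids[OF t, of "k t (u t)"] by auto
  qed
qed

lemma sections_homotopic_over_circle:
  assumes I: "isotopy (top_of_set (cball (0::complex) 1)) M h k"
    and P: "P \<subseteq> topspace M" "\<And>z p. \<lbrakk>norm z = 1; p \<in> P\<rbrakk> \<Longrightarrow> h z p = p"
    and con: "path_connected_space (subtopology M (topspace M - P))"
    and y: "continuous_map (top_of_set (cball 0 1)) M y"
      "\<And>z p. \<lbrakk>norm z \<le> 1; p \<in> P\<rbrakk> \<Longrightarrow> y z \<noteq> h z p"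
    and y': "continuous_map (top_of_set (cball 0 1)) M y'"
      "\<And>z p. \<lbrakk>norm z \<le> 1; p \<in> P\<rbrakk> \<Longrightarrow> y' z \<noteq> h z p"
  obtains F where
    "continuous_map (top_of_set ({0..1::real} \<times> sphere 0 1)) (subtopology M (topspace M - P)) F"
    "\<And>z. norm z = 1 \<Longrightarrow> F (0, z) = y' z" "\<And>z. norm z = 1 \<Longrightarrow> F (1, z) = y z"
proof -
  let ?D = "cball (0::complex) 1" and ?X = "subtopology M (topspace M - P)"
  let ?A = "{0..1::real} \<times> sphere (0::complex) 1"
  have "continuous_map (top_of_set ?D) ?X (\<lambda>z. k z (y z))"
    "continuous_map (top_of_set ?D) ?X (\<lambda>z. k z (y' z))"
    using y(2) y'(2)
    by (auto intro!: continuous_map_isotopy_inverse_section[OF I] y(1) y'(1))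
  then have "homotopic_with (\<lambda>_. True) (top_of_set ?D) ?X (\<lambda>z. k z (y' z)) (\<lambda>z. k z (y z))"
    using con by (intro homotopic_from_contractible_space) (simp add: convex_imp_contractible)
  then obtain G where G: "continuous_map (top_of_set ({0..1::real} \<times> ?D)) ?X G"
    "\<forall>z. G (0, z) = k z (y' z)" "\<forall>z. G (1, z) = k z (y z)"
    unfolding homotopic_with_def prod_topology_top_of_set by blast
  have circle: "z \<in> topspace (top_of_set ?D)" if "norm z = 1" for z
    using that by simp
  have G': "continuous_map (top_of_set ?A) ?X G"
    by (rule continuous_map_from_subtopology_mono[OF G(1)]) auto
  show thesis
  proof (rule that[of "\<lambda>q. h (snd q) (G q)"], rule continuous_map_into_subtopology)
    have "continuous_map (top_of_set ?A) (top_of_set ?D) snd"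
      by (auto simp: continuous_map_in_subtopology intro!: continuous_intros)
    then show "continuous_map (top_of_set ?A) M (\<lambda>q. h (snd q) (G q))"
      using continuous_map_into_fulltopology[OF G'] by (rule continuous_map_isotopy_apply[OF I])
    show "(\<lambda>q. h (snd q) (G q)) \<in> topspace (top_of_set ?A) \<rightarrow> topspace M - P"
    proof
      fix q assume "q \<in> topspace (top_of_set ?A)"
      then have q: "norm (snd q) = 1" and Gq: "G q \<in> topspace M - P"
        using continuous_map_image_subset_topspace[OF G'] by auto
      have "h (snd q) (G q) \<noteq> h (snd q) r" if "r \<in> P" for r
        using Gq that P(1) isotopy_eq_iff[OF I circle[OF q], of "G q" r] by auto
      then show "h (snd q) (G q) \<in> topspace M - P"
        using isotopyD(3)[OF I circle[OF q]] Gq P(2)[OF q] by (metis DiffD1 DiffI)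
    qed
    fix z :: complex assume z: "norm z = 1"
    have "y z \<in> topspace M" "y' z \<in> topspace M"
      using continuous_map_image_subset_topspace[OF y(1)]
        continuous_map_image_subset_topspace[OF y'(1)] z by auto
    then show "h (snd (0, z)) (G (0, z)) = y' z" "h (snd (1, z)) (G (1, z)) = y z"
      using isotopyD(2)[OF I circle[OF z]] by (simp_all add: G)
  qed
qed

proposition section_null_homotopic:
  assumes I: "isotopy (top_of_set (cball (0::complex) 1)) M h k"
    and P: "P \<subseteq> topspace M" "\<And>z p. \<lbrakk>norm z = 1; p \<in> P\<rbrakk> \<Longrightarrow> h z p = p"
    and con: "path_connected_space (subtopology M (topspace M - P))"
    and y: "continuous_map (top_of_set (cball 0 1)) M y" "\<And>z p. \<lbrakk>norm z \<le> 1; p \<in> P\<rbrakk> \<Longrightarrow> y z \<noteq> h z p"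
    and y': "continuous_map (top_of_set (cball 0 1)) M y'"
      "\<And>z p. \<lbrakk>norm z \<le> 1; p \<in> P\<rbrakk> \<Longrightarrow> y' z \<noteq> h z p"
    and const: "\<And>z. norm z = 1 \<Longrightarrow> y' z = c"
  obtains Y where "continuous_map (top_of_set (cball 0 1)) (subtopology M (topspace M - P)) Y"
    "\<And>z. norm z = 1 \<Longrightarrow> Y z = y z"
proof -
  let ?X = "subtopology M (topspace M - P)"
  obtain F where F: "continuous_map (top_of_set ({0..1::real} \<times> sphere 0 1)) ?X F"
    "\<And>z. norm z = 1 \<Longrightarrow> F (0, z) = y' z" "\<And>z. norm z = 1 \<Longrightarrow> F (1, z) = y z"
    using sections_homotopic_over_circle[OF I P con y y'] by blast
  define f where "f q = F (fst q, cis (2 * pi * snd q))" for q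
  have "continuous_map (top_of_set unit_square) ?X f"
    unfolding f_def by (rule continuous_map_compose_on[OF F(1)]) (auto intro!: continuous_intros)
  moreover have "f (r, 0) = f (r, 1)" for r
    by (simp add: f_def)
  moreover have "f (0, t) = f (0, 0)" for t
    by (simp add: f_def F(2) const)
  ultimately obtain Y where Y: "continuous_map (top_of_set (cball 0 1)) ?X Y"
    "\<And>x. x \<in> unit_square \<Longrightarrow> Y (polar x) = f x"
    by (rule polar_descend) (rule that)
  have "Y z = y z" if z: "norm z = 1" for z
  proof -
    obtain t where "t \<in> {0..1}" "z = cis (2 * pi * t)"
      using z by (rule unit_circle_param)
    then show ?thesis
      using Y(2)[of "(1, t)"] F(3)[OF z] by (simp add: polar_def f_def)
  qed
  with Y(1) show thesis by (rule that)
qed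

section \<open>Null-homotopies of a loop around a point\<close>

lemma exp_eq_imp_increment_eq:
  fixes f g :: "real \<Rightarrow> complex"
  assumes f: "continuous_on {0..1} f" and g: "continuous_on {0..1} g"
    and exp_eq: "\<And>t. t \<in> {0..1} \<Longrightarrow> exp (f t) = exp (g t)"
  shows "f 1 - f 0 = g 1 - g 0"
proof -
  define d where "d t = f t - g t" for t
  have exp_d: "exp (d t) = 1" if "t \<in> {0..1}" for t
    using exp_eq[OF that] by (simp add: d_def exp_diff)
  have "d constant_on {0..1}"
  proof (rule continuous_discrete_range_constant)
    show "continuous_on {0..1} d"
      unfolding d_def using f g by (rule continuous_on_diff)
    fix s :: real assume s: "s \<in> {0..1}"
    have "1 \<le> norm (d t - d s)" if t: "t \<in> {0..1}" "d t \<noteq> d s" for t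
    proof -
      have "exp (d t - d s) = 1"
        using exp_d s t(1) by (simp add: exp_diff)
      then obtain m :: int where m: "Re (d t - d s) = 0" "Im (d t - d s) = of_int (2 * m) * pi"
        using exp_eq_1 by blast
      then have "m \<noteq> 0"
        using t(2) by (auto simp: complex_eq_iff)
      then have "1 \<le> \<bar>real_of_int (2 * m)\<bar>" by linarith
      then have "1 * 1 \<le> \<bar>real_of_int (2 * m)\<bar> * pi"
        using pi_gt3 by (intro mult_mono) auto
      then have "1 \<le> \<bar>Im (d t - d s)\<bar>"
        using m(2) by (simp add: abs_mult)
      then show ?thesis
        using abs_Im_le_cmod order_trans by blast
    qed
    then show "\<exists>\<epsilon>>0. \<forall>t. t \<in> {0..1} \<and> d t \<noteq> d s \<longrightarrow> \<epsilon> \<le> norm (d t - d s)"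
      by (intro exI[of _ 1]) auto
  qed simp
  then have "d 0 = d 1"
    by (auto simp: constant_on_def)
  then show ?thesis
    by (simp add: d_def algebra_simps)
qed

lemma closedin_chart_disc_diff:
  fixes e :: "complex \<Rightarrow> 'a"
  assumes M: "Hausdorff_space M" and e: "open_embedding UNIV M e"
  shows "closedin (subtopology M (topspace M - e ` S)) (e ` (cball c r - S))"
proof -
  have "closedin M (e ` cball c r)"
    using open_embedding_closedin_image[OF e M] by simp
  then have "closedin (subtopology M (topspace M - e ` S)) (e ` cball c r \<inter> (topspace M - e ` S))"
    by (metis closedin_subtopology)
  moreover have "e ` cball c r \<inter> (topspace M - e ` S) = e ` (cball c r - S)"
    using open_embedding_in_topspace[OF e] open_embedding_eq_iff[OF e] by auto
  ultimately show ?thesis by simp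
qed

(* The quotient (z - u) / (z - v) is deformed to the constant 1 away from the disc of radius R,
   and so extends to all of M. *)
lemma chart_separating_function:
  fixes e :: "complex \<Rightarrow> 'a"
  assumes M: "Hausdorff_space M" and e: "open_embedding UNIV M e" and R: "norm u \<le> R" "norm v \<le> R"
  obtains \<Theta> where "continuous_map (subtopology M (topspace M - e ` {u, v})) (top_of_set (- {0})) \<Theta>"
    "\<And>z. \<lbrakk>norm z \<le> R; z \<notin> {u, v}\<rbrakk> \<Longrightarrow> \<Theta> (e z) = (z - u) / (z - v)"
proof -
  let ?C = "- {u, v}"
  define \<sigma> where "\<sigma> z = complex_of_real (max 0 (min 1 (R + 2 - norm z)))" for z :: complex
  define \<theta> where "\<theta> z = (z - \<sigma> z * u) / (z - \<sigma> z * v)" for z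
  have \<sigma>_inside: "\<sigma> z = 1" if "norm z \<le> R" for z
    using that by (simp add: \<sigma>_def)
  have nonzero: "z - \<sigma> z * w \<noteq> 0" if "norm w \<le> R" "z \<noteq> w" for z w
  proof
    assume "z - \<sigma> z * w = 0"
    then have z: "z = \<sigma> z * w" by simp
    have "norm (\<sigma> z) \<le> 1"
      by (simp add: \<sigma>_def)
    then have "norm z \<le> R"
      using arg_cong[OF z, of norm] mult_right_mono[of "norm (\<sigma> z)" 1 "norm w"] that(1)
      by (simp add: norm_mult)
    then show False
      using z \<sigma>_inside that(2) by simp
  qed
  have g: "open_embedding ?C (subtopology M (topspace M - e ` {u, v})) e"
    by (rule open_embedding_delete[OF e]) simp
  have "continuous_map (subtopology M (topspace M - e ` {u, v})) (top_of_set (- {0}))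
      (chart_extension ?C e \<theta> (\<lambda>_. 1))"
  proof (rule continuous_map_chart_extension[OF g closedin_chart_disc_diff[OF M e]])
    have "continuous_on ?C \<theta>"
      unfolding \<theta>_def \<sigma>_def
      by (intro continuous_intros) (use nonzero R in \<open>auto simp: \<sigma>_def\<close>)
    then show "continuous_map (top_of_set ?C) (top_of_set (- {0})) \<theta>"
      using nonzero R by (auto simp: continuous_map_in_subtopology \<theta>_def)
    show "\<theta> z = 1" if "z \<in> ?C" "z \<notin> cball 0 (R + 2) - {u, v}" for z
    proof -
      have "norm z > R + 2"
        using that by auto
      moreover from this have "norm z > 0"
        using R(1) norm_ge_zero[of u] by linarith
      ultimately show ?thesis
        by (simp add: \<theta>_def \<sigma>_def)
    qed
  qed auto
  moreover have "chart_extension ?C e \<theta> (\<lambda>_. 1) (e z) = (z - u) / (z - v)"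
    if "norm z \<le> R" "z \<notin> {u, v}" for z
    using that by (simp add: chart_extension_chart[OF g] \<theta>_def \<sigma>_inside)
  ultimately show thesis by (rule that)
qed

proposition null_homotopic_log_increments_eq:
  fixes e :: "complex \<Rightarrow> 'a"
  assumes M: "Hausdorff_space M" and e: "open_embedding UNIV M e"
    and Y: "continuous_map (top_of_set (cball 0 1)) (subtopology M (topspace M - e ` {u, v})) Y"
    and Y_circle: "\<And>t. t \<in> {0..1} \<Longrightarrow> Y (cis (2 * pi * t)) = e (\<alpha> t)"
    and R: "\<And>t. t \<in> {0..1} \<Longrightarrow> norm (\<alpha> t) \<le> R" "norm u \<le> R" "norm v \<le> R"
    and log_u: "continuous_on {0..1} f" "\<And>t. t \<in> {0..1} \<Longrightarrow> exp (f t) = \<alpha> t - u"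
    and log_v: "continuous_on {0..1} g" "\<And>t. t \<in> {0..1} \<Longrightarrow> exp (g t) = \<alpha> t - v"
  shows "f 1 - f 0 = g 1 - g 0"
proof -
  let ?D = "cball (0::complex) 1"
  obtain \<Theta> where \<Theta>: "continuous_map (subtopology M (topspace M - e ` {u, v}))
      (top_of_set (- {0})) \<Theta>"
    "\<And>z. \<lbrakk>norm z \<le> R; z \<notin> {u, v}\<rbrakk> \<Longrightarrow> \<Theta> (e z) = (z - u) / (z - v)"
    using chart_separating_function[OF M e R(2,3)] by blast
  have "continuous_on ?D (\<Theta> \<circ> Y)" "\<And>z. z \<in> ?D \<Longrightarrow> (\<Theta> \<circ> Y) z \<noteq> 0"
    using continuous_map_compose[OF Y \<Theta>(1)] by (auto simp: continuous_map_in_subtopology)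
  then obtain l where l: "continuous_on ?D l" "\<And>z. z \<in> ?D \<Longrightarrow> (\<Theta> \<circ> Y) z = exp (l z)"
    using continuous_logarithm_on_cball by metis
  have "exp (l (cis (2 * pi * t))) = exp (f t - g t)" if t: "t \<in> {0..1}" for t
  proof -
    have "\<alpha> t - u \<noteq> 0" "\<alpha> t - v \<noteq> 0"
      using log_u(2)[OF t] log_v(2)[OF t] by (metis exp_not_eq_zero)+
    then have "\<Theta> (Y (cis (2 * pi * t))) = (\<alpha> t - u) / (\<alpha> t - v)"
      using \<Theta>(2)[OF R(1)[OF t]] Y_circle[OF t] by simp
    then show ?thesis
      using l(2)[of "cis (2 * pi * t)"] log_u(2)[OF t] log_v(2)[OF t] by (simp add: exp_diff)
  qed
  moreover have "continuous_on {0..1} (\<lambda>t. l (cis (2 * pi * t)))"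
    by (intro continuous_on_compose2[OF l(1)] continuous_intros) auto
  ultimately have "l (cis (2 * pi * 1)) - l (cis (2 * pi * 0)) = (f 1 - g 1) - (f 0 - g 0)"
    using log_u(1) log_v(1) by (intro exp_eq_imp_increment_eq continuous_intros)
  then have "f 1 - g 1 = f 0 - g 0" by simp
  then show ?thesis
    by (simp add: algebra_simps)
qed

lemma punctured_chart_push_outside:
  fixes e :: "complex \<Rightarrow> 'a"
  assumes M: "Hausdorff_space M" and e: "open_embedding UNIV M e" and L: "L > 0"
  obtains \<eta> where "continuous_map (subtopology M (topspace M - {e u})) M \<eta>"
    "\<And>x. x \<noteq> e u \<Longrightarrow> \<eta> x \<notin> e ` ball u L"
    "\<And>q. \<lbrakk>q \<noteq> 0; norm q \<le> L\<rbrakk> \<Longrightarrow> \<eta> (e (u + q)) = e (u + of_real L * sgn q)"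
proof -
  let ?C = "- {u}"
  define \<phi> where "\<phi> z = u + of_real (max L (norm (z - u))) * sgn (z - u)" for z
  have g: "open_embedding ?C (subtopology M (topspace M - {e u})) e"
    using open_embedding_delete[OF e, of "{u}"] by simp
  have K: "closedin (subtopology M (topspace M - {e u})) (e ` (cball u L - {u}))"
    using closedin_chart_disc_diff[OF M e, of "{u}"] by simp
  have "continuous_map (subtopology M (topspace M - {e u})) M (chart_conj ?C e \<phi>)"
    unfolding chart_conj_def
  proof (rule continuous_map_chart_extension[OF g K])
    have "continuous_on ?C \<phi>"
      unfolding \<phi>_def by (intro continuous_intros) auto
    then show "continuous_map (top_of_set ?C) M (\<lambda>z. e (\<phi> z))"
      by (rule open_embedding_compose_on[OF e]) simp
    show "continuous_map (subtopology (subtopology M (topspace M - {e u}))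
        (topspace (subtopology M (topspace M - {e u})) - e ` (cball u L - {u}))) M (\<lambda>x. x)"
      by (intro continuous_map_from_subtopology) simp
    show "e (\<phi> z) = e z" if "z \<in> ?C" "z \<notin> cball u L - {u}" for z
    proof -
      have "max L (norm (z - u)) = norm (z - u)" "norm (z - u) \<noteq> 0"
        using that by (auto simp: dist_norm norm_minus_commute)
      then show ?thesis
        by (simp add: \<phi>_def sgn_eq)
    qed
  qed auto
  moreover have "chart_conj ?C e \<phi> x \<notin> e ` ball u L" if "x \<noteq> e u" for x
  proof (cases "x \<in> e ` ?C")
    case True
    then obtain z where z: "z \<in> ?C" "x = e z" by blast
    then have "\<phi> z \<notin> ball u L"
      by (simp add: \<phi>_def dist_norm norm_mult norm_sgn)
    then show ?thesis
      using z by (auto simp: chart_conj_chart[OF g] open_embedding_eq_iff[OF e])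
  next
    case False
    with \<open>x \<noteq> e u\<close> show ?thesis
      by (auto simp: chart_conj_outside)
  qed
  moreover have "chart_conj ?C e \<phi> (e (u + q)) = e (u + of_real L * sgn q)"
    if "q \<noteq> 0" "norm q \<le> L" for q
    using that by (simp add: chart_conj_chart[OF g] \<phi>_def max_def)
  ultimately show thesis by (rule that)
qed

lemma null_homotopy_push_outside:
  assumes M: "Hausdorff_space M" and e: "open_embedding UNIV M e"
    and Y: "continuous_map (top_of_set (cball 0 1)) (subtopology M (topspace M - {e u})) Y"
    and Y_circle: "\<And>t. t \<in> {0..1} \<Longrightarrow> Y (cis (2 * pi * t)) =
      e (u + of_real (\<rho> t) * cis (2 * pi * t) * w)"
    and \<rho>: "\<And>t. t \<in> {0..1} \<Longrightarrow> 0 < \<rho> t" "\<And>t. t \<in> {0..1} \<Longrightarrow> \<rho> t * norm w \<le> L"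
    and w: "w \<noteq> 0" and L: "L > 0"
  obtains G where "continuous_map (top_of_set (cball 0 1)) M G"
    "\<And>z. norm z \<le> 1 \<Longrightarrow> G z \<notin> e ` ball u L"
    "\<And>z. norm z = 1 \<Longrightarrow> G z = e (u + of_real L * z)"
proof -
  let ?D = "cball (0::complex) 1"
  obtain \<eta> where \<eta>: "continuous_map (subtopology M (topspace M - {e u})) M \<eta>"
    "\<And>x. x \<noteq> e u \<Longrightarrow> \<eta> x \<notin> e ` ball u L"
    "\<And>q. \<lbrakk>q \<noteq> 0; norm q \<le> L\<rbrakk> \<Longrightarrow> \<eta> (e (u + q)) = e (u + of_real L * sgn q)"
    using punctured_chart_push_outside[OF M e L] by blast
  have v: "norm (sgn w) = 1"
    using w by (simp add: norm_sgn)
  then have "continuous_map (top_of_set ?D) (subtopology M (topspace M - {e u}))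
      (\<lambda>z. Y (z / sgn w))"
    by (intro continuous_map_compose_on[OF Y]) (auto simp: norm_divide intro!: continuous_intros)
  then have "continuous_map (top_of_set ?D) M (\<lambda>z. \<eta> (Y (z / sgn w)))"
    using continuous_map_compose[OF _ \<eta>(1)] by (fastforce simp: o_def)
  moreover have "\<eta> (Y (z / sgn w)) \<notin> e ` ball u L" if "norm z \<le> 1" for z
    using Y v that by (intro \<eta>(2)) (auto simp: continuous_map_def Pi_iff norm_divide)
  moreover have "\<eta> (Y (z / sgn w)) = e (u + of_real L * z)" if z: "norm z = 1" for z
  proof -
    have "norm (z / sgn w) = 1"
      using z v by (simp add: norm_divide)
    then obtain t where t: "t \<in> {0..1}" "z / sgn w = cis (2 * pi * t)"
      by (rule unit_circle_param)
    let ?q = "of_real (\<rho> t) * cis (2 * pi * t) * w"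
    have "sgn ?q = cis (2 * pi * t) * sgn w"
      using \<rho>(1)[OF t(1)] by (simp add: sgn_mult sgn_of_real)
    also have "\<dots> = z"
      using t(2) w by (simp add: field_simps sgn_zero_iff)
    finally have "sgn ?q = z" .
    moreover have "?q \<noteq> 0" "norm ?q \<le> L"
      using w \<rho>[OF t(1)] by (auto simp: norm_mult)
    ultimately show ?thesis
      using Y_circle[OF t(1)] \<eta>(3)[of ?q] t(2) by simp
  qed
  ultimately show thesis by (rule that)
qed

section \<open>Rotations of the sphere\<close>

(* The cap G extends the chart to a map from the Riemann sphere, written in homogeneous
   coordinates. *)
locale capped_chart =
  fixes M :: "'a topology" and e :: "complex \<Rightarrow> 'a" and u :: complex
    and L :: real and G :: "complex \<Rightarrow> 'a"
  assumes e: "open_embedding UNIV M e" and L: "L > 0"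
    and G: "continuous_map (top_of_set (cball 0 1)) M G"
    and G_outside: "\<And>z. norm z \<le> 1 \<Longrightarrow> G z \<notin> e ` ball u L"
    and G_circle: "\<And>z. norm z = 1 \<Longrightarrow> G z = e (u + of_real L * z)"
begin

definition cap_coordinate :: "complex \<times> complex \<Rightarrow> complex" where
  "cap_coordinate x = of_real L * cnj (snd x / (fst x - u * snd x))"

definition sphere_map :: "complex \<times> complex \<Rightarrow> 'a" where
  "sphere_map x = (if norm (fst x - u * snd x) \<le> L * norm (snd x) then e (fst x / snd x)
     else G (cap_coordinate x))"

lemma norm_cap_coordinate_le:
  assumes "L * norm (snd x) \<le> norm (fst x - u * snd x)" "fst x - u * snd x \<noteq> 0"
  shows "norm (cap_coordinate x) \<le> 1"
proof -
  have "norm (cap_coordinate x) = L * norm (snd x) / norm (fst x - u * snd x)"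
    unfolding cap_coordinate_def norm_mult complex_mod_cnj norm_divide using L by simp
  then show ?thesis
    using assms by (simp add: divide_le_eq)
qed

lemma cap_coordinate_circle:
  assumes "norm (fst x - u * snd x) = L * norm (snd x)" "snd x \<noteq> 0"
  shows "G (cap_coordinate x) = e (fst x / snd x)"
proof -
  define q where "q = fst x / snd x - u"
  have q: "fst x - u * snd x = q * snd x"
    using assms(2) by (simp add: q_def field_simps)
  then have norm_q: "norm q = L"
    using assms by (simp add: norm_mult)
  then have "q \<noteq> 0"
    using L by auto
  have "of_real L * of_real L = q * cnj q"
    using complex_norm_square[of q] norm_q by (simp add: power2_eq_square)
  then have "cap_coordinate x = q / of_real L"
    using \<open>q \<noteq> 0\<close> assms(2) L by (simp add: cap_coordinate_def q field_simps)
  moreover have "norm (q / of_real L) = 1"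
    using norm_q L by (simp add: norm_divide)
  ultimately show ?thesis
    using G_circle L by (simp add: q_def)
qed

lemma continuous_map_sphere_map: "continuous_map (top_of_set (- {(0, 0)})) M sphere_map"
  unfolding sphere_map_def
proof (rule continuous_map_top_of_set_cases_le)
  let ?A = "- {(0::complex, 0::complex)}"
  have snd_nonzero: "snd x \<noteq> 0" if "x \<in> ?A" "norm (fst x - u * snd x) \<le> L * norm (snd x)" for x
    using that by (cases x) auto
  have diff_nonzero: "fst x - u * snd x \<noteq> 0"
    if x: "x \<in> ?A" "L * norm (snd x) \<le> norm (fst x - u * snd x)" for x
  proof
    assume "fst x - u * snd x = 0"
    moreover from this have "snd x = 0"
      using x(2) L by (simp add: mult_le_0_iff)
    ultimately show False
      using x(1) by (cases x) auto
  qed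
  show "continuous_map (top_of_set {x \<in> ?A. norm (fst x - u * snd x) \<le> L * norm (snd x)}) M
      (\<lambda>x. e (fst x / snd x))"
    by (rule open_embedding_compose_on[OF e])
      (use snd_nonzero in \<open>auto intro!: continuous_intros\<close>)
  show "continuous_map (top_of_set {x \<in> ?A. L * norm (snd x) \<le> norm (fst x - u * snd x)}) M
      (\<lambda>x. G (cap_coordinate x))"
  proof (rule continuous_map_compose_on[OF G])
    show "continuous_on {x \<in> ?A. L * norm (snd x) \<le> norm (fst x - u * snd x)} cap_coordinate"
      unfolding cap_coordinate_def by (intro continuous_intros) (use diff_nonzero in auto)
  qed (use norm_cap_coordinate_le diff_nonzero in auto)
  show "e (fst x / snd x) = G (cap_coordinate x)"
    if "x \<in> ?A" "norm (fst x - u * snd x) = L * norm (snd x)" for x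
    using cap_coordinate_circle[OF that(2)] snd_nonzero[OF that(1)] that(2) by simp
qed (intro continuous_intros)+

lemma sphere_map_neq:
  assumes det: "fst x * snd y - fst y * snd x \<noteq> 0"
    and close: "norm (fst x - u * snd x) < L * norm (snd x)"
  shows "sphere_map x \<noteq> sphere_map y"
proof (cases "norm (fst y - u * snd y) \<le> L * norm (snd y)")
  case True
  then have "snd x \<noteq> 0" "snd y \<noteq> 0"
    using close det by auto
  then have "fst x / snd x \<noteq> fst y / snd y"
    using det by (simp add: frac_eq_eq)
  then show ?thesis
    using close True by (simp add: sphere_map_def open_embedding_eq_iff[OF e])
next
  case False
  have "snd x \<noteq> 0"
    using close by auto
  then have "fst x - u * snd x = (fst x / snd x - u) * snd x"
    by (simp add: field_simps)
  then have "fst x / snd x \<in> ball u L"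
    using close \<open>snd x \<noteq> 0\<close> by (simp add: norm_mult dist_norm norm_minus_commute)
  then have "sphere_map x \<in> e ` ball u L"
    using close by (simp add: sphere_map_def)
  moreover have "fst y - u * snd y \<noteq> 0"
    using False L by (auto simp: zero_le_mult_iff)
  then have "norm (cap_coordinate y) \<le> 1"
    using False by (intro norm_cap_coordinate_le) auto
  then have "sphere_map y \<notin> e ` ball u L"
    using G_outside False by (simp add: sphere_map_def)
  ultimately show ?thesis by metis
qed

end

definition SU2_image :: "complex \<Rightarrow> complex \<Rightarrow> complex \<Rightarrow> complex \<times> complex" where
  "SU2_image a b z = (a * z + b, - cnj b * z + cnj a)"

lemma SU2_identity:
  "(norm a)\<^sup>2 + (norm b)\<^sup>2 = 1 \<Longrightarrow> a * cnj a + b * cnj b = 1"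
  by (metis complex_norm_square of_real_1 of_real_add)

lemma SU2_image_det:
  assumes "(norm a)\<^sup>2 + (norm b)\<^sup>2 = 1"
  shows "fst (SU2_image a b z) * snd (SU2_image a b w) -
    fst (SU2_image a b w) * snd (SU2_image a b z) = z - w"
proof -
  have "fst (SU2_image a b z) * snd (SU2_image a b w) -
      fst (SU2_image a b w) * snd (SU2_image a b z) = (a * cnj a + b * cnj b) * (z - w)"
    by (simp add: SU2_image_def algebra_simps)
  then show ?thesis
    by (simp add: SU2_identity[OF assms])
qed

lemma SU2_image_norm:
  assumes "(norm a)\<^sup>2 + (norm b)\<^sup>2 = 1"
  shows "(norm (fst (SU2_image a b z)))\<^sup>2 + (norm (snd (SU2_image a b z)))\<^sup>2 = 1 + (norm z)\<^sup>2"
proof -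
  let ?P = "fst (SU2_image a b z)" and ?Q = "snd (SU2_image a b z)"
  have "?P * cnj ?P + ?Q * cnj ?Q = (a * cnj a + b * cnj b) * (1 + z * cnj z)"
    by (simp add: SU2_image_def algebra_simps)
  then have "complex_of_real ((norm ?P)\<^sup>2 + (norm ?Q)\<^sup>2) = of_real (1 + (norm z)\<^sup>2)"
    by (simp only: SU2_identity[OF assms] of_real_add complex_norm_square of_real_1 mult_1)
  then show ?thesis
    by (simp only: of_real_eq_iff)
qed

lemma SU2_image_nonzero:
  assumes "(norm a)\<^sup>2 + (norm b)\<^sup>2 = 1"
  shows "SU2_image a b z \<noteq> (0, 0)"
proof
  assume "SU2_image a b z = (0, 0)"
  then have "1 + (norm z)\<^sup>2 = 0"
    using SU2_image_norm[OF assms, of z] by simp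
  then show False
    by (smt (verit) zero_le_power2)
qed

lemma norm_SU2_image_le:
  assumes ab: "(norm a)\<^sup>2 + (norm b)\<^sup>2 = 1" and B: "norm z \<le> B"
  shows "norm (fst (SU2_image a b z)) \<le> 1 + B" "norm (snd (SU2_image a b z)) \<le> 1 + B"
proof -
  have "B \<ge> 0"
    using B norm_ge_zero order_trans by blast
  have "(norm z)\<^sup>2 \<le> B\<^sup>2"
    using B by (simp add: power_mono)
  moreover have "(1 + B)\<^sup>2 = 1 + B\<^sup>2 + 2 * B"
    by (simp add: power2_sum)
  ultimately have "1 + (norm z)\<^sup>2 \<le> (1 + B)\<^sup>2"
    using \<open>B \<ge> 0\<close> by linarith
  then have "(norm (fst (SU2_image a b z)))\<^sup>2 \<le> (1 + B)\<^sup>2"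
      "(norm (snd (SU2_image a b z)))\<^sup>2 \<le> (1 + B)\<^sup>2"
    using SU2_image_norm[OF ab, of z] by (smt (verit) zero_le_power2)+
  then show "norm (fst (SU2_image a b z)) \<le> 1 + B" "norm (snd (SU2_image a b z)) \<le> 1 + B"
    using \<open>B \<ge> 0\<close> by (auto intro: power2_le_imp_le)
qed

lemma SU2_image_close:
  assumes ab: "(norm a)\<^sup>2 + (norm b)\<^sup>2 = 1" and B: "norm z \<le> B" "norm w \<le> B"
    and L: "2 * (1 + B)\<^sup>2 * (1 + norm u) < norm (z - w) * L" "L > 0"
    and far: "L * norm (snd (SU2_image a b w)) \<le>
      norm (fst (SU2_image a b w) - u * snd (SU2_image a b w))"
  shows "norm (fst (SU2_image a b z) - u * snd (SU2_image a b z)) <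
    L * norm (snd (SU2_image a b z))"
proof (rule ccontr)
  let ?P = "\<lambda>z. fst (SU2_image a b z)" and ?Q = "\<lambda>z. snd (SU2_image a b z)"
  assume "\<not> ?thesis"
  then have far': "L * norm (?Q z) \<le> norm (?P z - u * ?Q z)" by simp
  have B0: "0 \<le> 1 + B"
    using B(1) norm_ge_zero[of z] by linarith
  have Q_small: "L * norm (?Q x) \<le> (1 + B) * (1 + norm u)"
    if "norm x \<le> B" "L * norm (?Q x) \<le> norm (?P x - u * ?Q x)" for x
  proof -
    have "norm (?P x - u * ?Q x) \<le> norm (?P x) + norm u * norm (?Q x)"
      by (metis norm_mult norm_triangle_ineq4)
    also have "\<dots> \<le> (1 + B) + norm u * (1 + B)"
      using norm_SU2_image_le[OF ab that(1)] by (intro add_mono mult_left_mono) auto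
    finally show ?thesis
      using that(2) by (simp add: algebra_simps)
  qed
  have "norm (z - w) * L = norm (?P z * ?Q w - ?P w * ?Q z) * L"
    by (simp only: SU2_image_det[OF ab])
  also have "\<dots> \<le> (norm (?P z) * norm (?Q w) + norm (?P w) * norm (?Q z)) * L"
    using L(2) by (intro mult_right_mono) (metis norm_mult norm_triangle_ineq4, simp)
  also have "\<dots> = norm (?P z) * (L * norm (?Q w)) + norm (?P w) * (L * norm (?Q z))"
    by (simp add: algebra_simps)
  also have "\<dots> \<le> (1 + B) * ((1 + B) * (1 + norm u)) + (1 + B) * ((1 + B) * (1 + norm u))"
    by (intro add_mono mult_mono norm_SU2_image_le(1)[OF ab] Q_small B far far')
      (use B0 L(2) in auto)
  also have "\<dots> = 2 * (1 + B)\<^sup>2 * (1 + norm u)"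
    by (simp add: power2_eq_square algebra_simps)
  finally show False
    using L(1) by simp
qed

lemma SU2_double_rotation_contractible:
  obtains a b :: "real \<times> real \<Rightarrow> complex" where
    "continuous_on UNIV a" "continuous_on UNIV b" "\<And>x. (norm (a x))\<^sup>2 + (norm (b x))\<^sup>2 = 1"
    "\<And>t. a (0, t) = cis (2 * pi * t) \<and> b (0, t) = 0" "\<And>t. a (1, t) = 1 \<and> b (1, t) = 0"
    "\<And>s. a (s, 0) = 1 \<and> b (s, 0) = 0" "\<And>s. a (s, 1) = 1 \<and> b (s, 1) = 0"
proof -
  define a where "a x = Complex (cos (pi * snd x)) (sin (pi * snd x) * cos (pi * fst x)) *
      cis (pi * snd x)"
    for x :: "real \<times> real"
  define b where "b x = of_real (sin (pi * snd x) * sin (pi * fst x)) * cis (- pi * snd x)"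
    for x :: "real \<times> real"
  have "(norm (a x))\<^sup>2 + (norm (b x))\<^sup>2 = 1" for x
  proof -
    let ?c = "cos (pi * snd x)" and ?s = "sin (pi * snd x)"
    let ?c' = "cos (pi * fst x)" and ?s' = "sin (pi * fst x)"
    have "(norm (a x))\<^sup>2 = ?c\<^sup>2 + (?s * ?c')\<^sup>2"
      by (simp only: a_def norm_mult norm_cis mult_1_right cmod_power2 complex.sel)
    moreover have "(norm (b x))\<^sup>2 = (?s * ?s')\<^sup>2"
      by (simp only: b_def norm_mult norm_cis mult_1_right norm_of_real power2_abs)
    moreover have "(?s * ?c')\<^sup>2 + (?s * ?s')\<^sup>2 = ?s\<^sup>2 * (?c'\<^sup>2 + ?s'\<^sup>2)"
      by (simp only: power_mult_distrib distrib_left)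
    ultimately show ?thesis
      by (simp add: add.assoc)
  qed
  moreover have "continuous_on UNIV a" "continuous_on UNIV b"
    unfolding a_def b_def Complex_eq by (intro continuous_intros)+
  moreover have "a (0, t) = cis (2 * pi * t)" for t
  proof -
    have "Complex (cos (pi * t)) (sin (pi * t)) = cis (pi * t)"
      by (simp add: complex_eq_iff)
    then show ?thesis
      by (simp add: a_def cis_mult mult.assoc)
  qed
  moreover have "a (1, t) = 1" for t
  proof -
    have "Complex (cos (pi * t)) (- sin (pi * t)) = cis (- (pi * t))"
      by (simp add: complex_eq_iff)
    then show ?thesis
      by (simp add: a_def cis_mult)
  qed
  moreover have "a (s, 0) = 1" "a (s, 1) = 1" "b (0, s) = 0" "b (1, s) = 0"
    "b (s, 0) = 0" "b (s, 1) = 0" for s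
    by (simp_all add: a_def b_def complex_eq_iff)
  ultimately show thesis
    by (intro that[of a b]) simp_all
qed

context capped_chart
begin

lemma sphere_map_SU2_rotation:
  assumes "norm z + norm u \<le> L"
  shows "sphere_map (SU2_image (cis t) 0 z) = e (cis (2 * t) * z)"
proof -
  have "cis t * z / cnj (cis t) = (cis t * cis t) * z"
    by (simp add: cis_cnj divide_inverse)
  also have "cis t * cis t = cis (2 * t)"
    by (simp add: cis_mult)
  finally have "e (cis t * z / cnj (cis t)) = e (cis (2 * t) * z)"
    by (rule arg_cong)
  moreover have "norm (cis t * z - u * cnj (cis t)) \<le> L"
    using norm_triangle_ineq4[of "cis t * z" "u * cnj (cis t)"] assms by (simp add: norm_mult)
  ultimately show ?thesis
    by (simp add: sphere_map_def SU2_image_def)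
qed

lemma inj_on_sphere_map_SU2_image:
  assumes ab: "(norm a)\<^sup>2 + (norm b)\<^sup>2 = 1" and d: "\<And>i. i \<in> I \<Longrightarrow> norm (d i) \<le> B"
    and separated: "\<And>i j. \<lbrakk>i \<in> I; j \<in> I; i \<noteq> j\<rbrakk> \<Longrightarrow>
      2 * (1 + B)\<^sup>2 * (1 + norm u) < norm (d i - d j) * L"
  shows "inj_on (\<lambda>i. sphere_map (SU2_image a b (d i))) I"
proof (rule inj_onI, rule ccontr)
  let ?m = "\<lambda>i. SU2_image a b (d i)"
  fix i j assume ij: "i \<in> I" "j \<in> I" "i \<noteq> j" and eq: "sphere_map (?m i) = sphere_map (?m j)"
  have "0 \<le> 2 * (1 + B)\<^sup>2 * (1 + norm u)"
    by simp
  also have "\<dots> < norm (d i - d j) * L"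
    by (rule separated[OF ij])
  finally have "d i \<noteq> d j"
    by auto
  then have det: "fst (?m i) * snd (?m j) - fst (?m j) * snd (?m i) \<noteq> 0"
    "fst (?m j) * snd (?m i) - fst (?m i) * snd (?m j) \<noteq> 0"
    by (simp_all only: SU2_image_det[OF ab]) simp_all
  consider "norm (fst (?m i) - u * snd (?m i)) < L * norm (snd (?m i))"
    | "norm (fst (?m j) - u * snd (?m j)) < L * norm (snd (?m j))"
    using SU2_image_close[OF ab d d separated[OF ij] L] ij by fastforce
  then show False
    using sphere_map_neq[OF det(1)] sphere_map_neq[OF det(2)] eq by cases auto
qed

lemma double_rotation_null_homotopic_if_separated:
  assumes d: "\<And>i. i < n \<Longrightarrow> norm (d i) \<le> B" and L_large: "B + norm u \<le> L"
    and separated: "\<And>i j. \<lbrakk>i < n; j < n; i \<noteq> j\<rbrakk> \<Longrightarrow>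
      2 * (1 + B)\<^sup>2 * (1 + norm u) < norm (d i - d j) * L"
  shows "path_homotopic (ordered_config M n)
    (\<lambda>t. \<lambda>i\<in>{..<n}. e (cis (4 * pi * t) * d i)) (\<lambda>_. \<lambda>i\<in>{..<n}. e (d i))"
proof -
  obtain a b :: "real \<times> real \<Rightarrow> complex" where cont: "continuous_on UNIV a" "continuous_on UNIV b"
    and ab: "\<And>x. (norm (a x))\<^sup>2 + (norm (b x))\<^sup>2 = 1"
    and left: "\<And>t. a (0, t) = cis (2 * pi * t) \<and> b (0, t) = 0"
    and right: "\<And>t. a (1, t) = 1 \<and> b (1, t) = 0"
    and ends: "\<And>s. a (s, 0) = 1 \<and> b (s, 0) = 0" "\<And>s. a (s, 1) = 1 \<and> b (s, 1) = 0"
    by (rule SU2_double_rotation_contractible) (rule that)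
  define S where "S x = (\<lambda>i\<in>{..<n}. sphere_map (SU2_image (a x) (b x) (d i)))" for x
  have "continuous_map (top_of_set unit_square) (ordered_config M n) S"
    unfolding continuous_map_ordered_config
  proof (intro conjI allI impI ballI)
    fix i assume "i < n"
    have "continuous_map (top_of_set unit_square) M (\<lambda>x. sphere_map (SU2_image (a x) (b x) (d i)))"
    proof (rule continuous_map_compose_on[OF continuous_map_sphere_map])
      show "continuous_on unit_square (\<lambda>x. SU2_image (a x) (b x) (d i))"
        unfolding SU2_image_def
        by (intro continuous_intros cont[THEN continuous_on_subset]) auto
    qed (use SU2_image_nonzero[OF ab] in auto)
    then show "continuous_map (top_of_set unit_square) M (\<lambda>x. S x i)"
      using \<open>i < n\<close> by (simp add: S_def)
  next
    fix x show "inj_on (S x) {..<n}"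
      using inj_on_sphere_map_SU2_image[OF ab, of "{..<n}" d B x] d separated
      by (simp add: S_def inj_on_restrict_eq)
  qed (simp add: S_def)
  moreover have d_L: "norm (d i) + norm u \<le> L" if "i < n" for i
    using d[OF that] L_large by simp
  have "S (0, t) = (\<lambda>i\<in>{..<n}. e (cis (4 * pi * t) * d i))" for t
    using sphere_map_SU2_rotation[OF d_L, of _ "2 * pi * t"] left[of t]
    by (auto simp: S_def mult.assoc)
  moreover have "sphere_map (SU2_image 1 0 (d i)) = e (d i)" if "i < n" for i
    using sphere_map_SU2_rotation[OF d_L[OF that], of 0] by simp
  moreover have "cis (4 * pi) = 1"
    using cis_multiple_2pi[of 2] by simp
  ultimately show ?thesis
    by (intro path_homotopicI[where S = S]) (auto simp: S_def right ends)
qed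

end

proposition double_rotation_null_homotopic:
  assumes M: "Hausdorff_space M" and e: "open_embedding UNIV M e"
    and Y: "continuous_map (top_of_set (cball 0 1)) (subtopology M (topspace M - {e u})) Y"
    and Y_circle: "\<And>t. t \<in> {0..1} \<Longrightarrow> Y (cis (2 * pi * t)) =
      e (u + of_real (\<rho> t) * cis (2 * pi * t) * w)"
    and \<rho>: "\<And>t. t \<in> {0..1} \<Longrightarrow> 0 < \<rho> t" "\<And>t. t \<in> {0..1} \<Longrightarrow> \<rho> t \<le> 1" and w: "w \<noteq> 0"
    and d: "inj_on d {..<n}"
  shows "path_homotopic (ordered_config M n)
    (\<lambda>t. \<lambda>i\<in>{..<n}. e (cis (4 * pi * t) * d i)) (\<lambda>_. \<lambda>i\<in>{..<n}. e (d i))"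
proof -
  obtain B where B: "\<And>i. i < n \<Longrightarrow> norm (d i) \<le> B"
    using finite_imp_bounded[of "d ` {..<n}"] unfolding bounded_iff by auto
  let ?sep = "\<lambda>p. norm (d (fst p) - d (snd p))" and ?pairs = "{p \<in> {..<n} \<times> {..<n}. fst p \<noteq> snd p}"
  define \<delta> where "\<delta> = Min (insert 1 (?sep ` ?pairs))"
  have \<delta>: "\<delta> > 0"
    unfolding \<delta>_def using d by (subst Min_gr_iff) (auto dest: inj_onD)
  have \<delta>_le: "\<delta> \<le> norm (d i - d j)" if "i < n" "j < n" "i \<noteq> j" for i j
    unfolding \<delta>_def by (rule Min_le) (use that in force)+
  define c where "c = 2 * (1 + B)\<^sup>2 * (1 + norm u)"
  define L where "L = \<bar>B\<bar> + norm u + norm w + (c + 1) / \<delta>"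
  have "c \<ge> 0"
    by (simp add: c_def)
  then have "(c + 1) / \<delta> > 0"
    using \<delta> by simp
  then have L_bounds: "L > 0" "B + norm u \<le> L" "norm w \<le> L" "(c + 1) / \<delta> \<le> L"
    using norm_ge_zero[of u] norm_ge_zero[of w] abs_ge_self[of B] unfolding L_def by linarith+
  have c_less: "c < norm (d i - d j) * L" if "i < n" "j < n" "i \<noteq> j" for i j
  proof -
    have "c < \<delta> * L"
      using L_bounds(4) \<delta> by (simp add: divide_le_eq mult.commute)
    also have "\<dots> \<le> norm (d i - d j) * L"
      using \<delta>_le[OF that] L_bounds(1) by (intro mult_right_mono) auto
    finally show ?thesis .
  qed
  have "\<rho> t * norm w \<le> L" if "t \<in> {0..1}" for t
    using \<rho>[OF that] L_bounds(3) mult_right_mono[of "\<rho> t" 1 "norm w"] by simp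
  then obtain G where "continuous_map (top_of_set (cball 0 1)) M G"
    "\<And>z. norm z \<le> 1 \<Longrightarrow> G z \<notin> e ` ball u L" "\<And>z. norm z = 1 \<Longrightarrow> G z = e (u + of_real L * z)"
    using null_homotopy_push_outside[OF M e Y Y_circle \<rho>(1) _ w L_bounds(1)] by metis
  then interpret capped_chart M e u L G
    using e L_bounds(1) by unfold_locales auto
  show ?thesis
    by (rule double_rotation_null_homotopic_if_separated[OF _ L_bounds(2)])
      (rule B c_less[unfolded c_def]; assumption)+
qed

section \<open>Planar positions rotated by a permutation\<close>

lemma card_orbit_pos:
  assumes "permutation f"
  shows "0 < card (orbit f x)"
  using finite_orbit[OF permutation_self_in_orbit[OF assms]] orbit_nonempty[of f x]
  by (simp add: card_gt_0_iff)

lemma funpow_eq_iff_mod_card_orbit: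
  assumes "permutation f"
  shows "(f ^^ a) x = (f ^^ b) x \<longleftrightarrow> a mod card (orbit f x) = b mod card (orbit f x)"
proof -
  let ?L = "funpow_dist1 f x x"
  have self: "x \<in> orbit f x"
    using assms by (rule permutation_self_in_orbit)
  have inj: "inj_on (\<lambda>m. (f ^^ m) x) {0..<?L}"
    using self by (rule inj_on_funpow_dist1)
  then have "card (orbit f x) = ?L"
    unfolding orbit_conv_funpow_dist1[OF self] by (simp add: card_image)
  moreover have "(f ^^ (m mod ?L)) x = (f ^^ m) x" for m
    by (rule funpow_mod_eq) (rule funpow_dist1_prop[OF self])
  ultimately show ?thesis
    using inj_on_eq_iff[OF inj, of "a mod ?L" "b mod ?L"] by simp
qed

lemma cis_root_of_unity_eq_iff:
  fixes a b r :: nat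
  assumes "0 < r"
  shows "cis (2 * pi * a / r) = cis (2 * pi * b / r) \<longleftrightarrow> a mod r = b mod r"
proof -
  have "cis (2 * pi * m / r) = exp (2 * of_real pi * \<i> * of_nat m / of_nat r)" for m
    by (simp add: cis_conv_exp mult_ac)
  then show ?thesis
    using complex_root_unity_eq[of r a b] assms by (simp add: cong_def)
qed

lemma sin_root_of_unity_ge:
  fixes k r :: nat
  assumes "0 < k" "k < r"
  shows "sin (pi / r) \<le> sin (pi * k / r)"
proof -
  have half: "sin (pi / r) \<le> sin (pi * m / r)" if "0 < m" "2 * m \<le> r" for m :: nat
  proof (rule sin_monotone_2pi_le)
    show "pi / r \<le> pi * m / r"
      using that by (simp add: divide_right_mono)
    have "pi * real (2 * m) \<le> pi * real r"
      using that(2) by (intro mult_left_mono) (simp_all only: of_nat_le_iff pi_ge_zero)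
    then show "pi * m / r \<le> pi / 2"
      using assms by (simp add: divide_le_eq field_simps)
    have "0 \<le> pi / r"
      by simp
    then show "- (pi / 2) \<le> pi / r"
      using pi_gt_zero by linarith
  qed
  show ?thesis
  proof (cases "2 * k \<le> r")
    case True
    then show ?thesis
      using half assms by blast
  next
    case False
    then have "sin (pi / r) \<le> sin (pi * real (r - k) / r)"
      using half[of "r - k"] assms by simp
    also have "pi * real (r - k) / r = pi - pi * k / r"
      using assms by (simp add: of_nat_diff field_simps)
    finally show ?thesis
      by simp
  qed
qed

lemma norm_cis_diff_one: "norm (cis t - 1) = 2 * \<bar>sin (t / 2)\<bar>"
  using dist_exp_i_1[of t] by (simp add: cis_conv_exp)

lemma norm_cis_root_of_unity_diff_one:
  fixes k r :: nat
  assumes "k \<le> r"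
  shows "norm (cis (2 * pi * k / r) - 1) = 2 * sin (pi * k / r)"
proof -
  have "0 \<le> sin (pi * k / r)"
    using assms by (intro sin_ge_zero) (simp_all add: divide_le_eq)
  then show ?thesis
    by (simp add: norm_cis_diff_one)
qed

lemma norm_cis_root_of_unity_diff_one_le:
  fixes r :: nat
  assumes "3 \<le> r"
  shows "norm (cis (2 * pi / r) - 1) \<le> 9/5"
proof -
  have "pi / r \<le> pi / 3" "0 \<le> pi / r"
    using assms divide_left_mono[of 3 r pi] by simp_all
  then have "sin (pi / r) \<le> sin (pi / 3)"
    using pi_gt_zero by (intro sin_monotone_2pi_le) linarith+
  then have "norm (cis (2 * pi / r) - 1) \<le> sqrt 3"
    using norm_cis_root_of_unity_diff_one[of 1 r] assms by (simp add: sin_60)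
  also have "sqrt 3 \<le> 9/5"
    by (rule real_le_lsqrt) (simp_all add: power2_eq_square)
  finally show ?thesis .
qed

definition orbit_root :: "('a \<Rightarrow> 'a) \<Rightarrow> 'a \<Rightarrow> 'a \<Rightarrow> complex" where
  "orbit_root f x y = cis (2 * pi * funpow_dist f x y / card (orbit f x))"

lemma norm_orbit_root [simp]: "norm (orbit_root f x y) = 1"
  by (simp add: orbit_root_def)

context
  fixes f :: "'a \<Rightarrow> 'a"
  assumes f: "permutation f"
begin

lemma orbit_root_funpow: "orbit_root f x ((f ^^ m) x) = cis (2 * pi * m / card (orbit f x))"
proof -
  have "(f ^^ m) x \<in> orbit f x"
    using permutation_self_in_orbit[OF f] by (rule funpow_in_orbit)
  then have "(f ^^ funpow_dist f x ((f ^^ m) x)) x = (f ^^ m) x"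
    by (rule funpow_dist_prop)
  then show ?thesis
    unfolding orbit_root_def funpow_eq_iff_mod_card_orbit[OF f]
      cis_root_of_unity_eq_iff[OF card_orbit_pos[OF f]] .
qed

lemma orbit_root_self [simp]: "orbit_root f x x = 1"
  using orbit_root_funpow[of x 0] by simp

lemma orbitE_funpow:
  assumes "y \<in> orbit f x"
  obtains m where "y = (f ^^ m) x"
  using assms unfolding orbit_altdef_permutation[OF f] by blast

lemma orbit_root_step:
  assumes "y \<in> orbit f x"
  shows "orbit_root f x (f y) = cis (2 * pi / card (orbit f x)) * orbit_root f x y"
proof -
  obtain m where m: "y = (f ^^ m) x"
    using assms by (rule orbitE_funpow)
  then have "f y = (f ^^ Suc m) x"
    by simp
  then show ?thesis
    unfolding m by (simp only: orbit_root_funpow cis_mult)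
      (simp add: add_divide_distrib distrib_left)
qed

lemma inj_on_orbit_root: "inj_on (orbit_root f x) (orbit f x)"
proof (rule inj_onI)
  fix y z assume "y \<in> orbit f x" "z \<in> orbit f x" and eq: "orbit_root f x y = orbit_root f x z"
  then obtain a b where "y = (f ^^ a) x" "z = (f ^^ b) x"
    by (elim orbitE_funpow)
  then show "y = z"
    using eq by (simp only: orbit_root_funpow funpow_eq_iff_mod_card_orbit[OF f]
        cis_root_of_unity_eq_iff[OF card_orbit_pos[OF f]])
qed

lemma norm_orbit_root_diff_one_ge:
  assumes "y \<in> orbit f x" "y \<noteq> x"
  shows "norm (cis (2 * pi / card (orbit f x)) - 1) \<le> norm (orbit_root f x y - 1)"
proof -
  let ?r = "card (orbit f x)"
  obtain m where m: "y = (f ^^ m) x"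
    using assms(1) by (rule orbitE_funpow)
  have r: "0 < ?r"
    using f by (rule card_orbit_pos)
  have "m mod ?r \<noteq> 0"
    using assms(2) funpow_eq_iff_mod_card_orbit[OF f, of m x 0] m by auto
  then have k: "0 < m mod ?r" "m mod ?r < ?r"
    using r by simp_all
  have "norm (cis (2 * pi / ?r) - 1) = 2 * sin (pi / ?r)"
    using norm_cis_root_of_unity_diff_one[of 1 ?r] r by simp
  also have "\<dots> \<le> 2 * sin (pi * (m mod ?r) / ?r)"
    using sin_root_of_unity_ge[OF k] by simp
  also have "\<dots> = norm (cis (2 * pi * (m mod ?r) / ?r) - 1)"
    using norm_cis_root_of_unity_diff_one[of "m mod ?r" ?r] k by simp
  also have "cis (2 * pi * (m mod ?r) / ?r) = orbit_root f x y"
    unfolding m orbit_root_funpow cis_root_of_unity_eq_iff[OF r] by simp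
  finally show ?thesis .
qed

end

lemma card_orbit_eq_1_iff:
  assumes "permutation f"
  shows "card (orbit f x) = 1 \<longleftrightarrow> f x = x"
  using funpow_eq_iff_mod_card_orbit[OF assms, of 1 x 0] card_orbit_pos[OF assms, of x] by auto

lemma card_orbit_dvd_iff:
  assumes "permutation f"
  shows "card (orbit f x) dvd m \<longleftrightarrow> (f ^^ m) x = x"
  using funpow_eq_iff_mod_card_orbit[OF assms, of m x 0] by (simp add: dvd_eq_mod_eq_0)

lemma card_orbit_eq_2:
  assumes "permutation f" "f x \<noteq> x" "f (f x) = x"
  shows "card (orbit f x) = 2"
proof -
  have "card (orbit f x) dvd 2"
    using assms(3) by (simp add: card_orbit_dvd_iff[OF assms(1)] numeral_2_eq_2)
  then have "card (orbit f x) \<le> 2"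
    by (rule dvd_imp_le) simp
  moreover have "card (orbit f x) \<noteq> 1"
    using assms(2) card_orbit_eq_1_iff[OF assms(1), of x] by metis
  ultimately show ?thesis
    using card_orbit_pos[OF assms(1), of x] by linarith
qed

lemma card_orbit_ge_3:
  assumes "permutation f" "f x \<noteq> x" "f (f x) \<noteq> x"
  shows "3 \<le> card (orbit f x)"
proof -
  have "\<not> card (orbit f x) dvd 2"
    using assms(3) by (simp add: card_orbit_dvd_iff[OF assms(1)] numeral_2_eq_2)
  then have "card (orbit f x) \<noteq> 2"
    by auto
  moreover have "card (orbit f x) \<noteq> 1"
    using assms(2) card_orbit_eq_1_iff[OF assms(1), of x] by metis
  ultimately show ?thesis
    using card_orbit_pos[OF assms(1), of x] by linarith
qed

locale moving_pair =
  fixes p :: "nat \<Rightarrow> nat" and l j :: nat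
  assumes permutation: "permutation p" and moves_l: "p l \<noteq> l"
    and pair: "j = p l \<and> p j \<noteq> l \<or> p (p l) = l \<and> p (p j) = j \<and> j \<noteq> l \<and> j \<noteq> p l"
begin

lemma j_neq_l [simp]: "j \<noteq> l" "l \<noteq> j" and p_j_neq_l [simp]: "p j \<noteq> l" "l \<noteq> p j"
  using pair moves_l by auto

lemma p_eq_iff [simp]: "p i = p k \<longleftrightarrow> i = k"
  using permutation_bijective[OF permutation] by (auto simp: bij_def inj_def)

lemma orbit_p [simp]: "orbit p (p i) = orbit p i"
  using permutation by (rule permutation_orbit_step)

lemma in_orbit_self [simp]: "i \<in> orbit p i"
  using permutation by (rule permutation_self_in_orbit)

lemma card_orbit_j:
  assumes "p j \<noteq> j"
  shows "card (orbit p j) = card (orbit p l)"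
  using pair
proof
  assume "p (p l) = l \<and> p (p j) = j \<and> j \<noteq> l \<and> j \<noteq> p l"
  then show ?thesis
    using assms moves_l by (simp add: card_orbit_eq_2[OF permutation])
qed simp

definition orbit_rep :: "nat \<Rightarrow> nat" where
  "orbit_rep i =
     (if l \<in> orbit p i then l else if j \<in> orbit p i then j else (LEAST k. k \<in> orbit p i))"

lemma orbit_rep_in_orbit: "orbit_rep i \<in> orbit p i"
  unfolding orbit_rep_def by (auto intro: LeastI[of _ i])

lemma orbit_orbit_rep [simp]: "orbit p (orbit_rep i) = orbit p i"
  using orbit_cyclic_eq3[OF cyclic_on_orbit'[OF permutation] orbit_rep_in_orbit] .

lemma in_orbit_orbit_rep: "i \<in> orbit p (orbit_rep i)"
  by simp

lemma orbit_rep_p [simp]: "orbit_rep (p i) = orbit_rep i"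
  by (simp add: orbit_rep_def)

lemma orbit_rep_l [simp]: "orbit_rep l = l"
  by (simp add: orbit_rep_def)

(* The orbits of l and j are innermost, so that j is the point nearest to l; if j is fixed, it is
   the centre of rotation. *)
definition radius :: "nat \<Rightarrow> real" where
  "radius m = (if m = l then 1 else if m = j then (if p j = j then 0 else 14/5) else 3 + m)"

definition pos :: "nat \<Rightarrow> complex" where
  "pos i = radius (orbit_rep i) * orbit_root p (orbit_rep i) i"

(* The speed of a point at the centre is immaterial; there it is chosen so that j turns with l. *)
definition speed :: "nat \<Rightarrow> real" where
  "speed i = (if i = j then 1 / card (orbit p l) else 1 / card (orbit p i))"

lemma radius_nonneg: "0 \<le> radius m"
  by (simp add: radius_def)

lemma radius_eq_iff: "radius m = radius m' \<longleftrightarrow> m = m'"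
  by (auto simp: radius_def)

lemma norm_pos: "norm (pos i) = radius (orbit_rep i)"
  using radius_nonneg[of "orbit_rep i"] by (simp add: pos_def norm_mult)

lemma orbit_j_fixed:
  assumes "p j = j"
  shows "orbit p j = {j}"
  using assms by (simp add: orbit_eq_singleton_iff)

lemma orbit_rep_j_cases: "j = p l \<and> orbit_rep j = l \<or> p (p l) = l \<and> orbit_rep j = j"
  using pair
proof
  assume "p (p l) = l \<and> p (p j) = j \<and> j \<noteq> l \<and> j \<noteq> p l"
  moreover have "k \<in> {l, p l}" if "p (p l) = l" "k \<in> orbit p l" for k
    using that(2) by (induction rule: orbit.induct) (use that(1) in auto)
  ultimately have "j \<notin> orbit p l"
    by blast
  then have "l \<notin> orbit p j"
    using orbit_swap[OF in_orbit_self] by blast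
  then show ?thesis
    using \<open>p (p l) = l \<and> _\<close> by (simp add: orbit_rep_def)
next
  assume j: "j = p l \<and> p j \<noteq> l"
  then have "l \<in> orbit p j"
    by auto
  then have "orbit_rep j = l"
    unfolding orbit_rep_def by simp
  then show ?thesis
    using j by blast
qed

lemma orbit_rep_eq_j_fixed:
  assumes "orbit_rep i = j" "p j = j"
  shows "i = j"
  using in_orbit_orbit_rep[of i] assms orbit_j_fixed by simp

lemma inj_pos: "inj pos"
proof (rule injI)
  fix i k assume eq: "pos i = pos k"
  then have same_orbit: "orbit_rep i = orbit_rep k"
    using norm_pos radius_eq_iff by metis
  show "i = k"
  proof (cases "radius (orbit_rep k) = 0")
    case True
    then have "orbit_rep k = j" "p j = j"
      by (auto simp: radius_def split: if_splits)
    then show ?thesis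
      using orbit_rep_eq_j_fixed[of i] orbit_rep_eq_j_fixed[of k] same_orbit by simp
  next
    case False
    then have "orbit_root p (orbit_rep k) i = orbit_root p (orbit_rep k) k"
      using eq by (simp add: pos_def same_orbit)
    moreover have "i \<in> orbit p (orbit_rep k)" "k \<in> orbit p (orbit_rep k)"
      using in_orbit_orbit_rep[of i] in_orbit_orbit_rep[of k] same_orbit by simp_all
    ultimately show ?thesis
      by (rule inj_onD[OF inj_on_orbit_root[OF permutation]])
  qed
qed

lemma pos_p: "pos (p i) = cis (2 * pi * speed i) * pos i"
proof (cases "i = j \<and> p j = j")
  case True
  then have "pos i = 0"
    using orbit_rep_j_cases by (auto simp: pos_def radius_def)
  then show ?thesis
    using True by simp
next
  case False
  then have "speed i = 1 / card (orbit p i)"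
    using card_orbit_j by (auto simp: speed_def)
  then show ?thesis
    using orbit_root_step[OF permutation in_orbit_orbit_rep[of i]] by (simp add: pos_def)
qed

lemma speed_cong_orbit:
  assumes "orbit p i = orbit p k"
  shows "speed i = speed k"
proof (cases "p j = j \<and> (i = j \<or> k = j)")
  case True
  then have "i = k"
    using assms orbit_j_fixed in_orbit_self[of i] in_orbit_self[of k] by auto
  then show ?thesis
    by simp
next
  case False
  then show ?thesis
    using assms card_orbit_j by (auto simp: speed_def)
qed

lemma speed_j: "speed j = speed l"
  by (simp add: speed_def)

lemma speed_eq_or_norm_pos_neq: "speed i = speed k \<or> norm (pos i) \<noteq> norm (pos k)"
  using speed_cong_orbit[of i k] orbit_orbit_rep[of i] orbit_orbit_rep[of k]
  by (metis norm_pos radius_eq_iff)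

lemma speed_eq_or_norm_pos_ge: "speed k = speed j \<or> 3 \<le> norm (pos k)"
proof (cases "orbit_rep k = l \<or> orbit_rep k = j")
  case True
  then have "speed k = speed l \<or> speed k = speed j"
    using speed_cong_orbit orbit_orbit_rep[of k] by metis
  then show ?thesis
    using speed_j by simp
next
  case False
  then show ?thesis
    by (simp add: norm_pos radius_def)
qed

lemma ex_common_period: "\<exists>N>0. \<forall>i. cis (2 * pi * (real N * speed i)) = 1"
proof -
  obtain N where N: "p ^^ N = id" "N > 0"
    using permutation_is_nilpotent[OF permutation] by blast
  have "cis (2 * pi * (real N * speed i)) = 1" for i
  proof -
    obtain k where "speed i = 1 / card (orbit p k)"
      by (cases "i = j") (auto simp: speed_def)
    moreover obtain m where "N = card (orbit p k) * m"
      using card_orbit_dvd_iff[OF permutation, of k N] N(1) by (auto elim: dvdE)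
    ultimately have "real N * speed i = m"
      using card_orbit_pos[OF permutation, of k] by simp
    then show ?thesis
      using cis_multiple_2pi[of "real m"] by simp
  qed
  then show ?thesis
    using N(2) by blast
qed

lemma pos_l [simp]: "pos l = 1"
  by (simp add: pos_def radius_def orbit_root_self[OF permutation])

lemma norm_pos_diff_one_ge:
  assumes "k \<noteq> j" "orbit_rep k \<noteq> l"
  shows "9/5 \<le> norm (pos k - 1)"
proof -
  have "14/5 \<le> radius (orbit_rep k)"
    using assms orbit_rep_eq_j_fixed[of k] by (auto simp: radius_def)
  then show ?thesis
    using norm_triangle_ineq2[of "pos k" 1] by (simp add: norm_pos)
qed

lemma norm_cis_orbit_l_le:
  assumes "k \<noteq> l" "orbit_rep k = l"
  shows "norm (cis (2 * pi / card (orbit p l)) - 1) \<le> norm (pos k - 1)"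
proof -
  have "pos k = orbit_root p l k" "k \<in> orbit p l"
    using assms(2) in_orbit_orbit_rep[of k] by (simp_all add: pos_def radius_def)
  then show ?thesis
    using norm_orbit_root_diff_one_ge[OF permutation _ assms(1)] by simp
qed

lemma pos_j_nearest:
  shows "norm (pos j - 1) \<le> 9/5" and "k \<noteq> l \<Longrightarrow> norm (pos j - 1) \<le> norm (pos k - 1)"
proof -
  have "norm (pos j - 1) \<le> 9/5 \<and> (k \<noteq> l \<longrightarrow> norm (pos j - 1) \<le> norm (pos k - 1))" for k
    using orbit_rep_j_cases
  proof
    assume j: "j = p l \<and> orbit_rep j = l"
    then have "3 \<le> card (orbit p l)"
      using card_orbit_ge_3[OF permutation moves_l] p_j_neq_l(1) by metis
    have "pos j = orbit_root p l j"
      unfolding pos_def conjunct2[OF j] by (simp add: radius_def)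
    then have pos_j: "pos j = cis (2 * pi / card (orbit p l))"
      using j orbit_root_step[OF permutation in_orbit_self[of l]]
      by (simp add: orbit_root_self[OF permutation])
    then have "norm (pos j - 1) \<le> 9/5"
      using norm_cis_root_of_unity_diff_one_le[OF \<open>3 \<le> _\<close>] by simp
    then show ?thesis
      using norm_cis_orbit_l_le[of k] norm_pos_diff_one_ge[of k] by (force simp: pos_j[symmetric])
  next
    assume j: "p (p l) = l \<and> orbit_rep j = j"
    then have "pos j = of_real (radius j)"
      by (simp add: pos_def orbit_root_self[OF permutation])
    then have "pos j - 1 = of_real (radius j - 1)"
      by simp
    then have pos_j: "norm (pos j - 1) = \<bar>radius j - 1\<bar>"
      by (simp only: norm_of_real)
    have "card (orbit p l) = 2"
      using j card_orbit_eq_2[OF permutation moves_l] by blast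
    then show ?thesis
      using norm_cis_orbit_l_le[of k] norm_pos_diff_one_ge[of k] pos_j by (force simp: radius_def)
  qed
  then show "norm (pos j - 1) \<le> 9/5" "k \<noteq> l \<Longrightarrow> norm (pos j - 1) \<le> norm (pos k - 1)"
    by blast+
qed

lemma speed_near: "i \<in> {j, p j, l, p l} \<Longrightarrow> speed i = 1 / card (orbit p l)"
  using speed_cong_orbit[of "p j" j] speed_cong_orbit[of "p l" l] by (auto simp: speed_def)

end

lemma ex_moving_pair:
  assumes p: "p permutes {..<n}" and n: "3 \<le> n" and "p \<noteq> id"
  shows "\<exists>l<n. \<exists>j<n. moving_pair p l j"
proof -
  obtain i where "p i \<noteq> i"
    using \<open>p \<noteq> id\<close> by fastforce
  have perm: "permutation p"
    using p permutation_permutes by blast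
  have less: "k < n" "p k < n" if "p k \<noteq> k" for k
    using that permutes_not_in[OF p, of k] permutes_in_image[OF p, of k] by auto
  show ?thesis
  proof (cases "\<forall>k. p (p k) = k")
    case True
    have "card ({..<n} - {i, p i}) \<noteq> 0"
      using n card_Diff_subset[of "{i, p i}" "{..<n}"] less[OF \<open>p i \<noteq> i\<close>]
        card_insert_le_m1[of 2 "{p i}" i]
      by simp
    then obtain j where "j < n" "j \<noteq> i" "j \<noteq> p i"
      by (metis Diff_iff card_gt_0_iff ex_in_conv insertCI lessThan_iff neq0_conv)
    then show ?thesis
      using True \<open>p i \<noteq> i\<close> less[OF \<open>p i \<noteq> i\<close>] perm by (auto simp: moving_pair_def)
  next
    case False
    then obtain l where l: "p (p l) \<noteq> l"
      by blast
    then have "p l \<noteq> l"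
      by metis
    then show ?thesis
      using l less[of l] perm by (auto simp: moving_pair_def)
  qed
qed

section \<open>Roots in bi-orderable groups\<close>

lemma (in group) pow_conjugate:
  assumes "x \<in> carrier G" "y \<in> carrier G"
  shows "(y \<otimes> x \<otimes> inv y) [^] (k :: nat) = y \<otimes> x [^] k \<otimes> inv y"
proof (induction k)
  case 0
  then show ?case
    using assms by simp
next
  case (Suc k)
  have "(y \<otimes> x \<otimes> inv y) [^] Suc k = (y \<otimes> x [^] k \<otimes> inv y) \<otimes> (y \<otimes> x \<otimes> inv y)"
    by (simp add: Suc)
  also have "\<dots> = y \<otimes> (x [^] k \<otimes> (inv y \<otimes> (y \<otimes> (x \<otimes> inv y))))"
    using assms by (simp add: m_assoc)
  also have "inv y \<otimes> (y \<otimes> (x \<otimes> inv y)) = x \<otimes> inv y"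
    using assms by (simp add: m_assoc[symmetric])
  also have "y \<otimes> (x [^] k \<otimes> (x \<otimes> inv y)) = y \<otimes> x [^] Suc k \<otimes> inv y"
    using assms by (simp add: m_assoc)
  finally show ?case .
qed

lemma biorderable_pow_inject:
  fixes G (structure) and k :: nat
  assumes "group G" "biorderable G"
    and x: "x \<in> carrier G" and y: "y \<in> carrier G" and eq: "x [^] k = y [^] k" and "0 < k"
  shows "x = y"
proof (rule ccontr)
  interpret group G
    by fact
  obtain r where irrefl: "\<forall>x\<in>carrier G. \<not> r x x"
    and trans: "\<forall>x\<in>carrier G. \<forall>y\<in>carrier G. \<forall>z\<in>carrier G. r x y \<longrightarrow> r y z \<longrightarrow> r x z"
    and total: "\<forall>x\<in>carrier G. \<forall>y\<in>carrier G. x \<noteq> y \<longrightarrow> r x y \<or> r y x"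
    and mult: "\<forall>x\<in>carrier G. \<forall>y\<in>carrier G. \<forall>g\<in>carrier G. r x y \<longrightarrow>
      r (g \<otimes> x) (g \<otimes> y) \<and> r (x \<otimes> g) (y \<otimes> g)"
    using \<open>biorderable G\<close> unfolding biorderable_def by (elim exE conjE) (rule that)
  have pow_mono: "r (u [^] Suc m) (w [^] Suc m)"
    if u: "u \<in> carrier G" and w: "w \<in> carrier G" and "r u w" for u w m
  proof (induction m)
    case 0
    then show ?case
      using that by simp
  next
    case (Suc m)
    have "r (u [^] Suc m \<otimes> u) (w [^] Suc m \<otimes> u)"
      using mult[rule_format, OF _ _ u Suc] u w by simp
    moreover have "r (w [^] Suc m \<otimes> u) (w [^] Suc m \<otimes> w)"
      using mult[rule_format, OF u w _ \<open>r u w\<close>, of "w [^] Suc m"] w by simp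
    ultimately show ?case
      using trans[rule_format, of "u [^] Suc m \<otimes> u" "w [^] Suc m \<otimes> u" "w [^] Suc m \<otimes> w"] u w
      by (simp only: nat_pow_Suc[of _ "Suc m"] nat_pow_closed m_closed)
  qed
  obtain m where k: "k = Suc m"
    using \<open>0 < k\<close> gr0_conv_Suc by blast
  assume "x \<noteq> y"
  then have "r (x [^] k) (y [^] k) \<or> r (y [^] k) (x [^] k)"
    using total[rule_format, OF x y] pow_mono[OF x y] pow_mono[OF y x] unfolding k by blast
  then show False
    using irrefl y eq by simp
qed

lemma biorderable_root_commutes:
  fixes G (structure) and k :: nat
  assumes G: "group G" "biorderable G" and x: "x \<in> carrier G" and y: "y \<in> carrier G"
    and comm: "x [^] k \<otimes> y = y \<otimes> x [^] k" and "0 < k"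
  shows "x \<otimes> y = y \<otimes> x"
proof -
  interpret group G
    by (rule G(1))
  have "(y \<otimes> x \<otimes> inv y) [^] k = y \<otimes> x [^] k \<otimes> inv y"
    using x y by (rule pow_conjugate)
  also have "\<dots> = x [^] k"
    using x y comm by (simp add: inv_solve_right')
  finally have "y \<otimes> x \<otimes> inv y = x"
    using x y \<open>0 < k\<close> by (simp add: biorderable_pow_inject[OF G])
  then show ?thesis
    using x y by (simp add: inv_solve_right')
qed

definition nonorderable_pair :: "('a, 'b) monoid_scheme \<Rightarrow> 'a \<Rightarrow> 'a \<Rightarrow> bool" where
  "nonorderable_pair G x y \<longleftrightarrow>
     (\<exists>k>0. x [^]\<^bsub>G\<^esub> (k :: nat) \<otimes>\<^bsub>G\<^esub> y = y \<otimes>\<^bsub>G\<^esub> x [^]\<^bsub>G\<^esub> k) \<and>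
     (x \<otimes>\<^bsub>G\<^esub> y = y \<otimes>\<^bsub>G\<^esub> x \<longrightarrow> (\<exists>m>0. x [^]\<^bsub>G\<^esub> (m :: nat) = \<one>\<^bsub>G\<^esub>))"

proposition biorderable_nonorderable_pair:
  assumes G: "group G" "biorderable G" and xy: "x \<in> carrier G" "y \<in> carrier G"
    and pair: "nonorderable_pair G x y"
  shows "x = \<one>\<^bsub>G\<^esub>"
proof -
  interpret group G
    by (rule G(1))
  have "x \<otimes>\<^bsub>G\<^esub> y = y \<otimes>\<^bsub>G\<^esub> x"
    using pair biorderable_root_commutes[OF G xy] unfolding nonorderable_pair_def by blast
  then obtain m :: nat where "m > 0" "x [^]\<^bsub>G\<^esub> m = \<one>\<^bsub>G\<^esub>"
    using pair unfolding nonorderable_pair_def by blast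
  then show ?thesis
    using biorderable_pow_inject[OF G xy(1) one_closed, of m] by simp
qed

lemma nonorderable_pair_hom:
  assumes "group G" "group H" "h \<in> hom G H" and inj: "inj_on h (carrier G)"
    and xy: "x \<in> carrier G" "y \<in> carrier G" and pair: "nonorderable_pair G x y"
  shows "nonorderable_pair H (h x) (h y)"
proof -
  interpret h: group_hom G H h
    using assms(1-3) by (simp add: group_hom_def group_hom_axioms_def)
  have comm: "h u \<otimes>\<^bsub>H\<^esub> h w = h w \<otimes>\<^bsub>H\<^esub> h u \<longleftrightarrow> u \<otimes>\<^bsub>G\<^esub> w = w \<otimes>\<^bsub>G\<^esub> u"
    if "u \<in> carrier G" "w \<in> carrier G" for u w
    using that inj_on_eq_iff[OF inj, of "u \<otimes>\<^bsub>G\<^esub> w" "w \<otimes>\<^bsub>G\<^esub> u"] by simp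
  have pow: "h x [^]\<^bsub>H\<^esub> k = h (x [^]\<^bsub>G\<^esub> k)" for k :: nat
    using xy(1) by (simp add: h.hom_nat_pow)
  obtain k :: nat where k: "k > 0" "x [^]\<^bsub>G\<^esub> k \<otimes>\<^bsub>G\<^esub> y = y \<otimes>\<^bsub>G\<^esub> x [^]\<^bsub>G\<^esub> k"
    and torsion: "x \<otimes>\<^bsub>G\<^esub> y = y \<otimes>\<^bsub>G\<^esub> x \<longrightarrow> (\<exists>m>0. x [^]\<^bsub>G\<^esub> (m :: nat) = \<one>\<^bsub>G\<^esub>)"
    using pair unfolding nonorderable_pair_def by blast
  have "h (x [^]\<^bsub>G\<^esub> k) \<otimes>\<^bsub>H\<^esub> h y = h y \<otimes>\<^bsub>H\<^esub> h (x [^]\<^bsub>G\<^esub> k)"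
    using k(2) comm[OF h.G.nat_pow_closed[OF xy(1)] xy(2)] by blast
  moreover have "\<exists>m>0. h (x [^]\<^bsub>G\<^esub> (m :: nat)) = \<one>\<^bsub>H\<^esub>"
    if "h x \<otimes>\<^bsub>H\<^esub> h y = h y \<otimes>\<^bsub>H\<^esub> h x"
    using that torsion h.hom_one unfolding comm[OF xy] by metis
  ultimately show ?thesis
    unfolding nonorderable_pair_def pow using k(1) by blast
qed

lemma nonorderable_pair_subgroup:
  "nonorderable_pair (G\<lparr>carrier := H\<rparr>) x y \<longleftrightarrow> nonorderable_pair G x y"
  unfolding nonorderable_pair_def nat_pow_def by simp

section \<open>Twisting and rotating a planar configuration\<close>

lemma log_increment_turn:
  fixes w :: complex
  assumes "continuous_on {0..1} \<rho>" "\<And>t. t \<in> {0..1} \<Longrightarrow> 0 < \<rho> t" "\<rho> 1 = \<rho> 0" "w \<noteq> 0"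
  obtains f where "continuous_on {0..1} f" "f 1 - f 0 = 2 * pi * \<i>"
    "\<And>t. t \<in> {0..1} \<Longrightarrow> exp (f t) = of_real (\<rho> t) * cis (2 * pi * t) * w"
proof
  let ?f = "\<lambda>t. of_real (ln (\<rho> t)) + of_real (2 * pi * t) * \<i> + Ln w"
  have "\<rho> t \<noteq> 0" if "t \<in> {0..1}" for t
    using assms(2)[OF that] by simp
  then show "continuous_on {0..1} ?f"
    using assms(1) by (intro continuous_intros) blast+
  show "?f 1 - ?f 0 = 2 * pi * \<i>"
    using assms(3) by simp
  show "exp (?f t) = of_real (\<rho> t) * cis (2 * pi * t) * w" if "t \<in> {0..1}" for t
  proof -
    have "exp (?f t) = exp (of_real (ln (\<rho> t))) * cis (2 * pi * t) * w"
      using \<open>w \<noteq> 0\<close> by (simp add: exp_add cis_conv_exp mult.commute)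
    also have "exp (of_real (ln (\<rho> t))) = (of_real (\<rho> t) :: complex)"
      using assms(2)[OF that] by (simp only: exp_of_real exp_ln)
    finally show ?thesis .
  qed
qed

lemma log_increment_within_ball:
  fixes w :: complex
  assumes x: "continuous_on {0..1} x" "x 1 = x 0"
    and le: "\<And>t. t \<in> {0..1} \<Longrightarrow> norm (x t) \<le> norm w" and neq: "\<And>t. t \<in> {0..1} \<Longrightarrow> x t \<noteq> w"
    and "w \<noteq> 0"
  obtains g where "continuous_on {0..1} g" "g 1 = g (0 :: real)"
    "\<And>t. t \<in> {0..1} \<Longrightarrow> exp (g t) = x t - w"
proof
  let ?y = "\<lambda>t. 1 - x t / w" and ?g = "\<lambda>t. Ln (1 - x t / w) + Ln (- w)"
  have nonpos: "?y t \<notin> \<real>\<^sub>\<le>\<^sub>0" if t: "t \<in> {0..1}" for t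
  proof -
    have norm: "norm (x t / w) \<le> 1" and "x t / w \<noteq> 1"
      using le[OF t] neq[OF t] \<open>w \<noteq> 0\<close> by (simp_all add: norm_divide)
    have "Re (x t / w) \<noteq> 1"
    proof
      assume "Re (x t / w) = 1"
      moreover from this have "Im (x t / w) = 0"
        using norm cmod_power2[of "x t / w"] power_le_one[of "norm (x t / w)" 2] by simp
      ultimately show False
        using \<open>x t / w \<noteq> 1\<close> by (simp add: complex_eq_iff)
    qed
    then have "Re (x t / w) < 1"
      using norm complex_Re_le_cmod[of "x t / w"] by linarith
    then show ?thesis
      by (simp add: complex_nonpos_Reals_iff)
  qed
  show "continuous_on {0..1} ?g"
    using nonpos \<open>w \<noteq> 0\<close> x(1) by (intro continuous_intros) blast+
  show "?g 1 = ?g 0"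
    using x(2) by simp
  show "exp (?g t) = x t - w" if "t \<in> {0..1}" for t
  proof -
    have "?y t \<noteq> 0"
      using nonpos[OF that] by auto
    then have "exp (?g t) = ?y t * - w"
      using \<open>w \<noteq> 0\<close> by (simp add: exp_add)
    also have "\<dots> = x t - w"
      using \<open>w \<noteq> 0\<close> by (simp add: field_simps)
    finally show ?thesis .
  qed
qed

definition dip :: "real \<Rightarrow> real" where
  "dip t = 1 - t * (1 - t)"

lemma dip_ends [simp]: "dip 0 = 1" "dip 1 = 1"
  by (simp_all add: dip_def)

lemma dip_pos: "0 < dip t"
proof -
  have "0 < (t - 1/2)\<^sup>2 + 3/4"
    by (rule add_nonneg_pos) simp_all
  then show ?thesis
    by (simp add: dip_def power2_eq_square algebra_simps)
qed

lemma dip_le_1: "t \<in> {0..1} \<Longrightarrow> dip t \<le> 1"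
  by (simp add: dip_def)

lemma dip_less_1: "\<lbrakk>0 < t; t < 1\<rbrakk> \<Longrightarrow> dip t < 1"
  by (simp add: dip_def)

lemma continuous_on_dip [continuous_intros]:
  "continuous_on A f \<Longrightarrow> continuous_on A (\<lambda>x. dip (f x))"
  unfolding dip_def by (intro continuous_intros)

locale rotating_strands = moving_pair +
  fixes M :: "'a topology" and n :: nat and e :: "complex \<Rightarrow> 'a"
  assumes surface: "surface_with_boundary M" and compact: "compact_space M"
    and connected: "connected_space M" and p: "p permutes {..<n}" and l: "l < n" and j: "j < n"
    and e: "open_embedding UNIV M e"
begin

lemma Hausdorff: "Hausdorff_space M"
  using surface by (simp add: surface_with_boundary_def)

lemma p_less_iff [simp]: "p i < n \<longleftrightarrow> i < n"
  using permutes_in_image[OF p, of i] by simp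

lemma speed_p [simp]: "speed (p i) = speed i"
  by (rule speed_cong_orbit) simp

lemma e_eq_iff [simp]: "e z = e w \<longleftrightarrow> z = w"
  using open_embedding_eq_iff[OF e] by simp

lemma pos_eq_iff [simp]: "pos i = pos k \<longleftrightarrow> i = k"
  using inj_pos by (rule inj_eq)

lemma pos_j_neq_1: "pos j \<noteq> 1"
  using pos_eq_iff[of j l] by simp

(* Between its ends the twisting strand is strictly closer to l than j is; it thereby avoids the
   other points that are as close to l as j. *)
definition twisting :: "real \<Rightarrow> complex" where
  "twisting t = 1 + of_real (dip t) * cis (2 * pi * t) * (pos j - 1)"

definition strand :: "nat \<Rightarrow> real \<Rightarrow> complex" where
  "strand i t = (if i = j then twisting t else pos i)"

definition spin :: "real \<Rightarrow> real \<Rightarrow> nat \<Rightarrow> 'a" where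
  "spin \<tau> s = (\<lambda>i\<in>{..<n}. e (cis (2 * pi * (\<tau> * speed i)) * strand i s))"

lemma twisting_ends [simp]: "twisting 0 = pos j" "twisting 1 = pos j"
  by (simp_all add: twisting_def)

lemma strand_ends [simp]: "strand i 0 = pos i" "strand i 1 = pos i"
  by (simp_all add: strand_def)

lemma continuous_on_twisting [continuous_intros]:
  "continuous_on T f \<Longrightarrow> continuous_on T (\<lambda>x. twisting (f x))"
  unfolding twisting_def by (intro continuous_intros)

lemma continuous_on_strand [continuous_intros]:
  "continuous_on T f \<Longrightarrow> continuous_on T (\<lambda>x. strand i (f x))"
  unfolding strand_def by (cases "i = j") (simp_all add: continuous_on_twisting)

lemma norm_contracted_twisting_diff_one:
  assumes "\<sigma> \<in> {0..1}"
  shows "norm (of_real (1 - \<sigma>) * twisting s + of_real \<sigma> * pos j - 1) \<le>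
    ((1 - \<sigma>) * dip s + \<sigma>) * norm (pos j - 1)"
proof -
  let ?a = "of_real (1 - \<sigma>) * (of_real (dip s) * cis (2 * pi * s))"
  have "of_real (1 - \<sigma>) * twisting s + of_real \<sigma> * pos j - 1 = (?a + of_real \<sigma>) * (pos j - 1)"
    by (simp add: twisting_def algebra_simps)
  moreover have "norm (?a + of_real \<sigma>) \<le> (1 - \<sigma>) * dip s + \<sigma>"
    using norm_triangle_ineq[of ?a "of_real \<sigma>"] assms dip_pos[of s]
    by (simp add: norm_mult del: of_real_diff)
  ultimately show ?thesis
    by (simp add: norm_mult mult_right_mono)
qed

lemma contracted_twisting:
  assumes \<sigma>: "\<sigma> \<in> {0..1}" and s: "s \<in> {0..1}"
  shows "norm (of_real (1 - \<sigma>) * twisting s + of_real \<sigma> * pos j) \<le> 14/5"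
    and "\<lbrakk>k \<noteq> j; k \<noteq> l\<rbrakk> \<Longrightarrow> of_real (1 - \<sigma>) * twisting s + of_real \<sigma> * pos j \<noteq> pos k"
proof -
  let ?z = "of_real (1 - \<sigma>) * twisting s + of_real \<sigma> * pos j" and ?c = "(1 - \<sigma>) * dip s + \<sigma>"
  have c_le: "?c \<le> 1"
    using mult_left_le[OF dip_le_1[OF s], of "1 - \<sigma>"] \<sigma> by simp
  have z: "norm (?z - 1) \<le> ?c * norm (pos j - 1)"
    using \<sigma> by (rule norm_contracted_twisting_diff_one)
  also have "\<dots> \<le> norm (pos j - 1)"
    using c_le mult_right_mono[of ?c 1 "norm (pos j - 1)"] by simp
  finally show "norm ?z \<le> 14/5"
    using norm_triangle_ineq[of "?z - 1" 1] pos_j_nearest(1) by simp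
  assume k: "k \<noteq> j" "k \<noteq> l"
  show "?z \<noteq> pos k"
  proof (cases "\<sigma> = 1 \<or> s = 0 \<or> s = 1")
    case True
    then have "?z = pos j"
      by (auto simp: algebra_simps)
    then show ?thesis
      using k by auto
  next
    case False
    then have "(1 - \<sigma>) * dip s < 1 - \<sigma>"
      using \<sigma> s dip_less_1[of s] by simp
    then have "?c * norm (pos j - 1) < 1 * norm (pos j - 1)"
      using pos_j_neq_1 by (intro mult_strict_right_mono) simp_all
    then have "norm (?z - 1) < norm (pos k - 1)"
      using z pos_j_nearest(2)[OF k(2)] by linarith
    then show ?thesis
      by auto
  qed
qed

lemma norm_twisting: "s \<in> {0..1} \<Longrightarrow> norm (twisting s) \<le> 14/5"
  using contracted_twisting(1)[of 0 s] by simp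

lemma twisting_neq_1: "twisting s \<noteq> 1"
  using dip_pos[of s] pos_j_neq_1 by (simp add: twisting_def)

lemma twisting_neq: "\<lbrakk>s \<in> {0..1}; k \<noteq> j\<rbrakk> \<Longrightarrow> twisting s \<noteq> pos k"
  using contracted_twisting(2)[of 0 s k] twisting_neq_1[of s] by (cases "k = l") auto

lemma strand_neq: "\<lbrakk>s \<in> {0..1}; i \<noteq> k\<rbrakk> \<Longrightarrow> strand i s \<noteq> strand k s"
  using twisting_neq[of s i] twisting_neq[of s k] by (auto simp: strand_def)

lemma speed_eq_or_norm_strand_neq:
  assumes "s \<in> {0..1}"
  shows "speed i = speed k \<or> norm (strand i s) \<noteq> norm (strand k s)"
  using speed_eq_or_norm_pos_ge[of i] speed_eq_or_norm_pos_ge[of k] speed_eq_or_norm_pos_neq[of i k]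
    norm_twisting[OF assms] by (auto simp: strand_def)

lemma rotated_strand_neq:
  assumes "s \<in> {0..1}" "i \<noteq> k"
  shows "cis (2 * pi * (\<tau> * speed i)) * strand i s \<noteq> cis (2 * pi * (\<tau> * speed k)) * strand k s"
proof
  assume eq: "cis (2 * pi * (\<tau> * speed i)) * strand i s = cis (2 * pi * (\<tau> * speed k)) * strand k s"
  then have "norm (strand i s) = norm (strand k s)"
    by (metis mult_1 norm_cis norm_mult)
  then have "speed i = speed k"
    using speed_eq_or_norm_strand_neq[OF assms(1)] by blast
  then show False
    using eq strand_neq[OF assms] by simp
qed

lemma continuous_map_spin:
  assumes f: "continuous_on T f" and g: "continuous_on T g" "g \<in> T \<rightarrow> {0..1}"
  shows "continuous_map (top_of_set T) (ordered_config M n) (\<lambda>x. spin (f x) (g x))"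
  unfolding continuous_map_ordered_config
proof (intro conjI allI impI ballI)
  fix i assume "i < n"
  moreover have "continuous_map (top_of_set T) M
      (\<lambda>x. e (cis (2 * pi * (f x * speed i)) * strand i (g x)))"
    by (intro open_embedding_compose_on[OF e] continuous_intros f g(1)) auto
  ultimately show "continuous_map (top_of_set T) M (\<lambda>x. spin (f x) (g x) i)"
    by (simp add: spin_def)
next
  fix x assume "x \<in> topspace (top_of_set T)"
  then have "g x \<in> {0..1}"
    using g(2) by auto
  then show "inj_on (spin (f x) (g x)) {..<n}"
    using rotated_strand_neq by (intro inj_onI, simp add: spin_def) blast
qed (simp add: spin_def)

lemma spin_in_config: "s \<in> {0..1} \<Longrightarrow> spin \<tau> s \<in> topspace (ordered_config M n)"
  using continuous_map_image_subset_topspace[OF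
      continuous_map_spin[of "{0} :: real set" "\<lambda>_. \<tau>" "\<lambda>_. s"]]
  by auto

lemma pathin_spin:
  "pathin (ordered_config M n) (spin \<tau>)" "pathin (ordered_config M n) (\<lambda>t. spin (c * t) 0)"
  unfolding pathin_def by (rule continuous_map_spin; auto intro!: continuous_intros)+

lemma spin_twist_ends [simp]: "spin \<tau> 1 = spin \<tau> 0"
  by (simp add: spin_def)

lemma spin_add_one: "spin (\<tau> + 1) 0 = permute_config n p (spin \<tau> 0)"
  by (auto simp: spin_def permute_config_def pos_p cis_mult algebra_simps)

lemma spin_add_image: "spin (\<tau> + real k) 0 ` {..<n} = spin \<tau> 0 ` {..<n}"
proof (induction k)
  case (Suc k)
  have "spin (\<tau> + real (Suc k)) 0 = permute_config n p (spin (\<tau> + real k) 0)"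
    using spin_add_one[of "\<tau> + real k"] by (simp add: add_ac)
  then show ?case
    using Suc by (simp add: permute_config_image[OF p])
qed simp

definition rotated_twist :: "real \<Rightarrow> nat \<Rightarrow> 'a" where
  "rotated_twist s = permute_config n (inv_into UNIV p) (spin 1 s)"

lemma pathin_rotated_twist: "pathin (ordered_config M n) rotated_twist"
  unfolding rotated_twist_def
  by (rule pathin_continuous_image[OF pathin_spin(1)
        continuous_map_permute_config[OF permutes_inv[OF p]]])

lemma rotated_twist_image: "rotated_twist s ` {..<n} = spin 1 s ` {..<n}"
  unfolding rotated_twist_def by (rule permute_config_image[OF permutes_inv[OF p]])

lemma rotated_twist_apply:
  assumes "i < n"
  shows "rotated_twist s i = e (if i = p j then cis (2 * pi * speed j) * twisting s else pos i)"
proof -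
  obtain k where k: "i = p k"
    using permutes_surj[OF p] by blast
  have "inv_into UNIV p (p k) = k"
    using permutes_inj[OF p] by simp
  then show ?thesis
    using assms by (simp add: k rotated_twist_def permute_config_def spin_def strand_def pos_p)
qed

lemma rotated_twist_0: "rotated_twist 0 = spin 0 0"
proof
  fix i show "rotated_twist 0 i = spin 0 0 i"
  proof (cases "i < n")
    case True
    then show ?thesis
      using pos_p[of j] by (auto simp: rotated_twist_apply spin_def)
  qed (simp add: rotated_twist_def permute_config_def spin_def)
qed

subsection \<open>Strands swept out by a homotopy between a twist and its rotation\<close>

definition untwisting :: "nat \<Rightarrow> real \<times> real \<Rightarrow> complex" where
  "untwisting i x = (if i = p j
     then cis (2 * pi * speed j) * (of_real (1 - fst x) * twisting (snd x) + of_real (fst x) * pos j)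
     else pos i)"

lemma untwisting_simps [simp]:
  "untwisting i (1, t) = pos i" "untwisting i (\<sigma>, 1) = untwisting i (\<sigma>, 0)"
  by (simp_all add: untwisting_def pos_p)

lemma untwisting_0: "i < n \<Longrightarrow> e (untwisting i (0, t)) = rotated_twist t i"
  by (simp add: untwisting_def rotated_twist_apply)

lemma continuous_on_untwisting [continuous_intros]:
  "\<lbrakk>continuous_on A f; continuous_on A g\<rbrakk> \<Longrightarrow> continuous_on A (\<lambda>x. untwisting i (f x, g x))"
  unfolding untwisting_def by (cases "i = p j") (auto intro!: continuous_intros)

lemma untwisting_neq:
  assumes x: "x \<in> unit_square" and "i \<noteq> k" and k: "k \<notin> {p j, p l}"
  shows "untwisting i x \<noteq> untwisting k x"
proof (cases "i = p j")
  case True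
  obtain k' where k': "k = p k'"
    using permutes_surj[OF p] by blast
  let ?z = "of_real (1 - fst x) * twisting (snd x) + of_real (fst x) * pos j"
  have z: "norm ?z \<le> 14/5" "?z \<noteq> pos k'"
    using contracted_twisting(1)[of "fst x" "snd x"]
      contracted_twisting(2)[of "fst x" "snd x" k'] x k
    by (auto simp: k' mem_Times_iff)
  have "cis (2 * pi * speed j) * ?z \<noteq> cis (2 * pi * speed k') * pos k'"
  proof (cases "speed k' = speed j")
    case True
    then show ?thesis
      using z(2) by simp
  next
    case False
    then have "norm (pos k') \<ge> 3"
      using speed_eq_or_norm_pos_ge[of k'] by blast
    then have "norm (cis (2 * pi * speed j) * ?z) \<noteq> norm (cis (2 * pi * speed k') * pos k')"
      using z(1) by (simp add: norm_mult del: of_real_diff)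
    then show ?thesis
      by metis
  qed
  then show ?thesis
    using True k by (simp add: untwisting_def k' pos_p)
next
  case False
  then show ?thesis
    using assms by (simp add: untwisting_def)
qed

definition untwist_homotopy :: "(real \<times> real \<Rightarrow> nat \<Rightarrow> 'a) \<Rightarrow> nat \<Rightarrow> real \<times> real \<Rightarrow> 'a" where
  "untwist_homotopy S i x = (if 1/2 \<le> fst x then S (2 - 2 * fst x, snd x) i
     else e (untwisting i (1 - 2 * fst x, snd x)))"

lemma continuous_map_untwist_homotopy:
  assumes S: "continuous_map (top_of_set unit_square) (ordered_config M n) S"
    and S1: "\<And>t. t \<in> {0..1} \<Longrightarrow> S (1, t) = rotated_twist t" and i: "i < n"
  shows "continuous_map (top_of_set unit_square) M (untwist_homotopy S i)"
  unfolding untwist_homotopy_def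
proof (rule continuous_map_top_of_set_cases_le)
  have "continuous_map (top_of_set unit_square) M (\<lambda>x. S x i)"
    using S i unfolding continuous_map_ordered_config by blast
  then show "continuous_map (top_of_set {x \<in> unit_square. 1/2 \<le> fst x}) M
      (\<lambda>x. S (2 - 2 * fst x, snd x) i)"
    by (rule continuous_map_compose_on) (auto intro!: continuous_intros)
  show "continuous_map (top_of_set {x \<in> unit_square. fst x \<le> 1/2}) M
      (\<lambda>x. e (untwisting i (1 - 2 * fst x, snd x)))"
    by (rule open_embedding_compose_on[OF e]) (auto intro!: continuous_intros)
  show "S (2 - 2 * fst x, snd x) i = e (untwisting i (1 - 2 * fst x, snd x))"
    if "x \<in> unit_square" "1/2 = fst x" for x
  proof -
    have "2 - 2 * fst x = 1" "1 - 2 * fst x = 0"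
      using that(2) by linarith+
    then show ?thesis
      using that(1) S1[of "snd x"] untwisting_0[OF i, of "snd x"] by (auto simp: mem_Times_iff)
  qed
qed (auto intro!: continuous_intros)

lemma untwist_homotopy_neq:
  assumes S: "continuous_map (top_of_set unit_square) (ordered_config M n) S"
    and ik: "i < n" "k < n" "i \<noteq> k" "k \<notin> {p j, p l}" and x: "x \<in> unit_square"
  shows "untwist_homotopy S i x \<noteq> untwist_homotopy S k x"
proof (cases "1/2 \<le> fst x")
  case True
  then have "(2 - 2 * fst x, snd x) \<in> unit_square"
    using x by auto
  then have "inj_on (S (2 - 2 * fst x, snd x)) {..<n}"
    using S unfolding continuous_map_ordered_config by auto
  then show ?thesis
    using True ik inj_on_eq_iff[of _ "{..<n}" i k] by (simp add: untwist_homotopy_def)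
next
  case False
  then show ?thesis
    using untwisting_neq[of "(1 - 2 * fst x, snd x)" i k] ik x by (auto simp: untwist_homotopy_def)
qed

lemma untwist_homotopy_descends:
  assumes "\<And>s. s \<in> {0..1} \<Longrightarrow> S (s, 0) = spin 0 0" "\<And>s. s \<in> {0..1} \<Longrightarrow> S (s, 1) = spin 0 1"
  shows "r \<in> {0..1} \<Longrightarrow> untwist_homotopy S i (r, 0) = untwist_homotopy S i (r, 1)"
    and "untwist_homotopy S i (0, t) = untwist_homotopy S i (0, 0)"
  using assms[of "2 - 2 * r"] by (simp_all add: untwist_homotopy_def)

lemma strand_discs:
  assumes "path_homotopic (ordered_config M n) (spin 0) rotated_twist"
  obtains X where "\<And>i. i < n \<Longrightarrow> continuous_map (top_of_set (cball 0 1)) M (X i)"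
    "\<And>i t. \<lbrakk>i < n; t \<in> {0..1}\<rbrakk> \<Longrightarrow> X i (cis (2 * pi * t)) = e (strand i t)"
    "\<And>i k z. \<lbrakk>i < n; k < n; i \<noteq> k; k \<notin> {p j, p l}; norm z \<le> 1\<rbrakk> \<Longrightarrow> X i z \<noteq> X k z"
proof -
  obtain S where S: "continuous_map (top_of_set unit_square) (ordered_config M n) S"
    and S0: "\<And>t. t \<in> {0..1} \<Longrightarrow> S (0, t) = spin 0 t"
    and S1: "\<And>t. t \<in> {0..1} \<Longrightarrow> S (1, t) = rotated_twist t"
    and ends: "\<And>s. s \<in> {0..1} \<Longrightarrow> S (s, 0) = spin 0 0" "\<And>s. s \<in> {0..1} \<Longrightarrow> S (s, 1) = spin 0 1"
    using assms by (rule path_homotopicE) blast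
  let ?f = "untwist_homotopy S"
  have "\<exists>g. continuous_map (top_of_set (cball 0 1)) M g \<and> (\<forall>x\<in>unit_square. g (polar x) = ?f i x)"
    if "i < n" for i
    by (rule polar_descend[OF continuous_map_untwist_homotopy[OF S S1 that]
          untwist_homotopy_descends[OF ends]]) blast+
  then obtain X where X: "\<And>i. i < n \<Longrightarrow> continuous_map (top_of_set (cball 0 1)) M (X i)"
    "\<And>i x. \<lbrakk>i < n; x \<in> unit_square\<rbrakk> \<Longrightarrow> X i (polar x) = ?f i x"
    by metis
  show thesis
  proof (rule that[of X])
    show "X i (cis (2 * pi * t)) = e (strand i t)" if "i < n" "t \<in> {0..1}" for i t
      using X(2)[of i "(1, t)"] S0 that by (simp add: polar_def untwist_homotopy_def spin_def)
    show "X i z \<noteq> X k z" if "i < n" "k < n" "i \<noteq> k" "k \<notin> {p j, p l}" "norm z \<le> 1" for i k z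
    proof -
      obtain x where "x \<in> unit_square" "z = polar x"
        using \<open>norm z \<le> 1\<close> by (rule polar_surj_unit_disc)
      then show ?thesis
        using X(2) untwist_homotopy_neq[OF S] that by simp
    qed
  qed (rule X(1))
qed

lemma ex_strand_bound: "\<exists>R. \<forall>i<n. \<forall>t\<in>{0..1}. norm (strand i t) \<le> R"
proof -
  obtain B where "\<And>i. i < n \<Longrightarrow> norm (pos i) \<le> B"
    using finite_imp_bounded[of "pos ` {..<n}"] unfolding bounded_iff by auto
  then have "norm (strand i t) \<le> max B (14/5)" if "i < n" "t \<in> {0..1}" for i t
    using that norm_twisting[of t] by (auto simp: strand_def le_max_iff_disj)
  then show ?thesis
    by blast
qed

lemma interior_strand_discs:
  assumes "path_homotopic (ordered_config M n) (spin 0) rotated_twist"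
  obtains X where "\<And>i. i < n \<Longrightarrow> continuous_map (top_of_set (cball 0 1)) M (X i)"
    "\<And>i. i < n \<Longrightarrow> X i \<in> cball 0 1 \<rightarrow> manifold_interior M"
    "\<And>i t. \<lbrakk>i < n; t \<in> {0..1}\<rbrakk> \<Longrightarrow> X i (cis (2 * pi * t)) = e (strand i t)"
    "\<And>i k z. \<lbrakk>i < n; k < n; i \<noteq> k; k \<notin> {p j, p l}; norm z \<le> 1\<rbrakk> \<Longrightarrow> X i z \<noteq> X k z"
proof -
  obtain X where X: "\<And>i. i < n \<Longrightarrow> continuous_map (top_of_set (cball 0 1)) M (X i)"
    "\<And>i t. \<lbrakk>i < n; t \<in> {0..1}\<rbrakk> \<Longrightarrow> X i (cis (2 * pi * t)) = e (strand i t)"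
    "\<And>i k z. \<lbrakk>i < n; k < n; i \<noteq> k; k \<notin> {p j, p l}; norm z \<le> 1\<rbrakk> \<Longrightarrow> X i z \<noteq> X k z"
    using strand_discs[OF assms] by blast
  obtain R where R: "\<And>i t. \<lbrakk>i < n; t \<in> {0..1}\<rbrakk> \<Longrightarrow> norm (strand i t) \<le> R"
    using ex_strand_bound by blast
  have "closedin M (e ` cball 0 R)" "e ` cball 0 R \<subseteq> manifold_interior M"
    using open_embedding_closedin_image[OF e Hausdorff, of "cball 0 R"] manifold_interiorI[OF e]
    by auto
  then obtain h where h: "continuous_map M M h" "inj_on h (topspace M)"
    "h ` topspace M \<subseteq> manifold_interior M" "\<And>x. x \<in> e ` cball 0 R \<Longrightarrow> h x = x"
    using push_into_interior[OF surface compact] by blast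
  have X_top: "X i z \<in> topspace M" if "i < n" "norm z \<le> 1" for i z
    using continuous_map_image_subset_topspace[OF X(1)[OF \<open>i < n\<close>]] that by auto
  show thesis
  proof (rule that[of "\<lambda>i z. h (X i z)"])
    show "continuous_map (top_of_set (cball 0 1)) M (\<lambda>z. h (X i z))" if "i < n" for i
      using continuous_map_compose[OF X(1)[OF that] h(1)] by (simp add: o_def)
    show "(\<lambda>z. h (X i z)) \<in> cball 0 1 \<rightarrow> manifold_interior M" if "i < n" for i
      using h(3) X_top[OF that] by auto
    show "h (X i (cis (2 * pi * t))) = e (strand i t)" if "i < n" "t \<in> {0..1}" for i t
      using X(2)[OF that] R[OF that] h(4) by simp
    show "h (X i z) \<noteq> h (X k z)" if "i < n" "k < n" "i \<noteq> k" "k \<notin> {p j, p l}" "norm z \<le> 1" for i k z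
      using X(3)[OF that] X_top that inj_on_eq_iff[OF h(2)] by simp
  qed
qed

lemma fixed_strand_discs:
  assumes "path_homotopic (ordered_config M n) (spin 0) rotated_twist"
  obtains X h k where "\<And>i. i < n \<Longrightarrow> continuous_map (top_of_set (cball 0 1)) M (X i)"
    "\<And>t. t \<in> {0..1} \<Longrightarrow> X j (cis (2 * pi * t)) = e (twisting t)"
    "\<And>i z. \<lbrakk>i < n; i \<noteq> j; norm z = 1\<rbrakk> \<Longrightarrow> X i z = e (pos i)"
    "isotopy (top_of_set (cball 0 1)) M h k"
    "\<And>i z. \<lbrakk>i < n; i \<notin> {j, p j, p l}; norm z \<le> 1\<rbrakk> \<Longrightarrow> h z (e (pos i)) = X i z"
    "\<And>i k z. \<lbrakk>i < n; k < n; i \<noteq> k; k \<notin> {p j, p l}; norm z \<le> 1\<rbrakk> \<Longrightarrow> X i z \<noteq> X k z"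
proof -
  let ?I = "{..<n} - {j, p j, p l}"
  obtain X where X: "\<And>i. i < n \<Longrightarrow> continuous_map (top_of_set (cball 0 1)) M (X i)"
      "\<And>i. i < n \<Longrightarrow> X i \<in> cball 0 1 \<rightarrow> manifold_interior M"
    and circle: "\<And>i t. \<lbrakk>i < n; t \<in> {0..1}\<rbrakk> \<Longrightarrow> X i (cis (2 * pi * t)) = e (strand i t)"
    and neq: "\<And>i k z. \<lbrakk>i < n; k < n; i \<noteq> k; k \<notin> {p j, p l}; norm z \<le> 1\<rbrakk> \<Longrightarrow> X i z \<noteq> X k z"
    using interior_strand_discs[OF assms] by blast
  have X_circle: "X i z = e (pos i)" if "i < n" "i \<noteq> j" "norm z = 1" for i z
  proof -
    obtain t where "t \<in> {0..1}" "z = cis (2 * pi * t)"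
      using unit_circle_param[OF \<open>norm z = 1\<close>] by blast
    then show ?thesis
      using circle[of i t] that by (simp add: strand_def)
  qed
  have "\<exists>h k. isotopy (top_of_set (cball 0 1)) M h k \<and> (\<forall>m\<in>topspace M. h 1 m = m) \<and>
      (\<forall>i\<in>?I. \<forall>z\<in>cball 0 1. h z (X i 1) = X i z)"
    by (rule isotopy_extension_unit_disc[OF Hausdorff]) (use X neq in auto)
  then obtain h k where "isotopy (top_of_set (cball 0 1)) M h k"
    "\<And>i z. \<lbrakk>i \<in> ?I; norm z \<le> 1\<rbrakk> \<Longrightarrow> h z (X i 1) = X i z"
    by auto
  moreover have "X j (cis (2 * pi * t)) = e (twisting t)" if "t \<in> {0..1}" for t
    using circle[OF j that] by (simp add: strand_def)
  ultimately show thesis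
    by (intro that[of X h k] X(1) X_circle neq) (simp_all add: X_circle[of _ 1, symmetric])
qed

lemma twist_null_homotopic:
  assumes "path_homotopic (ordered_config M n) (spin 0) rotated_twist"
  obtains Y where "\<And>t. t \<in> {0..1} \<Longrightarrow> Y (cis (2 * pi * t)) = e (twisting t)"
    "continuous_map (top_of_set (cball 0 1))
      (subtopology M (topspace M - e ` pos ` ({..<n} - {j, p j, p l}))) Y"
proof -
  let ?I = "{..<n} - {j, p j, p l}"
  obtain X h k where X: "\<And>i. i < n \<Longrightarrow> continuous_map (top_of_set (cball 0 1)) M (X i)"
    and circle: "\<And>t. t \<in> {0..1} \<Longrightarrow> X j (cis (2 * pi * t)) = e (twisting t)"
      "\<And>i z. \<lbrakk>i < n; i \<noteq> j; norm z = 1\<rbrakk> \<Longrightarrow> X i z = e (pos i)"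
    and I: "isotopy (top_of_set (cball 0 1)) M h k"
    and h: "\<And>i z. \<lbrakk>i < n; i \<notin> {j, p j, p l}; norm z \<le> 1\<rbrakk> \<Longrightarrow> h z (e (pos i)) = X i z"
    and neq: "\<And>i k z. \<lbrakk>i < n; k < n; i \<noteq> k; k \<notin> {p j, p l}; norm z \<le> 1\<rbrakk> \<Longrightarrow> X i z \<noteq> X k z"
    by (rule fixed_strand_discs[OF assms]) (rule that)
  define m where "m = (if p l = j then p j else p l)"
  have m: "m < n" "m \<noteq> j" "m \<in> {p j, p l}"
    using l j p_eq_iff[of j l] by (auto simp: m_def)
  have avoid: "X i z \<noteq> h z q" if "i < n" "i \<notin> ?I" "norm z \<le> 1" "q \<in> e ` pos ` ?I" for i z q
  proof -
    obtain k where "k \<in> ?I" "q = e (pos k)"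
      using \<open>q \<in> _\<close> by blast
    moreover from this have "X i z \<noteq> X k z"
      using that by (intro neq) auto
    ultimately show ?thesis
      using h \<open>norm z \<le> 1\<close> by simp
  qed
  show thesis
  proof (rule section_null_homotopic[OF I, of "e ` pos ` ?I" "X j" "X m" "e (pos m)"])
    show "e ` pos ` ?I \<subseteq> topspace M"
      using open_embedding_in_topspace[OF e] by auto
    show "h z q = q" if "norm z = 1" "q \<in> e ` pos ` ?I" for z q
    proof -
      obtain k where "k \<in> ?I" "q = e (pos k)"
        using \<open>q \<in> _\<close> by blast
      then show ?thesis
        using h[of k z] circle(2)[of k z] \<open>norm z = 1\<close> by simp
    qed
    show "path_connected_space (subtopology M (topspace M - e ` pos ` ?I))"
      by (rule surface_diff_finite_path_connected[OF surface connected]) simp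
    show "X m z = e (pos m)" if "norm z = 1" for z
      using m that by (intro circle(2))
    fix Y assume "continuous_map (top_of_set (cball 0 1))
        (subtopology M (topspace M - e ` pos ` ?I)) Y"
      and Y: "\<And>z. norm z = 1 \<Longrightarrow> Y z = X j z"
    then show thesis
      using circle(1) by (intro that[of Y]) simp_all
  qed (use X avoid j m in auto)
qed

lemma no_twist_null_homotopy:
  assumes q: "q \<noteq> j" "q \<noteq> l"
    and Y: "\<And>t. t \<in> {0..1} \<Longrightarrow> Y (cis (2 * pi * t)) = e (twisting t)"
  shows "\<not> continuous_map (top_of_set (cball 0 1)) (subtopology M (topspace M - e ` {1, pos q})) Y"
proof
  assume cont: "continuous_map (top_of_set (cball 0 1))
      (subtopology M (topspace M - e ` {1, pos q})) Y"
  obtain f where f: "continuous_on {0..1} f" "f 1 - f 0 = 2 * pi * \<i>"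
    "\<And>t. t \<in> {0..1} \<Longrightarrow> exp (f t) = of_real (dip t) * cis (2 * pi * t) * (pos j - 1)"
    by (rule log_increment_turn[of dip "pos j - 1"])
      (use dip_pos pos_j_neq_1 in \<open>auto intro!: continuous_intros\<close>)
  have "norm (twisting t - 1) \<le> norm (pos q - 1)" if "t \<in> {0..1}" for t
    using norm_contracted_twisting_diff_one[of 0 t]
      mult_right_mono[OF dip_le_1[OF that], of "norm (pos j - 1)"]
      pos_j_nearest(2)[OF q(2)] by simp
  then obtain g where g: "continuous_on {0..1} g" "g 1 = g 0"
    "\<And>t. t \<in> {0..1} \<Longrightarrow> exp (g t) = (twisting t - 1) - (pos q - 1)"
    by (rule log_increment_within_ball[of "\<lambda>t. twisting t - 1" "pos q - 1", rotated 2])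
      (use twisting_neq[OF _ q(1)] pos_eq_iff[of q l] q in \<open>auto intro!: continuous_intros\<close>)
  have "f 1 - f 0 = g 1 - g 0"
  proof (rule null_homotopic_log_increments_eq[OF Hausdorff e cont Y])
    show "norm (twisting t) \<le> max (14/5) (norm (pos q))" if "t \<in> {0..1}" for t
      using norm_twisting[OF that] by simp
    show "exp (f t) = twisting t - 1" "exp (g t) = twisting t - pos q" if "t \<in> {0..1}" for t
      using f(3)[OF that] g(3)[OF that] by (simp_all add: twisting_def)
  qed (use f g in simp_all)
  then show False
    using f(2) g(2) by simp
qed

proposition double_rotation_null_homotopic_if_twist_homotopic:
  assumes "path_homotopic (ordered_config M n) (spin 0) rotated_twist"
  shows "path_homotopic (ordered_config M n)
    (\<lambda>t. spin (real (2 * card (orbit p l)) * t) 0) (\<lambda>_. spin 0 0)"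
proof -
  let ?I = "{..<n} - {j, p j, p l}"
  obtain Y where Y: "\<And>t. t \<in> {0..1} \<Longrightarrow> Y (cis (2 * pi * t)) = e (twisting t)"
    "continuous_map (top_of_set (cball 0 1)) (subtopology M (topspace M - e ` pos ` ?I)) Y"
    using twist_null_homotopic[OF assms] by blast
  have Y_diff: "continuous_map (top_of_set (cball 0 1)) (subtopology M (topspace M - e ` pos ` J)) Y"
    if "J \<subseteq> ?I" for J
    using Y(2) that unfolding continuous_map_in_subtopology by blast
  have l_I: "l \<in> ?I"
    using l moves_l by auto
  have "q = l" if "q \<in> ?I" for q
    using no_twist_null_homotopy[OF _ _ Y(1), of q] Y_diff[of "{l, q}"] that l_I by auto
  then have speed: "speed i = 1 / card (orbit p l)" if "i < n" for i
    using that speed_near[of i] by blast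
  have "path_homotopic (ordered_config M n)
      (\<lambda>t. \<lambda>i\<in>{..<n}. e (cis (4 * pi * t) * pos i)) (\<lambda>_. \<lambda>i\<in>{..<n}. e (pos i))"
  proof (rule double_rotation_null_homotopic[OF Hausdorff e])
    show "continuous_map (top_of_set (cball 0 1)) (subtopology M (topspace M - {e 1})) Y"
      using Y_diff[of "{l}"] l_I by simp
    show "Y (cis (2 * pi * t)) = e (1 + of_real (dip t) * cis (2 * pi * t) * (pos j - 1))"
      if "t \<in> {0..1}" for t
      using Y(1)[OF that] by (simp add: twisting_def)
  qed (use dip_pos dip_le_1 pos_j_neq_1 inj_pos in \<open>auto intro: inj_on_subset\<close>)
  moreover have "(\<lambda>i\<in>{..<n}. e (cis (4 * pi * t) * pos i)) =
      spin (real (2 * card (orbit p l)) * t) 0" for t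
    unfolding spin_def using card_orbit_pos[OF permutation, of l]
    by (intro restrict_ext) (simp add: speed field_simps)
  moreover have "(\<lambda>i\<in>{..<n}. e (pos i)) = spin 0 0"
    by (simp add: spin_def)
  ultimately show ?thesis
    by simp
qed

subsection \<open>The braids of a rotation and of a twist\<close>

abbreviation base :: "'a set" where
  "base \<equiv> spin 0 0 ` {..<n}"

abbreviation "B \<equiv> fundamental_group (unordered_config M n) base"

definition rot :: "nat \<Rightarrow> real \<Rightarrow> 'a set" where
  "rot k t = spin (real k * t) 0 ` {..<n}"

definition twist :: "nat \<Rightarrow> real \<Rightarrow> 'a set" where
  "twist k t = spin (real k) t ` {..<n}"

definition rotation_braid :: "(real \<Rightarrow> 'a set) set" where
  "rotation_braid = loop_class (unordered_config M n) base (rot 1)"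

definition twist_braid :: "(real \<Rightarrow> 'a set) set" where
  "twist_braid = loop_class (unordered_config M n) base (twist 0)"

lemma loopin_rot: "loopin (unordered_config M n) base (rot k)"
  using pathin_config_image[OF pathin_spin(2)[of "real k"]] spin_add_image[of 0 k]
  by (simp add: loopin_def rot_def[abs_def])

lemma loopin_twist: "loopin (unordered_config M n) base (twist k)"
  using pathin_config_image[OF pathin_spin(1)[of "real k"]] spin_add_image[of 0 k]
  by (simp add: loopin_def twist_def[abs_def])

lemma base_in_topspace: "base \<in> topspace (unordered_config M n)"
  unfolding topspace_unordered_config by (intro imageI spin_in_config) simp

sublocale B: group B
  using base_in_topspace by (rule group_fundamental_group)

lemma rotation_braid_closed [simp]: "rotation_braid \<in> carrier B"
  unfolding rotation_braid_def by (rule loop_class_in_fundamental_group[OF loopin_rot])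

lemma twist_braid_closed [simp]: "twist_braid \<in> carrier B"
  unfolding twist_braid_def by (rule loop_class_in_fundamental_group[OF loopin_twist])

lemma rot_join: "path_homotopic (unordered_config M n) (rot k \<frown> rot 1) (rot (Suc k))"
proof (rule path_homotopic_through_convex[where C = "UNIV :: real set"])
  let ?G = "\<lambda>\<tau>. spin \<tau> 0 ` {..<n}" and ?u = "\<lambda>t. real k * min (2 * t) 1 + max 0 (2 * t - 1)"
  have "continuous_map (top_of_set UNIV) (ordered_config M n) (\<lambda>\<tau>. spin \<tau> 0)"
    by (rule continuous_map_spin) (auto intro!: continuous_intros)
  from continuous_map_compose[OF this continuous_map_config_image]
  show "continuous_map (top_of_set UNIV) (unordered_config M n) ?G"
    by (simp add: o_def)
  show "(rot k \<frown> rot 1) t = ?G (?u t)" for t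
    using spin_add_image[of "2 * t - 1" k] by (simp add: loop_join_def rot_def add.commute)
  show "rot (Suc k) t = ?G (real (Suc k) * t)" for t
    by (simp add: rot_def)
qed (auto intro!: continuous_intros)

lemma rotation_braid_pow:
  "rotation_braid [^]\<^bsub>B\<^esub> k = loop_class (unordered_config M n) base (rot k)"
proof (induction k)
  case 0
  have "rot 0 = (\<lambda>_. base)"
    by (simp add: rot_def[abs_def])
  then show ?case
    by (simp add: fundamental_group_one)
next
  case (Suc k)
  have "rotation_braid [^]\<^bsub>B\<^esub> Suc k =
      loop_class (unordered_config M n) base (rot k) \<otimes>\<^bsub>B\<^esub> rotation_braid"
    by (simp only: B.nat_pow_Suc Suc)
  also have "\<dots> = loop_class (unordered_config M n) base (rot k \<frown> rot 1)"
    unfolding rotation_braid_def by (rule fundamental_group_mult[OF loopin_rot loopin_rot])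
  also have "\<dots> = loop_class (unordered_config M n) base (rot (Suc k))"
    using rot_join by (simp add: loop_class_eq_iff[OF loopin_join[OF loopin_rot loopin_rot]
          loopin_rot])
  finally show ?case .
qed

lemma twist_braid_mult_rotation_pow:
  "twist_braid \<otimes>\<^bsub>B\<^esub> rotation_braid [^]\<^bsub>B\<^esub> k =
    rotation_braid [^]\<^bsub>B\<^esub> k \<otimes>\<^bsub>B\<^esub> loop_class (unordered_config M n) base (twist k)"
proof -
  have "continuous_map (top_of_set unit_square) (ordered_config M n)
      (\<lambda>x. spin (real k * snd x) (fst x))"
    by (rule continuous_map_spin) (auto intro!: continuous_intros)
  from continuous_map_compose[OF this continuous_map_config_image]
  have "path_homotopic (unordered_config M n) (twist 0 \<frown> rot k) (rot k \<frown> twist k)"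
    using path_homotopic_square[of "unordered_config M n"
        "\<lambda>x. spin (real k * snd x) (fst x) ` {..<n}"]
    by (simp add: o_def rot_def[abs_def] twist_def[abs_def])
  then show ?thesis
    by (simp add: twist_braid_def rotation_braid_pow fundamental_group_mult loopin_rot loopin_twist
        loop_class_eq_iff loopin_join)
qed

lemma ex_rotation_braid_pow_commutes_twist_braid:
  "\<exists>N>0. rotation_braid [^]\<^bsub>B\<^esub> (N :: nat) \<otimes>\<^bsub>B\<^esub> twist_braid =
    twist_braid \<otimes>\<^bsub>B\<^esub> rotation_braid [^]\<^bsub>B\<^esub> N"
proof -
  obtain N where "N > 0" "\<And>i. cis (2 * pi * (real N * speed i)) = 1"
    using ex_common_period by blast
  moreover from this have "twist N = twist 0"
    by (simp add: twist_def[abs_def] spin_def)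
  ultimately show ?thesis
    using twist_braid_mult_rotation_pow[of N] by (auto simp: twist_braid_def)
qed

lemma rotation_braid_torsion_if_commutes_twist_braid:
  assumes "rotation_braid \<otimes>\<^bsub>B\<^esub> twist_braid = twist_braid \<otimes>\<^bsub>B\<^esub> rotation_braid"
  shows "rotation_braid [^]\<^bsub>B\<^esub> (2 * card (orbit p l)) = \<one>\<^bsub>B\<^esub>"
proof -
  have "rotation_braid \<otimes>\<^bsub>B\<^esub> twist_braid =
      rotation_braid \<otimes>\<^bsub>B\<^esub> loop_class (unordered_config M n) base (twist 1)"
    using assms twist_braid_mult_rotation_pow[of 1] by simp
  then have "twist_braid = loop_class (unordered_config M n) base (twist 1)"
    using loop_class_in_fundamental_group[OF loopin_twist] by simp
  then have "path_homotopic (unordered_config M n) (twist 0) (twist 1)"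
    unfolding twist_braid_def loop_class_eq_iff[OF loopin_twist loopin_twist] .
  then have "path_homotopic (ordered_config M n) (spin 0) rotated_twist"
    by (intro config_homotopy_lift[OF Hausdorff pathin_spin(1) pathin_rotated_twist])
      (simp_all add: rotated_twist_0 rotated_twist_image twist_def[abs_def])
  from path_homotopic_config_image[OF double_rotation_null_homotopic_if_twist_homotopic[OF this]]
  have "path_homotopic (unordered_config M n) (rot (2 * card (orbit p l))) (\<lambda>_. base)"
    by (simp add: rot_def[abs_def])
  then show ?thesis
    unfolding rotation_braid_pow fundamental_group_one
    using loopin_rot base_in_topspace by (subst loop_class_eq_iff) (simp_all add: loopin_def)
qed

proposition nonorderable_pair_rotation_twist: "nonorderable_pair B rotation_braid twist_braid"
  unfolding nonorderable_pair_def
proof (intro conjI impI)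
  assume "rotation_braid \<otimes>\<^bsub>B\<^esub> twist_braid = twist_braid \<otimes>\<^bsub>B\<^esub> rotation_braid"
  then have "rotation_braid [^]\<^bsub>B\<^esub> (2 * card (orbit p l)) = \<one>\<^bsub>B\<^esub>"
    by (rule rotation_braid_torsion_if_commutes_twist_braid)
  then show "\<exists>m>0. rotation_braid [^]\<^bsub>B\<^esub> (m :: nat) = \<one>\<^bsub>B\<^esub>"
    using card_orbit_pos[OF permutation, of l] by (intro exI[of _ "2 * card (orbit p l)"]) simp
qed (rule ex_rotation_braid_pow_commutes_twist_braid)

end

section \<open>The permutation of a braid\<close>

lemma loop_class_reverse:
  assumes "loopin X x p"
  shows "loop_class X x (path_reverse p) = inv\<^bsub>fundamental_group X x\<^esub> loop_class X x p"
proof -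
  have p: "pathin X p" "p 0 = x" "p 1 = x"
    using assms by (auto simp: loopin_def)
  then have x: "x \<in> topspace X"
    using pathin_in_topspace[of X p 0] by simp
  interpret group "fundamental_group X x"
    using x by (rule group_fundamental_group)
  have rev: "loopin X x (path_reverse p)"
    using p by (simp add: loopin_def)
  have "loop_class X x (path_reverse p) \<otimes>\<^bsub>fundamental_group X x\<^esub> loop_class X x p =
      \<one>\<^bsub>fundamental_group X x\<^esub>"
    unfolding fundamental_group_mult[OF rev assms] fundamental_group_one
    using path_homotopic_reverse_join[OF p(1)] p x
    by (subst loop_class_eq_iff[OF loopin_join[OF rev assms]]) (simp_all add: loopin_def)
  then show ?thesis
    using loop_class_in_fundamental_group[OF assms] loop_class_in_fundamental_group[OF rev]
    by (simp add: inv_equality)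
qed

lemma group_braid_group: "b \<in> topspace (ordered_config M n) \<Longrightarrow> group (braid_group M n b)"
  unfolding braid_group_def by (intro group_fundamental_group) (simp add: topspace_unordered_config)

definition braids_with_permutation ::
    "'a topology \<Rightarrow> nat \<Rightarrow> (nat \<Rightarrow> 'a) \<Rightarrow> (nat \<Rightarrow> nat) \<Rightarrow> (real \<Rightarrow> 'a set) set set" where
  "braids_with_permutation M n b p =
     {loop_class (unordered_config M n) (b ` {..<n}) (\<lambda>t. g t ` {..<n}) | g.
        pathin (ordered_config M n) g \<and> g 0 = b \<and> g 1 = permute_config n p b}"

lemma braids_with_permutationI:
  "\<lbrakk>pathin (ordered_config M n) g; g 0 = b; g 1 = permute_config n p b\<rbrakk> \<Longrightarrow>
    loop_class (unordered_config M n) (b ` {..<n}) (\<lambda>t. g t ` {..<n})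
      \<in> braids_with_permutation M n b p"
  unfolding braids_with_permutation_def by blast

lemma braids_with_permutationE:
  assumes "c \<in> braids_with_permutation M n b p" "p permutes {..<n}"
  obtains g where "pathin (ordered_config M n) g" "g 0 = b" "g 1 = permute_config n p b"
    "loopin (unordered_config M n) (b ` {..<n}) (\<lambda>t. g t ` {..<n})"
    "c = loop_class (unordered_config M n) (b ` {..<n}) (\<lambda>t. g t ` {..<n})"
proof -
  obtain g where "pathin (ordered_config M n) g" "g 0 = b" "g 1 = permute_config n p b"
    "c = loop_class (unordered_config M n) (b ` {..<n}) (\<lambda>t. g t ` {..<n})"
    using assms(1) unfolding braids_with_permutation_def by blast
  moreover from this
  have "loopin (unordered_config M n) (b ` {..<n}) (\<lambda>t. g t ` {..<n})"
    by (simp add: loopin_def pathin_config_image permute_config_image[OF assms(2)])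
  ultimately show thesis
    by (intro that)
qed

lemma pure_braid_subgroup_eq:
  assumes "b \<in> topspace (ordered_config M n)"
  shows "pure_braid_subgroup M n b = braids_with_permutation M n b id"
proof -
  have "permute_config n id b = b"
    using assms by (simp add: permute_config_def topspace_ordered_config
        PiE_def extensional_restrict)
  then show ?thesis
    by (simp add: pure_braid_subgroup_def braids_with_permutation_def loopin_def)
qed

lemma braid_has_permutation:
  assumes M: "Hausdorff_space M" and b: "b \<in> topspace (ordered_config M n)"
    and c: "c \<in> carrier (braid_group M n b)"
  obtains p where "p permutes {..<n}" "c \<in> braids_with_permutation M n b p"
proof -
  obtain \<eta> where \<eta>: "c = loop_class (unordered_config M n) (b ` {..<n}) \<eta>"
      "loopin (unordered_config M n) (b ` {..<n}) \<eta>"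
    using c unfolding braid_group_def by (rule fundamental_groupE)
  then have ends: "pathin (unordered_config M n) \<eta>" "\<eta> 0 = b ` {..<n}" "\<eta> 1 = b ` {..<n}"
    by (simp_all add: loopin_def)
  obtain g where g: "pathin (ordered_config M n) g" "\<And>t. t \<in> {0..1} \<Longrightarrow> g t ` {..<n} = \<eta> t" "g 0 = b"
    using config_path_lift[OF M ends(1) b] ends(2) by metis
  have "g 1 \<in> topspace (ordered_config M n)" "g 1 ` {..<n} = b ` {..<n}"
    using pathin_in_topspace[OF g(1)] g(2)[of 1] ends(3) by simp_all
  then obtain p where p: "p permutes {..<n}" "g 1 = permute_config n p b"
    using permute_config_if_same_image[OF _ b] by blast
  have "path_homotopic (unordered_config M n) \<eta> (\<lambda>t. g t ` {..<n})"
    using ends(1) g(2) by (rule path_homotopic_eq)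
  then have "c = loop_class (unordered_config M n) (b ` {..<n}) (\<lambda>t. g t ` {..<n})"
    unfolding \<eta>(1) using g p \<eta>(2)
    by (subst loop_class_eq_iff) (simp_all add: loopin_def pathin_config_image permute_config_image)
  then show thesis
    using that[OF p(1)] braids_with_permutationI[OF g(1,3) p(2)] by simp
qed

lemma one_in_braids_with_permutation:
  assumes M: "Hausdorff_space M" and b: "b \<in> topspace (ordered_config M n)"
    and p: "p permutes {..<n}" and one: "\<one>\<^bsub>braid_group M n b\<^esub> \<in> braids_with_permutation M n b p"
  shows "p = id"
proof -
  let ?C = "unordered_config M n"
  obtain g where g: "pathin (ordered_config M n) g" "g 0 = b" "g 1 = permute_config n p b"
    and loop: "loopin ?C (b ` {..<n}) (\<lambda>t. g t ` {..<n})"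
    and eq: "\<one>\<^bsub>braid_group M n b\<^esub> = loop_class ?C (b ` {..<n}) (\<lambda>t. g t ` {..<n})"
    using one p by (rule braids_with_permutationE)
  have "loopin ?C (b ` {..<n}) (\<lambda>_. b ` {..<n})"
    using b by (simp add: loopin_def topspace_unordered_config)
  then have "path_homotopic ?C (\<lambda>t. g t ` {..<n}) (\<lambda>_. b ` {..<n})"
    using eq[symmetric] loop by (simp add: braid_group_def fundamental_group_one loop_class_eq_iff)
  then have "path_homotopic (ordered_config M n) g (\<lambda>_. b)"
    using b g(2) by (intro config_homotopy_lift[OF M g(1)]) simp_all
  then have "permute_config n p b = b"
    using path_homotopicD(4) g(3) by metis
  then have "b (p i) = b i" if "i < n" for i
    using that unfolding permute_config_def by (metis lessThan_iff restrict_apply')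
  moreover have inj: "inj_on b {..<n}"
    using b by (simp add: topspace_ordered_config)
  ultimately have fixed: "p i = i" if "i < n" for i
    using that permutes_in_image[OF p, of i] inj_onD[OF inj, of "p i" i] by simp
  show ?thesis
  proof
    show "p i = id i" for i
      using fixed[of i] permutes_not_in[OF p, of i] by (cases "i < n") auto
  qed
qed

lemma braids_with_permutation_subset_subgroup:
  assumes H: "subgroup H (braid_group M n b)" "pure_braid_subgroup M n b \<subseteq> H"
    and p: "p permutes {..<n}" and c: "c \<in> H" "c \<in> braids_with_permutation M n b p"
    and b: "b \<in> topspace (ordered_config M n)"
  shows "braids_with_permutation M n b p \<subseteq> H"
proof
  let ?C = "unordered_config M n" and ?G = "braid_group M n b"
  interpret G: group ?G
    using b by (rule group_braid_group)
  fix x assume "x \<in> braids_with_permutation M n b p"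
  then obtain g where g: "pathin (ordered_config M n) g" "g 0 = b" "g 1 = permute_config n p b"
    and loop_g: "loopin ?C (b ` {..<n}) (\<lambda>t. g t ` {..<n})"
    and x: "x = loop_class ?C (b ` {..<n}) (\<lambda>t. g t ` {..<n})"
    using p by (rule braids_with_permutationE)
  obtain h where h: "pathin (ordered_config M n) h" "h 0 = b" "h 1 = permute_config n p b"
    and loop_h: "loopin ?C (b ` {..<n}) (\<lambda>t. h t ` {..<n})"
    and c_eq: "c = loop_class ?C (b ` {..<n}) (\<lambda>t. h t ` {..<n})"
    using c(2) p by (rule braids_with_permutationE)
  have rev: "loopin ?C (b ` {..<n}) (path_reverse (\<lambda>t. h t ` {..<n}))"
    using loop_h by (simp add: loopin_def)
  have "loopin (ordered_config M n) b (g \<frown> path_reverse h)"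
    using g h by (simp add: loopin_def)
  then have "loop_class ?C (b ` {..<n}) (\<lambda>t. (g \<frown> path_reverse h) t ` {..<n}) \<in> H"
    using H(2) unfolding pure_braid_subgroup_def by blast
  also have "(\<lambda>t. (g \<frown> path_reverse h) t ` {..<n}) =
      (\<lambda>t. g t ` {..<n}) \<frown> path_reverse (\<lambda>t. h t ` {..<n})"
    by (simp only: loop_join_image[of "\<lambda>z. z ` {..<n}"] path_reverse_image[of "\<lambda>z. z ` {..<n}"])
  also have "loop_class ?C (b ` {..<n}) \<dots> = x \<otimes>\<^bsub>?G\<^esub> inv\<^bsub>?G\<^esub> c"
    unfolding x c_eq braid_group_def loop_class_reverse[OF loop_h, symmetric]
    by (rule fundamental_group_mult[OF loop_g rev, symmetric])
  finally have "x \<otimes>\<^bsub>?G\<^esub> inv\<^bsub>?G\<^esub> c \<otimes>\<^bsub>?G\<^esub> c \<in> H"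
    using c(1) by (rule subgroup.m_closed[OF H(1)])
  moreover have "x \<in> carrier ?G" "c \<in> carrier ?G"
    using loop_class_in_fundamental_group[OF loop_g] subgroup.mem_carrier[OF H(1) c(1)]
    by (simp_all add: x braid_group_def)
  ultimately show "x \<in> H"
    by (simp add: G.m_assoc)
qed

lemma transport_class_braids_with_permutation:
  assumes \<nu>: "pathin (ordered_config M n) \<nu>" and p: "p permutes {..<n}"
    and c: "c \<in> braids_with_permutation M n (\<nu> 1) p"
  shows "transport_class (unordered_config M n) (\<lambda>t. \<nu> t ` {..<n}) c
      \<in> braids_with_permutation M n (\<nu> 0) p"
proof -
  let ?C = "unordered_config M n" and ?\<mu> = "\<lambda>t. \<nu> t ` {..<n}"
  obtain g where g: "pathin (ordered_config M n) g" "g 0 = \<nu> 1" "g 1 = permute_config n p (\<nu> 1)"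
    and loop: "loopin ?C (\<nu> 1 ` {..<n}) (\<lambda>t. g t ` {..<n})"
    and c: "c = loop_class ?C (\<nu> 1 ` {..<n}) (\<lambda>t. g t ` {..<n})"
    using c p by (rule braids_with_permutationE)
  let ?\<nu>' = "path_reverse (\<lambda>t. permute_config n p (\<nu> t))"
  have "pathin (ordered_config M n) (\<lambda>t. permute_config n p (\<nu> t))"
    using \<nu> continuous_map_permute_config[OF p] by (rule pathin_continuous_image)
  then have "pathin (ordered_config M n) (\<nu> \<frown> g \<frown> ?\<nu>')"
    using \<nu> g by simp
  then have "loop_class ?C (\<nu> 0 ` {..<n}) (\<lambda>t. (\<nu> \<frown> g \<frown> ?\<nu>') t ` {..<n}) \<in>
      braids_with_permutation M n (\<nu> 0) p"
    by (rule braids_with_permutationI) simp_all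
  also have "(\<lambda>t. (\<nu> \<frown> g \<frown> ?\<nu>') t ` {..<n}) = conj_loop ?\<mu> (\<lambda>t. g t ` {..<n})"
    by (simp add: loop_join_image[of "\<lambda>z. z ` {..<n}"] path_reverse_image[of "\<lambda>z. z ` {..<n}"]
        permute_config_image[OF p] conj_loop_def)
  also have "loop_class ?C (\<nu> 0 ` {..<n}) \<dots> = transport_class ?C ?\<mu> c"
    unfolding c using transport_class_loop_class[OF pathin_config_image[OF \<nu>] loop] by simp
  finally show ?thesis .
qed

section \<open>Non-orderability\<close>

lemma surface_infinite:
  assumes "surface_with_boundary M" "topspace M \<noteq> {}"
  shows "infinite (topspace M)"
proof -
  obtain e :: "complex \<Rightarrow> 'a" where e: "open_embedding UNIV M e"
    using chart_avoiding_finite[OF assms(1) finite.emptyI] assms(2) by auto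
  have "infinite (range e)"
    using open_embeddingD(3)[OF e] infinite_UNIV_char_0 by (simp add: finite_image_iff)
  moreover have "range e \<subseteq> topspace M"
    using open_embedding_in_topspace[OF e] by auto
  ultimately show ?thesis
    using finite_subset by blast
qed

lemma (in rotating_strands) rotation_braid_permutation:
  "rotation_braid \<in> braids_with_permutation M n (spin 0 0) p"
  unfolding rotation_braid_def rot_def[abs_def] using spin_add_one[of 0] pathin_spin(2)[of 1]
  by (intro braids_with_permutationI) simp_all

lemma (in rotating_strands) twist_braid_pure: "twist_braid \<in> pure_braid_subgroup M n (spin 0 0)"
  unfolding twist_braid_def twist_def[abs_def] pure_braid_subgroup_def
  using pathin_spin(1)[of 0] by (auto simp: loopin_def)

proposition ex_nonorderable_pair:
  assumes M: "surface_with_boundary M" "compact_space M" "connected_space M" and n: "3 \<le> n"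
    and b: "b \<in> topspace (ordered_config M n)" and p: "p permutes {..<n}" "p \<noteq> id"
  obtains x y where "x \<in> braids_with_permutation M n b p" "y \<in> pure_braid_subgroup M n b"
    "nonorderable_pair (braid_group M n b) x y"
proof -
  have "b \<in> {..<n} \<rightarrow>\<^sub>E topspace M"
    using b by (simp add: topspace_ordered_config)
  then have "b 0 \<in> topspace M"
    by (rule PiE_mem) (use n in simp)
  then have "\<not> topspace M \<subseteq> b ` {..<n}"
    using surface_infinite[OF M(1)] finite_subset by blast
  then obtain e :: "complex \<Rightarrow> 'a" where e: "open_embedding UNIV M e"
    and disj: "range e \<inter> b ` {..<n} = {}"
    by (rule chart_avoiding_finite[OF M(1) finite_imageI[OF finite_lessThan]])
  obtain l j where "l < n" "j < n" "moving_pair p l j"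
    using ex_moving_pair[OF p(1) n p(2)] by blast
  then interpret rotating_strands p l j M n e
    using M p(1) e by (simp add: rotating_strands_def rotating_strands_axioms_def)
  let ?z = "spin 0 0"
  have z: "?z \<in> topspace (ordered_config M n)"
    by (rule spin_in_config) simp
  have "b ` {..<n} \<inter> ?z ` {..<n} = {}"
    using disj by (auto simp: spin_def)
  then obtain \<nu> where \<nu>: "pathin (ordered_config M n) \<nu>" "\<nu> 0 = b" "\<nu> 1 = ?z"
    using path_component_of_disjoint_configs[OF M(1,3) b z] unfolding path_component_of_def by blast
  let ?T = "transport_class (unordered_config M n) (\<lambda>t. \<nu> t ` {..<n})"
  have "?T rotation_braid \<in> braids_with_permutation M n b p"
    using transport_class_braids_with_permutation[OF \<nu>(1) p(1)] rotation_braid_permutation \<nu>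
    by simp
  moreover have "?T twist_braid \<in> pure_braid_subgroup M n b"
    using transport_class_braids_with_permutation[OF \<nu>(1) permutes_id] twist_braid_pure
    by (simp add: \<nu> pure_braid_subgroup_eq[OF b] pure_braid_subgroup_eq[OF z])
  moreover have "?T \<in> hom B (braid_group M n b)" "inj_on ?T (carrier B)"
    using transport_class_hom[OF pathin_config_image[OF \<nu>(1)]]
      inj_on_transport_class[OF pathin_config_image[OF \<nu>(1)]] by (simp_all add: \<nu> braid_group_def)
  then have "nonorderable_pair (braid_group M n b) (?T rotation_braid) (?T twist_braid)"
    using nonorderable_pair_hom[OF B.group_axioms group_braid_group[OF b]]
      nonorderable_pair_rotation_twist by simp
  ultimately show thesis
    by (rule that)
qed

theorem theorem2:
  fixes M :: "'a topology" and n :: nat and b :: "nat \<Rightarrow> 'a"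
    and H :: "(real \<Rightarrow> 'a set) set set"
  assumes "n \<ge> 3"
    and "surface_with_boundary M" and "compact_space M" and "connected_space M"
    and "\<not> (M homeomorphic_space sphere2)"
    and "\<not> (M homeomorphic_space real_projective_plane)"
    and "b \<in> topspace (ordered_config M n)"
    and "subgroup H (braid_group M n b)"
    and "pure_braid_subgroup M n b \<subset> H"
  shows "\<not> biorderable ((braid_group M n b)\<lparr>carrier := H\<rparr>)"
proof
  let ?B = "braid_group M n b" and ?G = "(braid_group M n b)\<lparr>carrier := H\<rparr>"
  assume bi: "biorderable ?G"
  have Hausdorff: "Hausdorff_space M"
    using assms(2) by (simp add: surface_with_boundary_def)
  have G: "group ?G"
    using assms(8) group_braid_group[OF assms(7)] by (rule subgroup.subgroup_is_group)
  obtain c where c: "c \<in> H" "c \<notin> pure_braid_subgroup M n b"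
    using assms(9) by blast
  then obtain p where p: "p permutes {..<n}" "c \<in> braids_with_permutation M n b p"
    using braid_has_permutation[OF Hausdorff assms(7)] subgroup.mem_carrier[OF assms(8)] by blast
  have "p \<noteq> id"
    using c p pure_braid_subgroup_eq[OF assms(7)] by metis
  then obtain x y where xy: "x \<in> braids_with_permutation M n b p" "y \<in> pure_braid_subgroup M n b"
    and pair: "nonorderable_pair ?B x y"
    by (rule ex_nonorderable_pair[OF assms(2-4,1,7) p(1)])
  have "x \<in> H" "y \<in> H"
    using braids_with_permutation_subset_subgroup[OF assms(8) _ p(1) c(1) p(2) assms(7)]
      xy assms(9) by blast+
  then have "x = \<one>\<^bsub>?B\<^esub>"
    using biorderable_nonorderable_pair[OF G bi, of x y] pair
    by (simp add: nonorderable_pair_subgroup)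
  then show False
    using one_in_braids_with_permutation[OF Hausdorff assms(7) p(1)] xy(1) \<open>p \<noteq> id\<close> by simp
qed

end
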